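(* For all positive integers $q,k,c$ there exists a number $f(q,k,c)$, depending only on $q,k,c$, with the following property. Let $A$ be a torsion-free (additively written) abelian group and $L=\bigoplus_{a\in A}L_a$ an $A$-graded Lie algebra such that $L_0$ is ad-nilpotent of index $k$, i.e. $[L,\underbrace{L_0,\ldots,L_0}_{k}]=0$. Assume that $L$ admits a finite group $H$ of double automorphisms with $|H|=q$ such that $C_A(h)=0$ for all nontrivial $h\in H$ and $C_L(H)$ is nilpotent of class $c$. Then $L$ is nilpotent of class at most $f(q,k,c)$.
   Context: A Lie algebra means a Lie algebra over some commutative ring with unity. An $A$-graded Lie algebra is a Lie algebra $L=\bigoplus_{a\in A}L_a$ where the $L_a$ are subspaces (submodules) with $[L_a,L_b]\subseteq L_{a+b}$ for all $a,b\in A$. Commutators are left-normed: $[x_1,x_2,\ldots,x_n]=[\ldots[[x_1,x_2],x_3],\ldots,x_n]$, and $[L,K,\ldots,K]$ denotes the span of the corresponding commutators. A subspace $K$ of $L$ is ad-nilpotent of index (at most) $n$ if $[L,\underbrace{K,\ldots,K}_{n}]=0$. A double automorphism of $L$ is an automorphism $\phi$ of the Lie algebra $L$ that permutes the grading components in such a way that $L_a^\phi=L_{a^\phi}$ for all $a\in A$, where $a\mapsto a^\phi$ is an automorphism of the group $A$. A group $H$ of double automorphisms of $L$ is a group of automorphisms of $L$ which in this way acts on $A$ by group automorphisms, with $L_a^h=L_{a^h}$ for all $a\in A$, $h\in H$. One writes $C_L(H)=\{l\in L: l^h=l \text{ for all } h\in H\}$ and $C_A(h)=\{a\in A: a^h=a\}$.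 *)

theory Defs
  imports "HOL-Algebra.Module" "HOL-Algebra.Bij"
begin

section \<open>Lie algebras over a commutative ring\<close>

record ('r, 'l) lie_algebra = "('r, 'l) module" +
  bracket :: "'l \<Rightarrow> 'l \<Rightarrow> 'l"

text \<open>The ring multiplication and unit that the record inherits from \<open>module\<close> play no role.\<close>

locale lie_algebra = module R L
  for R :: "('r, 'm) ring_scheme" (structure) and L :: "('r, 'l, 'n) lie_algebra_scheme" (structure) +
  assumes bracket_closed:
      "\<lbrakk>x \<in> carrier L; y \<in> carrier L\<rbrakk> \<Longrightarrow> bracket L x y \<in> carrier L"
    and bracket_add_left:
      "\<lbrakk>x \<in> carrier L; y \<in> carrier L; z \<in> carrier L\<rbrakk> \<Longrightarrow>
        bracket L (x \<oplus>\<^bsub>L\<^esub> y) z = bracket L x z \<oplus>\<^bsub>L\<^esub> bracket L y z"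
    and bracket_add_right:
      "\<lbrakk>x \<in> carrier L; y \<in> carrier L; z \<in> carrier L\<rbrakk> \<Longrightarrow>
        bracket L x (y \<oplus>\<^bsub>L\<^esub> z) = bracket L x y \<oplus>\<^bsub>L\<^esub> bracket L x z"
    and bracket_smult_left:
      "\<lbrakk>r \<in> carrier R; x \<in> carrier L; y \<in> carrier L\<rbrakk> \<Longrightarrow>
        bracket L (r \<odot>\<^bsub>L\<^esub> x) y = r \<odot>\<^bsub>L\<^esub> bracket L x y"
    and bracket_smult_right:
      "\<lbrakk>r \<in> carrier R; x \<in> carrier L; y \<in> carrier L\<rbrakk> \<Longrightarrow>
        bracket L x (r \<odot>\<^bsub>L\<^esub> y) = r \<odot>\<^bsub>L\<^esub> bracket L x y"
    and bracket_self:
      "x \<in> carrier L \<Longrightarrow> bracket L x x = \<zero>\<^bsub>L\<^esub>"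
    and jacobi:
      "\<lbrakk>x \<in> carrier L; y \<in> carrier L; z \<in> carrier L\<rbrakk> \<Longrightarrow>
        bracket L (bracket L x y) z \<oplus>\<^bsub>L\<^esub> bracket L (bracket L y z) x
          \<oplus>\<^bsub>L\<^esub> bracket L (bracket L z x) y = \<zero>\<^bsub>L\<^esub>"

definition submodule_span ::
    "('r, 'm) ring_scheme \<Rightarrow> ('r, 'l, 'n) module_scheme \<Rightarrow> 'l set \<Rightarrow> 'l set" where
  "submodule_span R L S = \<Inter>{N. submodule N R L \<and> S \<subseteq> N}"

text \<open>The left-normed commutator \<open>[x, y\<^sub>1, \<dots>, y\<^sub>n]\<close> is \<open>foldl (bracket L) x [y\<^sub>1, \<dots>, y\<^sub>n]\<close>;
  \<open>commutator_span R L U K n\<close> is \<open>[U, K, \<dots>, K]\<close> with \<open>n\<close> copies of \<open>K\<close>.\<close>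

definition commutator_span ::
    "('r, 'm) ring_scheme \<Rightarrow> ('r, 'l, 'n) lie_algebra_scheme \<Rightarrow> 'l set \<Rightarrow> 'l set \<Rightarrow> nat \<Rightarrow> 'l set" where
  "commutator_span R L U K n =
     submodule_span R L {foldl (bracket L) x ys | x ys. x \<in> U \<and> set ys \<subseteq> K \<and> length ys = n}"

definition ad_nilpotent ::
    "('r, 'm) ring_scheme \<Rightarrow> ('r, 'l, 'n) lie_algebra_scheme \<Rightarrow> 'l set \<Rightarrow> nat \<Rightarrow> bool" where
  "ad_nilpotent R L K n \<longleftrightarrow> commutator_span R L (carrier L) K n = {\<zero>\<^bsub>L\<^esub>}"

text \<open>Nilpotency of class at most \<open>c\<close> of a subalgebra \<open>K\<close>: all commutators of weight \<open>c + 1\<close> in \<open>K\<close> vanish.\<close>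

definition nilpotent_of_class ::
    "('r, 'm) ring_scheme \<Rightarrow> ('r, 'l, 'n) lie_algebra_scheme \<Rightarrow> 'l set \<Rightarrow> nat \<Rightarrow> bool" where
  "nilpotent_of_class R L K c \<longleftrightarrow> commutator_span R L K K c = {\<zero>\<^bsub>L\<^esub>}"


section \<open>Gradings and double automorphisms\<close>

text \<open>The grading group is written multiplicatively, as commutative groups are in HOL-Algebra:
  \<open>a \<otimes>\<^bsub>A\<^esub> b\<close> stands for \<open>a + b\<close> and \<open>\<one>\<^bsub>A\<^esub>\<close> for \<open>0\<close>.\<close>

definition torsion_free :: "('a, 'p) monoid_scheme \<Rightarrow> bool" where
  "torsion_free A \<longleftrightarrow> (\<forall>a\<in>carrier A. \<forall>n::nat. n > 0 \<and> a [^]\<^bsub>A\<^esub> n = \<one>\<^bsub>A\<^esub> \<longrightarrow> a = \<one>\<^bsub>A\<^esub>)"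

locale graded_lie_algebra = lie_algebra R L + A: comm_group A
  for R :: "('r, 'm) ring_scheme" (structure)
    and L :: "('r, 'l, 'n) lie_algebra_scheme" (structure)
    and A :: "('a, 'p) monoid_scheme" (structure) +
  fixes G :: "'a \<Rightarrow> 'l set"
  assumes component_submodule: "a \<in> carrier A \<Longrightarrow> submodule (G a) R L"
    and direct_sum: "x \<in> carrier L \<Longrightarrow>
      \<exists>!u. u \<in> (\<Pi>\<^sub>E a\<in>carrier A. G a) \<and> finite {a \<in> carrier A. u a \<noteq> \<zero>\<^bsub>L\<^esub>}
         \<and> x = (\<Oplus>\<^bsub>L\<^esub>a\<in>{a \<in> carrier A. u a \<noteq> \<zero>\<^bsub>L\<^esub>}. u a)"
    and bracket_component:
      "\<lbrakk>a \<in> carrier A; b \<in> carrier A; x \<in> G a; y \<in> G b\<rbrakk> \<Longrightarrow> bracket L x y \<in> G (a \<otimes>\<^bsub>A\<^esub> b)"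

definition lie_auto ::
    "('r, 'm) ring_scheme \<Rightarrow> ('r, 'l, 'n) lie_algebra_scheme \<Rightarrow> ('l \<Rightarrow> 'l) set" where
  "lie_auto R L = {\<phi> \<in> Bij (carrier L).
     (\<forall>x\<in>carrier L. \<forall>y\<in>carrier L. \<phi> (x \<oplus>\<^bsub>L\<^esub> y) = \<phi> x \<oplus>\<^bsub>L\<^esub> \<phi> y) \<and>
     (\<forall>r\<in>carrier R. \<forall>x\<in>carrier L. \<phi> (r \<odot>\<^bsub>L\<^esub> x) = r \<odot>\<^bsub>L\<^esub> \<phi> x) \<and>
     (\<forall>x\<in>carrier L. \<forall>y\<in>carrier L. \<phi> (bracket L x y) = bracket L (\<phi> x) (\<phi> y))}"

text \<open>The map \<open>\<alpha>\<close> induced on \<open>A\<close> is carried along explicitly, because \<open>\<phi>\<close> alone does not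
  determine it on those \<open>a\<close> for which the component \<open>G a\<close> is zero.\<close>

definition double_automorphism ::
    "('r, 'm) ring_scheme \<Rightarrow> ('r, 'l, 'n) lie_algebra_scheme \<Rightarrow> ('a, 'p) monoid_scheme \<Rightarrow> ('a \<Rightarrow> 'l set)
      \<Rightarrow> ('l \<Rightarrow> 'l) \<Rightarrow> ('a \<Rightarrow> 'a) \<Rightarrow> bool" where
  "double_automorphism R L A G \<phi> \<alpha> \<longleftrightarrow>
     \<phi> \<in> lie_auto R L \<and> \<alpha> \<in> auto A \<and> (\<forall>a\<in>carrier A. \<phi> ` G a = G (\<alpha> a))"

definition double_automorphism_group ::
    "('r, 'm) ring_scheme \<Rightarrow> ('r, 'l, 'n) lie_algebra_scheme \<Rightarrow> ('a, 'p) monoid_scheme \<Rightarrow> ('a \<Rightarrow> 'l set)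
      \<Rightarrow> ('l \<Rightarrow> 'l) set \<Rightarrow> (('l \<Rightarrow> 'l) \<Rightarrow> 'a \<Rightarrow> 'a) \<Rightarrow> bool" where
  "double_automorphism_group R L A G H act \<longleftrightarrow>
     subgroup H (BijGroup (carrier L)) \<and>
     act \<in> hom (BijGroup (carrier L)\<lparr>carrier := H\<rparr>) (AutoGroup A) \<and>
     (\<forall>h\<in>H. double_automorphism R L A G h (act h))"

definition fixed_subalgebra ::
    "('r, 'l, 'n) lie_algebra_scheme \<Rightarrow> ('l \<Rightarrow> 'l) set \<Rightarrow> 'l set" where
  "fixed_subalgebra L H = {x \<in> carrier L. \<forall>h\<in>H. h x = x}"

text \<open>No nontrivial element of \<open>H\<close> fixes a nonzero element of \<open>A\<close>.\<close>

definition fixed_point_free ::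
    "('r, 'l, 'n) lie_algebra_scheme \<Rightarrow> ('a, 'p) monoid_scheme
      \<Rightarrow> ('l \<Rightarrow> 'l) set \<Rightarrow> (('l \<Rightarrow> 'l) \<Rightarrow> 'a \<Rightarrow> 'a) \<Rightarrow> bool" where
  "fixed_point_free L A H act \<longleftrightarrow>
     (\<forall>h\<in>H. h \<noteq> \<one>\<^bsub>BijGroup (carrier L)\<^esub> \<longrightarrow> {a \<in> carrier A. act h a = a} = {\<one>\<^bsub>A\<^esub>})"


section \<open>The bound on the nilpotency class\<close>

text \<open>The standing hypotheses, with \<open>q = |H|\<close>, the index \<open>k\<close> of ad-nilpotency of the zero
  component, and the class \<open>c\<close> of the fixed points.\<close>

definition double_automorphism_hyps ::
    "nat \<Rightarrow> nat \<Rightarrow> nat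
      \<Rightarrow> ('r, 'm) ring_scheme \<Rightarrow> ('r, 'l, 'n) lie_algebra_scheme \<Rightarrow> ('a, 'p) monoid_scheme \<Rightarrow> ('a \<Rightarrow> 'l set)
      \<Rightarrow> ('l \<Rightarrow> 'l) set \<Rightarrow> (('l \<Rightarrow> 'l) \<Rightarrow> 'a \<Rightarrow> 'a) \<Rightarrow> bool" where
  "double_automorphism_hyps q k c R L A G H act \<longleftrightarrow>
     graded_lie_algebra R L A G \<and>
     torsion_free A \<and>
     ad_nilpotent R L (G \<one>\<^bsub>A\<^esub>) k \<and>
     double_automorphism_group R L A G H act \<and>
     finite H \<and> card H = q \<and>
     fixed_point_free L A H act \<and>
     nilpotent_of_class R L (fixed_subalgebra L H) c"

text \<open>In a polymorphic statement \<open>\<exists>f. \<forall>R L A. \<dots>\<close> the function \<open>f\<close> may depend on the types over which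
  \<open>R\<close>, \<open>L\<close> and \<open>A\<close> range. To say that the bound depends on \<open>q\<close>, \<open>k\<close>, \<open>c\<close> only, it has to be a constant
  without type parameters. The constant chosen is the least bound valid for the structures whose
  carriers are subsets of fixed countable types. It loses nothing: if a Lie algebra \<open>L\<close> as above is not
  nilpotent of class \<open>n\<close>, then finitely many homogeneous elements, chosen so as to witness this and
  the faithfulness of \<open>H\<close>, generate together with their images under \<open>H\<close> a countable graded Lie ring
  that satisfies the same hypotheses and is not nilpotent of class \<open>n\<close>.\<close>

definition class_bound :: "nat \<Rightarrow> nat \<Rightarrow> nat \<Rightarrow> nat" where
  "class_bound q k c = (LEAST n.
     \<forall>(R :: int ring) (L :: (int, nat) lie_algebra) (A :: nat monoid) G H act.
       double_automorphism_hyps q k c R L A G H act \<longrightarrow> nilpotent_of_class R L (carrier L) n)"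

end

theory Submission
  imports Defs "HOL-Algebra.IntRing" "HOL-Algebra.Generated_Groups"
    "HOL-Library.Multiset" "HOL-Library.Countable_Set"
begin

text \<open>
  Write \<open>A\<close> additively. Call a sequence of weights \<open>d\<^sub>1, \<dots>, d\<^sub>n\<close> independent if
  \<open>h\<^sub>1 d\<^sub>1 + \<dots> + h\<^sub>n d\<^sub>n = d\<^sub>1 + \<dots> + d\<^sub>n\<close> with \<open>h\<^sub>i \<in> H\<close> forces all \<open>h\<^sub>i\<close> to be trivial.
  Sums over \<open>H\<close>-orbits are fixed points. A commutator of \<open>c + 1\<close> orbit sums vanishes, and for an
  independent sequence of weights the only summand of total weight \<open>d\<^sub>1 + \<dots> + d\<^sub>n\<close> in its expansion is
  the untwisted one. So every commutator of \<open>c + 1\<close> homogeneous elements with independent weights is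
  zero (\<open>selective_if_orbit_sums_nilpotent\<close>), and it remains to remove the restriction to independent
  weights. This is done by induction on \<open>c\<close> (\<open>selective_nilpotent\<close>): it suffices that the ideal
  generated by a commutator \<open>U\<close> of \<open>c\<close> homogeneous elements with independent weights is annihilated
  by boundedly many entries from \<open>L\<close>, since modulo all such ideals the hypothesis holds with \<open>c - 1\<close>
  for \<open>c\<close>. All statements are therefore made relative to a homogeneous ideal \<open>X\<close>.

  The ideal generated by \<open>U\<close> has boundedly many nonzero components
  (\<open>independent_commutator_nilpotent\<close>). Only boundedly many weights \<open>i\<close> extend the weights of \<open>U\<close>
  to a dependent sequence (\<open>dependent_extensions\<close>), because \<open>h - 1\<close> is injective on \<open>A\<close> for every
  nontrivial \<open>h\<close>. All other weights annihilate \<open>U\<close>. Entries of \<open>[U, \<dots>]\<close> may be permuted at the cost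
  of shorter commutators of the same weight (\<open>com_collect\<close>), so that only entries with the
  exceptional weights matter. Each of these occurs boundedly often, because \<open>[L, L\<^sub>b, \<dots>, L\<^sub>b] = 0\<close>
  (\<open>selective_engel\<close>): for \<open>b = 0\<close> this is assumed, and for \<open>b \<noteq> 0\<close> the constant sequence \<open>b, \<dots>, b\<close> is independent
  (\<open>indep_replicate\<close>), whence so is \<open>a + tb, b, \<dots>, b\<close> for all but boundedly many \<open>t\<close>.

  Finally, if \<open>L\<close> acts on something graded with boundedly many components and \<open>L\<^sub>0\<close> acts
  nilpotently, then \<open>L\<close> acts nilpotently (\<open>bounded_support_nilpotent\<close>). Here torsion-freeness gives a
  total order on \<open>A\<close>. On the component of the largest weight the entries of positive weight act as
  zero, so a product of total weight zero acts on it like a combination of products of elements of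
  \<open>L\<^sub>0\<close>. This allows
  the largest weight to be removed from the support.

  This proves the result with an explicit bound. The bound in the theorem is defined through countable
  structures only, so the second part of the development shows that a nonzero commutator in \<open>L\<close>
  survives in a countable substructure, which can be copied to the natural numbers.
\<close>

section \<open>Translation-invariant orders on torsion-free abelian groups\<close>

context comm_group
begin

text \<open>A translation-invariant partial order is given by the set \<open>P\<close> of its elements above the
  unit: \<open>a\<close> is above \<open>b\<close> iff \<open>a \<otimes> inv b\<close> lies in \<open>P\<close>.\<close>

definition order_cone :: "'a set \<Rightarrow> bool" where
  "order_cone P \<longleftrightarrow> P \<subseteq> carrier G \<and> \<one> \<in> P \<and> (\<forall>a\<in>P. \<forall>b\<in>P. a \<otimes> b \<in> P) \<and>
     (\<forall>a\<in>P. inv a \<in> P \<longrightarrow> a = \<one>)"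

definition total_cone :: "'a set \<Rightarrow> bool" where
  "total_cone P \<longleftrightarrow> order_cone P \<and> (\<forall>a\<in>carrier G. a \<in> P \<or> inv a \<in> P)"

lemma order_cone_pow_closed:
  assumes "order_cone P" "a \<in> P"
  shows "a [^] (n::nat) \<in> P"
  using assms by (induction n) (auto simp: order_cone_def)

text \<open>The cone generated by \<open>P\<close> and \<open>b\<close> is larger than \<open>P\<close>, so by maximality it contains a nontrivial
  element together with its inverse. Their product is trivial, and this exhibits the inverse of a power
  of \<open>b\<close> as an element of \<open>P\<close>.\<close>

lemma order_cone_extend:
  assumes P: "order_cone P" and b: "b \<in> carrier G"
    and max: "\<And>Q. order_cone Q \<Longrightarrow> P \<subseteq> Q \<Longrightarrow> Q = P" and "b \<notin> P"
  shows "\<exists>n>0. inv (b [^] (n::nat)) \<in> P"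
proof -
  define Q where "Q = {p \<otimes> b [^] (n::nat) | p n. p \<in> P}"
  have sub: "P \<subseteq> carrier G" and one: "\<one> \<in> P" and mult: "\<And>x y. x \<in> P \<Longrightarrow> y \<in> P \<Longrightarrow> x \<otimes> y \<in> P"
    and pointed: "\<And>x. x \<in> P \<Longrightarrow> inv x \<in> P \<Longrightarrow> x = \<one>"
    using P by (auto simp: order_cone_def)
  have PQ: "P \<subseteq> Q"
  proof
    fix p assume "p \<in> P"
    then have "p = p \<otimes> b [^] (0::nat)" using sub by auto
    then show "p \<in> Q" using \<open>p \<in> P\<close> unfolding Q_def by blast
  qed
  have "b = \<one> \<otimes> b [^] (1::nat)" using b by simp
  then have "b \<in> Q" using one unfolding Q_def by blast
  then have "\<not> order_cone Q" using max PQ \<open>b \<notin> P\<close> by blast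
  moreover have "Q \<subseteq> carrier G" using sub b by (auto simp: Q_def)
  moreover have "\<one> \<in> Q" using PQ one by auto
  moreover have "x \<otimes> y \<in> Q" if xQ: "x \<in> Q" and yQ: "y \<in> Q" for x y
  proof -
    obtain p n where x: "x = p \<otimes> b [^] (n::nat)" "p \<in> P"
      using xQ unfolding Q_def by blast
    obtain p' n' where y: "y = p' \<otimes> b [^] (n'::nat)" "p' \<in> P"
      using yQ unfolding Q_def by blast
    note xy = x(1) y(1) x(2) y(2)
    have c: "p \<in> carrier G" "p' \<in> carrier G" using xy sub by auto
    have "x \<otimes> y = (p \<otimes> p') \<otimes> b [^] (n + n')"
      using xy c b by (simp add: nat_pow_mult[symmetric] m_ac)
    then show ?thesis using mult[OF xy(3,4)] unfolding Q_def by blast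
  qed
  ultimately obtain x where x: "x \<in> Q" "inv x \<in> Q" "x \<noteq> \<one>"
    unfolding order_cone_def by blast
  obtain p n where p: "x = p \<otimes> b [^] (n::nat)" "p \<in> P"
    using x(1) unfolding Q_def by blast
  obtain p' n' where p': "inv x = p' \<otimes> b [^] (n'::nat)" "p' \<in> P"
    using x(2) unfolding Q_def by blast
  note xy = p(1) p'(1) p(2) p'(2)
  have c: "p \<in> carrier G" "p' \<in> carrier G" using xy sub by auto
  have xc: "x \<in> carrier G" using xy c b by simp
  have "\<one> = x \<otimes> inv x" using xc by simp
  also have "\<dots> = (p \<otimes> b [^] n) \<otimes> (p' \<otimes> b [^] n')"
    using xy by metis
  also have "\<dots> = (p \<otimes> p') \<otimes> b [^] (n + n')"
    using c b by (simp add: nat_pow_mult[symmetric] m_ac)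
  finally have "inv (b [^] (n + n')) = p \<otimes> p'"
    using c b by (metis inv_equality m_closed nat_pow_closed)
  then have *: "inv (b [^] (n + n')) \<in> P" using mult xy by simp
  have "n + n' > 0"
  proof (rule ccontr)
    assume "\<not> n + n' > 0"
    then have "x = p" "inv x = p'" using xy c by simp_all
    then show False using pointed x xy by metis
  qed
  with * show ?thesis by blast
qed

text \<open>A maximal cone is total: otherwise some \<open>a\<close> has a power and the inverse of a power in it,
  so that a power of \<open>a\<close> is trivial.\<close>

lemma torsion_free_orderable:
  assumes tf: "torsion_free G"
  shows "\<exists>P. total_cone P"
proof -
  have "\<exists>M\<in>{P. order_cone P}. \<forall>X\<in>{P. order_cone P}. M \<subseteq> X \<longrightarrow> X = M"
  proof (rule subset_Zorn_nonempty)
    have "order_cone {\<one>}" by (simp add: order_cone_def)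
    then show "{P. order_cone P} \<noteq> {}" by blast
  next
    fix C assume ne: "C \<noteq> {}" and ch: "subset.chain {P. order_cone P} C"
    have o: "order_cone X" if "X \<in> C" for X
      using ch that unfolding subset_chain_def by blast
    have lin: "X \<subseteq> Y \<or> Y \<subseteq> X" if "X \<in> C" "Y \<in> C" for X Y
      using ch that unfolding subset_chain_def by blast
    have "\<Union>C \<subseteq> carrier G" using o unfolding order_cone_def by blast
    moreover have "\<one> \<in> \<Union>C" using o ne unfolding order_cone_def by blast
    moreover have "a \<otimes> b \<in> \<Union>C" if ab: "a \<in> \<Union>C" "b \<in> \<Union>C" for a b
    proof -
      obtain X Y where "X \<in> C" "Y \<in> C" "a \<in> X" "b \<in> Y" using ab by blast
      with lin[of X Y] obtain Z where "Z \<in> C" "a \<in> Z" "b \<in> Z" by blast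
      then show ?thesis using o unfolding order_cone_def by blast
    qed
    moreover have "a = \<one>" if ab: "a \<in> \<Union>C" "inv a \<in> \<Union>C" for a
    proof -
      obtain X Y where "X \<in> C" "Y \<in> C" "a \<in> X" "inv a \<in> Y" using ab by blast
      with lin[of X Y] obtain Z where "Z \<in> C" "a \<in> Z" "inv a \<in> Z" by blast
      then show ?thesis using o unfolding order_cone_def by blast
    qed
    ultimately have "order_cone (\<Union>C)" unfolding order_cone_def by blast
    then show "\<Union>C \<in> {P. order_cone P}" by simp
  qed
  then obtain M where M: "order_cone M" and max: "\<And>X. order_cone X \<Longrightarrow> M \<subseteq> X \<Longrightarrow> X = M"
    by blast
  have "a \<in> M \<or> inv a \<in> M" if a: "a \<in> carrier G" for a
  proof (rule ccontr)
    assume "\<not> (a \<in> M \<or> inv a \<in> M)"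
    then have n: "a \<notin> M" "inv a \<notin> M" by auto
    obtain m where m: "m > 0" "inv (a [^] (m::nat)) \<in> M"
      using order_cone_extend[OF M a max n(1)] by blast
    obtain m' where m': "m' > 0" "inv (inv a [^] (m'::nat)) \<in> M"
      using order_cone_extend[OF M inv_closed[OF a] max n(2)] by blast
    have "inv (a [^] m) [^] m' \<in> M" using order_cone_pow_closed[OF M m(2)] .
    moreover have "inv (a [^] m) [^] m' = inv (a [^] (m * m'))"
      using nat_pow_inv[of "a [^] m" m'] nat_pow_pow[OF a, of m m'] a by simp
    moreover have "inv (inv a [^] m') [^] m \<in> M" using order_cone_pow_closed[OF M m'(2)] .
    moreover have "inv (inv a [^] m') [^] m = a [^] (m * m')"
      using nat_pow_inv[OF a, of m'] nat_pow_pow[OF a, of m' m] a by (simp add: mult.commute)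
    ultimately have "a [^] (m * m') = \<one>"
      using M unfolding order_cone_def by metis
    then have "a = \<one>" using tf a m(1) m'(1) unfolding torsion_free_def
      by (metis nat_0_less_mult_iff)
    then show False using n(1) M by (simp add: order_cone_def)
  qed
  then have "total_cone M" using M by (simp add: total_cone_def)
  then show ?thesis by blast
qed

lemma total_cone_max:
  assumes P: "total_cone P" and "finite S" "S \<noteq> {}" "S \<subseteq> carrier G"
  shows "\<exists>s\<in>S. \<forall>t\<in>S. s \<otimes> inv t \<in> P"
  using assms(2-4)
proof (induction S rule: finite_ne_induct)
  case (singleton x)
  then show ?case using P by (simp add: total_cone_def order_cone_def)
next
  case (insert x F)
  then obtain s where s: "s \<in> F" "\<forall>t\<in>F. s \<otimes> inv t \<in> P" by auto
  have c: "s \<in> carrier G" "x \<in> carrier G" using s insert by auto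
  have P': "\<one> \<in> P" "\<And>a b. a \<in> P \<Longrightarrow> b \<in> P \<Longrightarrow> a \<otimes> b \<in> P"
    using P by (auto simp: total_cone_def order_cone_def)
  show ?case
  proof (cases "s \<otimes> inv x \<in> P")
    case True then show ?thesis using s by auto
  next
    case False
    then have "inv (s \<otimes> inv x) \<in> P" using P c by (auto simp: total_cone_def)
    then have xs: "x \<otimes> inv s \<in> P" using c by (simp add: inv_mult_group)
    have "x \<otimes> inv t \<in> P" if t: "t \<in> F" for t
    proof -
      have tc: "t \<in> carrier G" using t insert by auto
      have "x \<otimes> inv t = (x \<otimes> inv s) \<otimes> (s \<otimes> inv t)"
        using c tc by (metis inv_closed inv_solve_right m_assoc m_closed)
      then show ?thesis using P'(2)[OF xs] s t by auto
    qed
    then show ?thesis using c P'(1) by auto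
  qed
qed

definition wt :: "'a list \<Rightarrow> 'a" where
  "wt bs = foldr (\<otimes>) bs \<one>"

lemma wt_Nil [simp]: "wt [] = \<one>"
  and wt_Cons [simp]: "wt (b # bs) = b \<otimes> wt bs"
  by (simp_all add: wt_def)

lemma wt_closed [simp, intro]: "set bs \<subseteq> carrier G \<Longrightarrow> wt bs \<in> carrier G"
  by (induction bs) auto

lemma wt_append:
  "set bs \<subseteq> carrier G \<Longrightarrow> set cs \<subseteq> carrier G \<Longrightarrow> wt (bs @ cs) = wt bs \<otimes> wt cs"
  by (induction bs) (auto simp: m_assoc)

lemma wt_mset_cong:
  assumes "mset bs = mset cs" "set bs \<subseteq> carrier G"
  shows "wt bs = wt cs"
  using assms
proof (induction bs arbitrary: cs)
  case (Cons b bs)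
  then have "b \<in> set cs" by (metis list.set_intros(1) mset_eq_setD)
  then obtain xs ys where cs: "cs = xs @ b # ys" by (meson split_list)
  then have eq: "mset bs = mset (xs @ ys)" using Cons.prems by simp
  have "set (xs @ ys) \<subseteq> carrier G"
    using Cons.prems cs by (metis eq insert_subset list.simps(15) mset_eq_setD)
  then show ?case using Cons.IH[OF eq] Cons.prems cs
    by (simp add: wt_append m_lcomm)
qed simp

lemma wt_map_inv: "set bs \<subseteq> carrier G \<Longrightarrow> wt (map (m_inv G) bs) = inv (wt bs)"
  by (induction bs) (auto simp: inv_mult)

lemma wt_replicate: "b \<in> carrier G \<Longrightarrow> wt (replicate n b) = b [^] n"
  by (induction n) (auto simp: m_comm)

lemma wt_trivial_if_all_positive:
  assumes P: "order_cone P" and "set bs \<subseteq> P" "wt bs = \<one>"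
  shows "set bs \<subseteq> {\<one>}"
  using assms(2,3)
proof (induction bs)
  case (Cons b bs)
  have sub: "P \<subseteq> carrier G" using P by (simp add: order_cone_def)
  have "wt bs \<in> P" if "set bs \<subseteq> P" for bs
    using that P by (induction bs) (auto simp: order_cone_def)
  then have "wt bs \<in> P" using Cons by auto
  moreover have "inv (wt bs) = b"
    using Cons.prems sub by (intro inv_equality) auto
  ultimately have "wt bs = \<one>" using P Cons.prems by (auto simp: order_cone_def)
  then show ?case using Cons sub by auto
qed simp

end


section \<open>Independent sequences\<close>

locale fpf_action = comm_group A
  for A :: "('a, 'p) monoid_scheme" (structure) +
  fixes H :: "'h set" and e :: 'h and act :: "'h \<Rightarrow> 'a \<Rightarrow> 'a"
  assumes torsion_free: "torsion_free A"
    and finite_H: "finite H"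
    and e_in: "e \<in> H"
    and act_e: "a \<in> carrier A \<Longrightarrow> act e a = a"
    and act_hom: "h \<in> H \<Longrightarrow> act h \<in> hom A A"
    and act_inj: "h \<in> H \<Longrightarrow> inj_on (act h) (carrier A)"
    and act_comp: "g \<in> H \<Longrightarrow> h \<in> H \<Longrightarrow> \<exists>f\<in>H. \<forall>a\<in>carrier A. act g (act h a) = act f a"
    and fpf: "h \<in> H \<Longrightarrow> h \<noteq> e \<Longrightarrow> a \<in> carrier A \<Longrightarrow> act h a = a \<Longrightarrow> a = \<one>"
begin

lemma act_closed [simp, intro]: "h \<in> H \<Longrightarrow> a \<in> carrier A \<Longrightarrow> act h a \<in> carrier A"
  using act_hom by (auto simp: hom_def)

lemma act_mult:
  "h \<in> H \<Longrightarrow> a \<in> carrier A \<Longrightarrow> b \<in> carrier A \<Longrightarrow> act h (a \<otimes> b) = act h a \<otimes> act h b"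
  using act_hom by (auto simp: hom_def)

lemma act_inv: "h \<in> H \<Longrightarrow> a \<in> carrier A \<Longrightarrow> act h (inv a) = inv (act h a)"
  using act_hom group_hom.hom_inv[of A A "act h" a] is_group
  by (simp add: group_hom_def group_hom_axioms_def)

lemma act_wt:
  "h \<in> H \<Longrightarrow> set bs \<subseteq> carrier A \<Longrightarrow> act h (wt bs) = wt (map (act h) bs)"
proof (induction bs)
  case Nil
  then show ?case using act_hom by (simp add: hom_one is_group)
qed (simp add: act_mult)

text \<open>Independence means that the product of the orbits of the entries contains \<open>wt ds\<close> only through
  the untwisted choice of factors. In the expansion of a commutator of orbit sums, the untwisted
  summand is then alone in its component.\<close>

definition indep :: "'a list \<Rightarrow> bool" where
  "indep ds \<longleftrightarrow> (\<forall>hs. set hs \<subseteq> H \<and> length hs = length ds \<and> wt (map2 act hs ds) = wt ds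
     \<longrightarrow> set hs \<subseteq> {e})"

lemma map2_act_closed:
  "set hs \<subseteq> H \<Longrightarrow> set ds \<subseteq> carrier A \<Longrightarrow> set (map2 act hs ds) \<subseteq> carrier A"
  by (auto dest: set_zip_leftD set_zip_rightD)

lemma indep_rotate:
  assumes "indep (i # ds)" "i \<in> carrier A" "set ds \<subseteq> carrier A"
  shows "indep (ds @ [i])"
  unfolding indep_def
proof (intro allI impI, elim conjE)
  fix hs assume hs: "set hs \<subseteq> H" "length hs = length (ds @ [i])" "wt (map2 act hs (ds @ [i])) = wt (ds @ [i])"
  then obtain hs' h where hh: "hs = hs' @ [h]" by (cases hs rule: rev_exhaust) auto
  have c: "set (map2 act hs' ds) \<subseteq> carrier A"
    using map2_act_closed[of hs' ds] hs hh assms by auto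
  have "wt (map2 act (h # hs') (i # ds)) = wt (i # ds)"
    using hs hh assms c by (simp add: wt_append m_comm)
  then have "set (h # hs') \<subseteq> {e}"
    using assms(1) hs hh unfolding indep_def by (metis Suc_inject append.simps(2) length_Cons length_append_singleton set_rotate1 rotate1.simps(2))
  then show "set hs \<subseteq> {e}" using hh by auto
qed

lemma indep_singleton:
  assumes "a \<in> carrier A" "a \<noteq> \<one>"
  shows "indep [a]"
  unfolding indep_def
proof (intro allI impI, elim conjE)
  fix hs assume hs: "set hs \<subseteq> H" "length hs = length [a]" "wt (map2 act hs [a]) = wt [a]"
  then obtain h where "hs = [h]" by (auto simp: length_Suc_conv)
  then show "set hs \<subseteq> {e}" using hs fpf[of h a] assms by auto
qed

text \<open>Some total order makes \<open>b\<close> the greatest element of its orbit: take any total order and pull it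
  back along a suitable element of \<open>H\<close>. A product of \<open>n\<close> elements of the orbit can then be \<open>b\<^sup>n\<close>
  only if every factor is \<open>b\<close>.\<close>

lemma indep_replicate:
  assumes b: "b \<in> carrier A" "b \<noteq> \<one>"
  shows "indep (replicate n b)"
  unfolding indep_def
proof (intro allI impI, elim conjE)
  fix hs assume hs: "set hs \<subseteq> H" "length hs = length (replicate n b)"
    and eq: "wt (map2 act hs (replicate n b)) = wt (replicate n b)"
  have m2: "map2 act hs (replicate n b) = map (\<lambda>h. act h b) hs"
    using hs(2) by (auto simp: list_eq_iff_nth_eq)
  obtain P where P: "total_cone P" using torsion_free_orderable torsion_free by blast
  have "\<exists>s\<in>(\<lambda>h. act h b) ` H. \<forall>t\<in>(\<lambda>h. act h b) ` H. s \<otimes> inv t \<in> P"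
    by (rule total_cone_max[OF P]) (use finite_H e_in b in auto)
  then obtain g where g: "g \<in> H" and max: "\<And>h. h \<in> H \<Longrightarrow> act g b \<otimes> inv (act h b) \<in> P" by auto
  \<comment> \<open>The order is pulled back along \<open>g\<close>: applying \<open>act g\<close> turns \<open>b\<close> into the maximum \<open>m\<close>.\<close>
  define m where "m = act g b"
  have mc: "m \<in> carrier A" using g b by (simp add: m_def)
  define cs where "cs = map (\<lambda>h. act g (act h b)) hs"
  have cc: "set cs \<subseteq> carrier A" using hs g b by (auto simp: cs_def)
  have "set (map (\<lambda>h. act h b) hs) \<subseteq> carrier A" using hs b by auto
  from act_wt[OF g this] have "wt cs = act g (wt (map (\<lambda>h. act h b) hs))"
    by (simp add: cs_def comp_def)
  also have "\<dots> = act g (wt (replicate n b))" using eq m2 by simp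
  also have "\<dots> = m [^] n"
    using act_wt[OF g, of "replicate n b"] b mc by (auto simp: m_def wt_replicate set_replicate_conv_if)
  finally have wcs: "wt cs = m [^] n" .
  have "wt (map (\<lambda>c. m \<otimes> inv c) xs) = m [^] length xs \<otimes> inv (wt xs)" if "set xs \<subseteq> carrier A" for xs
    using that mc by (induction xs) (auto simp: inv_mult m_ac)
  from this[OF cc] have "wt (map (\<lambda>c. m \<otimes> inv c) cs) = \<one>"
    using wcs mc hs(2) by (simp add: cs_def)
  moreover have "set (map (\<lambda>c. m \<otimes> inv c) cs) \<subseteq> P"
  proof -
    have "m \<otimes> inv (act g (act h b)) \<in> P" if "h \<in> set hs" for h
      using act_comp[OF g, of h] that hs b max by (metis m_def subsetD)
    then show ?thesis by (auto simp: cs_def)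
  qed
  ultimately have one: "set (map (\<lambda>c. m \<otimes> inv c) cs) \<subseteq> {\<one>}"
    using wt_trivial_if_all_positive P unfolding total_cone_def by blast
  show "set hs \<subseteq> {e}"
  proof
    fix h assume h: "h \<in> set hs"
    then have hH: "h \<in> H" using hs by auto
    have "m \<otimes> inv (act g (act h b)) = \<one>" using one h by (auto simp: cs_def)
    then have "act g b = act g (act h b)"
      using mc g hH b unfolding m_def by (metis act_closed inv_closed inv_equality inv_inv)
    then have "act h b = b" using act_inj[OF g] b hH by (metis act_closed inj_onD)
    then show "h \<in> {e}" using fpf[OF hH _ b(1)] b(2) by blast
  qed
qed

text \<open>Once the twisting elements \<open>h, hs\<close> are fixed, with \<open>h\<close> nontrivial, a dependence of \<open>i # ds\<close>
  determines \<open>act h i \<otimes> inv i\<close> and hence \<open>i\<close>.\<close>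

lemma dependent_extensions:
  assumes ind: "indep ds" and ds: "set ds \<subseteq> carrier A"
  shows "finite {i \<in> carrier A. \<not> indep (i # ds)}"
    and "card {i \<in> carrier A. \<not> indep (i # ds)} \<le> card H ^ Suc (length ds)"
proof -
  let ?D = "{i \<in> carrier A. \<not> indep (i # ds)}"
  let ?T = "{hs. set hs \<subseteq> H \<and> length hs = Suc (length ds)}"
  have "\<exists>hs. hs \<in> ?T \<and> hd hs \<noteq> e \<and>
      act (hd hs) i \<otimes> wt (map2 act (tl hs) ds) = i \<otimes> wt ds" if "i \<in> ?D" for i
  proof -
    from that obtain hs where hs: "set hs \<subseteq> H" "length hs = length (i # ds)"
      "wt (map2 act hs (i # ds)) = wt (i # ds)" "\<not> set hs \<subseteq> {e}" and i: "i \<in> carrier A"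
      unfolding indep_def by blast
    then obtain h hs' where hh: "hs = h # hs'" by (cases hs) auto
    have eq: "act h i \<otimes> wt (map2 act hs' ds) = i \<otimes> wt ds" using hs hh by simp
    have "h \<noteq> e"
    proof
      assume "h = e"
      then have "wt (map2 act hs' ds) = wt ds"
        using eq i ds act_e[OF i] wt_closed[OF map2_act_closed[of hs' ds]] hs hh by auto
      then have "set hs' \<subseteq> {e}" using ind hs hh unfolding indep_def by auto
      then show False using hs hh \<open>h = e\<close> by auto
    qed
    then show ?thesis using hs hh eq by (intro exI[of _ "h # hs'"]) auto
  qed
  then have "\<forall>i\<in>?D. \<exists>hs. hs \<in> ?T \<and> hd hs \<noteq> e \<and>
      act (hd hs) i \<otimes> wt (map2 act (tl hs) ds) = i \<otimes> wt ds" by blast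
  from bchoice[OF this] obtain f where f: "\<And>i. i \<in> ?D \<Longrightarrow> f i \<in> ?T \<and> hd (f i) \<noteq> e \<and>
      act (hd (f i)) i \<otimes> wt (map2 act (tl (f i)) ds) = i \<otimes> wt ds" by blast
  have inj: "inj_on f ?D"
  proof (rule inj_onI)
    fix i j assume ij: "i \<in> ?D" "j \<in> ?D" "f i = f j"
    define h where "h = hd (f i)"
    define w where "w = wt (map2 act (tl (f i)) ds)"
    define v where "v = wt ds"
    have ne: "f i \<noteq> []" using f[OF ij(1)] by auto
    have h: "h \<in> H" using f[OF ij(1)] ne unfolding h_def by (metis (mono_tags, lifting) hd_in_set mem_Collect_eq subsetD)
    have tl: "set (tl (f i)) \<subseteq> H" using f[OF ij(1)] ne by (metis (mono_tags, lifting) list.set_sel(2) mem_Collect_eq subset_iff)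
    have c: "w \<in> carrier A" "v \<in> carrier A" "i \<in> carrier A" "j \<in> carrier A"
      using map2_act_closed[OF tl ds] ds ij by (auto simp: w_def v_def)
    have e1: "act h i \<otimes> w = i \<otimes> v" and e2: "act h j \<otimes> w = j \<otimes> v"
      using f[OF ij(1)] f[OF ij(2)] ij(3) by (auto simp: h_def w_def v_def)
    have cancel: "(x \<otimes> z) \<otimes> inv (y \<otimes> z) = x \<otimes> inv y"
      if "x \<in> carrier A" "y \<in> carrier A" "z \<in> carrier A" for x y z
    proof -
      have "z \<otimes> (inv z \<otimes> inv y) = inv y"
        using that m_assoc[of z "inv z" "inv y"] by simp
      then show ?thesis using that by (simp add: inv_mult_group m_assoc)
    qed
    have "act h (i \<otimes> inv j) = act h i \<otimes> inv (act h j)"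
      using h c by (simp add: act_mult act_inv)
    also have "\<dots> = (act h i \<otimes> w) \<otimes> inv (act h j \<otimes> w)"
      using h c by (simp add: cancel)
    also have "\<dots> = i \<otimes> inv j"
      using c e1 e2 by (simp add: cancel)
    finally have "i \<otimes> inv j = \<one>"
      using fpf[OF h] f[OF ij(1)] c unfolding h_def by auto
    then show "i = j" using c by (metis inv_closed inv_equality inv_inv)
  qed
  have img: "f ` ?D \<subseteq> ?T" using f by auto
  have finT: "finite ?T" by (rule finite_lists_length_eq[OF finite_H])
  show "finite ?D" using finT img inj finite_imageD finite_subset by blast
  have "card ?D \<le> card ?T" using card_inj_on_le[OF inj img finT] .
  then show "card ?D \<le> card H ^ Suc (length ds)" using card_lists_length_eq[OF finite_H] by simp
qed

lemma inj_mult_pow: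
  assumes "a \<in> carrier A" "b \<in> carrier A" "b \<noteq> \<one>"
  shows "inj (\<lambda>t::nat. a \<otimes> b [^] t)"
proof (rule linorder_injI)
  fix s t :: nat assume "s < t"
  show "a \<otimes> b [^] s \<noteq> a \<otimes> b [^] t"
  proof
    assume "a \<otimes> b [^] s = a \<otimes> b [^] t"
    then have "b [^] s = b [^] t" using assms by simp
    also have "b [^] t = b [^] s \<otimes> b [^] (t - s)"
      using nat_pow_mult[OF assms(2), of s "t - s"] \<open>s < t\<close> by simp
    finally have "b [^] s = b [^] s \<otimes> b [^] (t - s)" .
    then have "b [^] (t - s) = \<one>"
      using assms by (metis l_cancel_one' nat_pow_closed)
    then show False using torsion_free assms \<open>s < t\<close> unfolding torsion_free_def
      by (metis zero_less_diff)
  qed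
qed

end

section \<open>Homogeneous commutators\<close>

context lie_algebra
begin

lemma bracket_zero_left [simp]: "x \<in> carrier L \<Longrightarrow> bracket L \<zero>\<^bsub>L\<^esub> x = \<zero>\<^bsub>L\<^esub>"
  using bracket_add_left[of "\<zero>\<^bsub>L\<^esub>" "\<zero>\<^bsub>L\<^esub>" x] bracket_closed[of "\<zero>\<^bsub>L\<^esub>" x]
  by (simp add: M.add.l_cancel_one')

lemma bracket_zero_right [simp]: "x \<in> carrier L \<Longrightarrow> bracket L x \<zero>\<^bsub>L\<^esub> = \<zero>\<^bsub>L\<^esub>"
  using bracket_add_right[of x "\<zero>\<^bsub>L\<^esub>" "\<zero>\<^bsub>L\<^esub>"] bracket_closed[of x "\<zero>\<^bsub>L\<^esub>"]
  by (simp add: M.add.l_cancel_one')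

lemma bracket_minus_left:
  assumes "x \<in> carrier L" "y \<in> carrier L"
  shows "bracket L (\<ominus>\<^bsub>L\<^esub> x) y = \<ominus>\<^bsub>L\<^esub> bracket L x y"
proof -
  have "bracket L (\<ominus>\<^bsub>L\<^esub> x) y \<oplus>\<^bsub>L\<^esub> bracket L x y = \<zero>\<^bsub>L\<^esub>"
    using bracket_add_left[of "\<ominus>\<^bsub>L\<^esub> x" x y] assms by (simp add: M.l_neg)
  then show ?thesis using assms bracket_closed by (metis M.a_inv_closed M.minus_equality)
qed

lemma bracket_anti:
  assumes "x \<in> carrier L" "y \<in> carrier L"
  shows "bracket L x y = \<ominus>\<^bsub>L\<^esub> bracket L y x"
proof -
  have "bracket L (x \<oplus>\<^bsub>L\<^esub> y) (x \<oplus>\<^bsub>L\<^esub> y) = bracket L x y \<oplus>\<^bsub>L\<^esub> bracket L y x"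
    using assms by (simp add: bracket_add_left[of x y "x \<oplus>\<^bsub>L\<^esub> y"])
      (simp add: bracket_add_right bracket_self bracket_closed)
  then have "bracket L x y \<oplus>\<^bsub>L\<^esub> bracket L y x = \<zero>\<^bsub>L\<^esub>" using assms by (simp add: bracket_self)
  then show ?thesis using assms bracket_closed by (metis M.minus_equality)
qed

lemma jacobi_swap:
  assumes "w \<in> carrier L" "z \<in> carrier L" "x \<in> carrier L"
  shows "bracket L (bracket L w z) x =
    bracket L (bracket L w x) z \<oplus>\<^bsub>L\<^esub> bracket L w (bracket L z x)"
proof -
  let ?p = "bracket L (bracket L w z) x" and ?q = "bracket L (bracket L w x) z"
    and ?r = "bracket L w (bracket L z x)"
  have c: "?p \<in> carrier L" "?q \<in> carrier L" "?r \<in> carrier L" using assms bracket_closed by auto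
  have "bracket L (bracket L z x) w = \<ominus>\<^bsub>L\<^esub> ?r"
    using bracket_anti assms bracket_closed by blast
  moreover have "bracket L (bracket L x w) z = \<ominus>\<^bsub>L\<^esub> ?q"
    using bracket_anti[of x w] bracket_minus_left assms bracket_closed by metis
  ultimately have "?p \<oplus>\<^bsub>L\<^esub> \<ominus>\<^bsub>L\<^esub> ?r \<oplus>\<^bsub>L\<^esub> \<ominus>\<^bsub>L\<^esub> ?q = \<zero>\<^bsub>L\<^esub>"
    using jacobi[OF assms] by simp
  then have "?p \<oplus>\<^bsub>L\<^esub> \<ominus>\<^bsub>L\<^esub> (?q \<oplus>\<^bsub>L\<^esub> ?r) = \<zero>\<^bsub>L\<^esub>"
    using c by (simp add: M.minus_add M.a_ac)
  then show ?thesis using c by (metis M.a_inv_closed M.add.m_closed M.minus_equality M.minus_minus)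
qed

definition com :: "'l \<Rightarrow> ('x \<times> 'l) list \<Rightarrow> 'l" where
  "com u ws = foldl (bracket L) u (map snd ws)"

lemma com_Nil [simp]: "com u [] = u"
  and com_Cons [simp]: "com u (w # ws) = com (bracket L u (snd w)) ws"
  and com_append: "com u (vs @ ws) = com (com u vs) ws"
  by (simp_all add: com_def)

lemma com_closed: "u \<in> carrier L \<Longrightarrow> snd ` set ws \<subseteq> carrier L \<Longrightarrow> com u ws \<in> carrier L"
  by (induction ws arbitrary: u) (auto simp: bracket_closed)

lemma com_add:
  "x \<in> carrier L \<Longrightarrow> y \<in> carrier L \<Longrightarrow> snd ` set ws \<subseteq> carrier L \<Longrightarrow>
    com (x \<oplus>\<^bsub>L\<^esub> y) ws = com x ws \<oplus>\<^bsub>L\<^esub> com y ws"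
  by (induction ws arbitrary: x y) (auto simp: bracket_closed bracket_add_left)

lemma com_minus:
  "x \<in> carrier L \<Longrightarrow> snd ` set ws \<subseteq> carrier L \<Longrightarrow> com (\<ominus>\<^bsub>L\<^esub> x) ws = \<ominus>\<^bsub>L\<^esub> com x ws"
  by (induction ws arbitrary: x) (auto simp: bracket_closed bracket_minus_left)

lemma com_zero: "snd ` set ws \<subseteq> carrier L \<Longrightarrow> com \<zero>\<^bsub>L\<^esub> ws = \<zero>\<^bsub>L\<^esub>"
  by (induction ws) auto

lemma com_swap:
  assumes "u \<in> carrier L" "z \<in> carrier L" "x \<in> carrier L"
    "snd ` set p \<subseteq> carrier L" "snd ` set q \<subseteq> carrier L"
  shows "com u (p @ (b, z) # (c, x) # q) =
    com u (p @ (c, x) # (b, z) # q) \<oplus>\<^bsub>L\<^esub> com u (p @ (d, bracket L z x) # q)"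
proof -
  have v: "com u p \<in> carrier L" using assms com_closed by blast
  show ?thesis
    using jacobi_swap[OF v assms(2,3)] v assms
    by (simp add: com_append com_add bracket_closed)
qed

lemma add_subgroupD:
  assumes "subgroup T (add_monoid L)"
  shows "T \<subseteq> carrier L" "\<zero>\<^bsub>L\<^esub> \<in> T"
    "x \<in> T \<Longrightarrow> y \<in> T \<Longrightarrow> x \<oplus>\<^bsub>L\<^esub> y \<in> T" "x \<in> T \<Longrightarrow> \<ominus>\<^bsub>L\<^esub> x \<in> T"
  using subgroup.subset[OF assms] subgroup.one_closed[OF assms] subgroup.m_closed[OF assms]
    subgroup.m_inv_closed[OF assms]
  by (auto simp: a_inv_def)

lemma add_subgroupI:
  assumes "T \<subseteq> carrier L" "\<zero>\<^bsub>L\<^esub> \<in> T"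
    "\<And>x y. x \<in> T \<Longrightarrow> y \<in> T \<Longrightarrow> x \<oplus>\<^bsub>L\<^esub> y \<in> T" "\<And>x. x \<in> T \<Longrightarrow> \<ominus>\<^bsub>L\<^esub> x \<in> T"
  shows "subgroup T (add_monoid L)"
  using assms by (intro subgroup.intro) (auto simp: a_inv_def)

lemma submodule_span_eq_zero_iff: "submodule_span R L S = {\<zero>\<^bsub>L\<^esub>} \<longleftrightarrow> S \<subseteq> {\<zero>\<^bsub>L\<^esub>}"
proof
  assume "submodule_span R L S = {\<zero>\<^bsub>L\<^esub>}"
  moreover have "S \<subseteq> submodule_span R L S" by (auto simp: submodule_span_def)
  ultimately show "S \<subseteq> {\<zero>\<^bsub>L\<^esub>}" by simp
next
  assume S: "S \<subseteq> {\<zero>\<^bsub>L\<^esub>}"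
  have "submodule {\<zero>\<^bsub>L\<^esub>} R L" by (rule submoduleI) auto
  then have "submodule_span R L S \<subseteq> {\<zero>\<^bsub>L\<^esub>}"
    unfolding submodule_span_def by (intro Inter_lower) (simp add: S)
  moreover have "\<zero>\<^bsub>L\<^esub> \<in> N" if "submodule N R L" for N
    using add_subgroupD(2)[OF submodule.axioms(1)[OF that]] .
  then have "\<zero>\<^bsub>L\<^esub> \<in> submodule_span R L S" by (simp add: submodule_span_def)
  ultimately show "submodule_span R L S = {\<zero>\<^bsub>L\<^esub>}" by auto
qed

lemma commutator_span_eq_zero_iff:
  "commutator_span R L U K n = {\<zero>\<^bsub>L\<^esub>} \<longleftrightarrow>
    (\<forall>x\<in>U. \<forall>ys. set ys \<subseteq> K \<and> length ys = n \<longrightarrow> foldl (bracket L) x ys = \<zero>\<^bsub>L\<^esub>)"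
  unfolding commutator_span_def submodule_span_eq_zero_iff by fastforce

end


context graded_lie_algebra
begin

lemma G_subgroup: "a \<in> carrier A \<Longrightarrow> subgroup (G a) (add_monoid L)"
  using component_submodule submodule.axioms(1) by blast

lemma G_carrier: "a \<in> carrier A \<Longrightarrow> x \<in> G a \<Longrightarrow> x \<in> carrier L"
  using add_subgroupD(1)[OF G_subgroup] by blast

lemmas G_zero = add_subgroupD(2)[OF G_subgroup]
lemmas G_add = add_subgroupD(3)[OF G_subgroup]
lemmas G_minus = add_subgroupD(4)[OF G_subgroup]

text \<open>An entry carries its weight along because the element does not determine it: zero lies in every
  component.\<close>

definition hword :: "('a \<times> 'l) list \<Rightarrow> bool" where
  "hword ws \<longleftrightarrow> (\<forall>w\<in>set ws. fst w \<in> carrier A \<and> snd w \<in> G (fst w))"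

abbreviation tw :: "('a \<times> 'l) list \<Rightarrow> 'a" where
  "tw ws \<equiv> A.wt (map fst ws)"

lemma hword_Nil [simp]: "hword []"
  and hword_Cons [simp]: "hword (w # ws) \<longleftrightarrow> fst w \<in> carrier A \<and> snd w \<in> G (fst w) \<and> hword ws"
  and hword_append [simp]: "hword (vs @ ws) \<longleftrightarrow> hword vs \<and> hword ws"
  by (auto simp: hword_def)

lemma hword_snd: "hword ws \<Longrightarrow> snd ` set ws \<subseteq> carrier L"
  using G_carrier by (auto simp: hword_def)

lemma hword_fst: "hword ws \<Longrightarrow> set (map fst ws) \<subseteq> carrier A"
  by (auto simp: hword_def)

lemma tw_closed [simp, intro]: "hword ws \<Longrightarrow> tw ws \<in> carrier A"
  using hword_fst A.wt_closed by blast

lemma tw_append: "hword vs \<Longrightarrow> hword ws \<Longrightarrow> tw (vs @ ws) = tw vs \<otimes>\<^bsub>A\<^esub> tw ws"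
  using A.wt_append hword_fst by simp

lemma tw_mset: "mset vs = mset ws \<Longrightarrow> hword vs \<Longrightarrow> tw vs = tw ws"
  using A.wt_mset_cong[of "map fst vs" "map fst ws"] hword_fst by simp

lemma com_component: "a \<in> carrier A \<Longrightarrow> u \<in> G a \<Longrightarrow> hword ws \<Longrightarrow> com u ws \<in> G (a \<otimes>\<^bsub>A\<^esub> tw ws)"
proof (induction ws arbitrary: a u)
  case (Cons w ws)
  then have "com (bracket L u (snd w)) ws \<in> G ((a \<otimes>\<^bsub>A\<^esub> fst w) \<otimes>\<^bsub>A\<^esub> tw ws)"
    using bracket_component by auto
  then show ?case using Cons.prems tw_closed[of ws] by (simp add: A.m_assoc)
qed simp

text \<open>Moving an entry to the left past another one costs a commutator with one entry less and the
  same total weight. If all these shorter commutators lie in \<open>T\<close>, then entries may be permuted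
  freely modulo \<open>T\<close>.\<close>

lemma com_move_left:
  assumes T: "subgroup T (add_monoid L)" and u: "u \<in> carrier L"
    and short: "\<And>vs. \<lbrakk>hword vs; vs \<noteq> []; length vs < n; tw vs = t\<rbrakk> \<Longrightarrow> com u vs \<in> T"
  shows "\<lbrakk>hword (r @ p @ x # q); length (r @ p @ x # q) = n; tw (r @ p @ x # q) = t;
     com u (r @ x # p @ q) \<in> T\<rbrakk> \<Longrightarrow> com u (r @ p @ x # q) \<in> T"
proof (induction p arbitrary: q rule: rev_induct)
  case (snoc z p)
  obtain b z' where z: "z = (b, z')" by force
  obtain c x' where x: "x = (c, x')" by force
  let ?y = "(b \<otimes>\<^bsub>A\<^esub> c, bracket L z' x')"
  have h: "hword r" "hword p" "hword q" "b \<in> carrier A" "c \<in> carrier A" "z' \<in> G b" "x' \<in> G c"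
    using snoc.prems z x by auto
  note cl = h(4,5) tw_closed[OF h(1)] tw_closed[OF h(2)] tw_closed[OF h(3)]
  have eq: "com u ((r @ p) @ (b, z') # (c, x') # q) =
     com u ((r @ p) @ (c, x') # (b, z') # q) \<oplus>\<^bsub>L\<^esub> com u ((r @ p) @ ?y # q)"
    using u G_carrier[OF h(4,6)] G_carrier[OF h(5,7)] hword_snd[of "r @ p"] hword_snd[OF h(3)] h(1,2)
    by (intro com_swap) simp_all
  have t1: "tw (r @ p @ x # z # q) = t"
    using snoc.prems(1,3) z x tw_mset[of "r @ (p @ [z]) @ x # q" "r @ p @ x # z # q"] by simp
  have 1: "com u (r @ p @ x # z # q) \<in> T"
    using snoc.prems t1 by (intro snoc.IH) auto
  have hy: "hword (r @ p @ ?y # q)" using h bracket_component by auto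
  have "tw (r @ p @ ?y # q) = t"
    using snoc.prems(3) h z x hy cl by (simp add: tw_append A.m_assoc del: map_append)
  then have 2: "com u (r @ p @ ?y # q) \<in> T"
    using snoc.prems(2) hy by (intro short) auto
  show ?case using eq 1 2 add_subgroupD(3)[OF T] z x by simp
qed simp

lemma com_permute:
  assumes T: "subgroup T (add_monoid L)" and u: "u \<in> carrier L"
    and short: "\<And>vs. \<lbrakk>hword vs; vs \<noteq> []; length vs < n; tw vs = t\<rbrakk> \<Longrightarrow> com u vs \<in> T"
  shows "\<lbrakk>mset ws = mset ws'; hword (r @ ws); length (r @ ws) = n; tw (r @ ws) = t;
     com u (r @ ws') \<in> T\<rbrakk> \<Longrightarrow> com u (r @ ws) \<in> T"
proof (induction ws' arbitrary: r ws)
  case (Cons x ws')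
  then have "x \<in> set ws" by (metis list.set_intros(1) mset_eq_setD)
  then obtain p q where ws: "ws = p @ x # q" by (meson split_list)
  have "com u ((r @ [x]) @ (p @ q)) \<in> T"
  proof (rule Cons.IH)
    show "mset (p @ q) = mset ws'" using Cons.prems ws by simp
    show "hword ((r @ [x]) @ p @ q)" using Cons.prems ws by auto
    show "length ((r @ [x]) @ p @ q) = n" using Cons.prems ws by auto
    show "tw ((r @ [x]) @ p @ q) = t"
      using Cons.prems(2,4) ws tw_mset[of "r @ ws" "(r @ [x]) @ p @ q"] by simp
    show "com u ((r @ [x]) @ ws') \<in> T" using Cons.prems by simp
  qed
  then have "com u (r @ x # p @ q) \<in> T" by simp
  from com_move_left[OF T u short _ _ _ this] show ?case
    using Cons.prems(2-4) unfolding ws by blast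
qed simp

text \<open>Consequently, to see that all commutators of a given total weight lie in \<open>T\<close>, each of them may
  first be rearranged at will.\<close>

lemma com_collect:
  assumes T: "subgroup T (add_monoid L)" and u: "u \<in> carrier L"
    and step: "\<And>ws. \<lbrakk>hword ws; ws \<noteq> []; tw ws = t\<rbrakk> \<Longrightarrow> \<exists>ws'. mset ws = mset ws' \<and> com u ws' \<in> T"
  shows "\<lbrakk>hword ws; ws \<noteq> []; tw ws = t\<rbrakk> \<Longrightarrow> com u ws \<in> T"
proof (induction "length ws" arbitrary: ws rule: less_induct)
  case less
  obtain ws' where "mset ws = mset ws'" "com u ws' \<in> T" using step[OF less.prems] by blast
  then show ?case
    using com_permute[OF T u less.hyps, where r = "[]" and ws = ws and ws' = ws'] less.prems by simp
qed


section \<open>Homogeneous ideals with bounded support\<close>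

text \<open>A homogeneous ideal is represented by the family of its components, so that no sums of elements
  of different weights occur. One-sided products suffice since the bracket is anticommutative.\<close>

definition hideal :: "('a \<Rightarrow> 'l set) \<Rightarrow> bool" where
  "hideal X \<longleftrightarrow> (\<forall>a\<in>carrier A. subgroup (X a) (add_monoid L) \<and> X a \<subseteq> G a \<and>
     (\<forall>x\<in>X a. \<forall>b\<in>carrier A. \<forall>y\<in>G b. bracket L x y \<in> X (a \<otimes>\<^bsub>A\<^esub> b)))"

lemma hidealI:
  assumes "\<And>a. a \<in> carrier A \<Longrightarrow> X a \<subseteq> G a"
    and "\<And>a. a \<in> carrier A \<Longrightarrow> \<zero>\<^bsub>L\<^esub> \<in> X a"
    and "\<And>a x y. \<lbrakk>a \<in> carrier A; x \<in> X a; y \<in> X a\<rbrakk> \<Longrightarrow> x \<oplus>\<^bsub>L\<^esub> y \<in> X a"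
    and "\<And>a x. \<lbrakk>a \<in> carrier A; x \<in> X a\<rbrakk> \<Longrightarrow> \<ominus>\<^bsub>L\<^esub> x \<in> X a"
    and "\<And>a b x y. \<lbrakk>a \<in> carrier A; b \<in> carrier A; x \<in> X a; y \<in> G b\<rbrakk> \<Longrightarrow> bracket L x y \<in> X (a \<otimes>\<^bsub>A\<^esub> b)"
  shows "hideal X"
  unfolding hideal_def
proof (intro ballI conjI)
  fix a assume a: "a \<in> carrier A"
  show "subgroup (X a) (add_monoid L)"
    using assms(2-4)[OF a] assms(1)[OF a] G_carrier[OF a] by (intro add_subgroupI) auto
qed (use assms in auto)

lemma hidealD:
  assumes "hideal X" "a \<in> carrier A"
  shows "subgroup (X a) (add_monoid L)" "X a \<subseteq> G a"
    "\<lbrakk>x \<in> X a; b \<in> carrier A; y \<in> G b\<rbrakk> \<Longrightarrow> bracket L x y \<in> X (a \<otimes>\<^bsub>A\<^esub> b)"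
  using assms unfolding hideal_def by blast+

lemmas hideal_subgroupD = add_subgroupD[OF hidealD(1)]

lemma hideal_com:
  assumes X: "hideal X"
  shows "\<lbrakk>a \<in> carrier A; x \<in> X a; hword ws\<rbrakk> \<Longrightarrow> com x ws \<in> X (a \<otimes>\<^bsub>A\<^esub> tw ws)"
proof (induction ws arbitrary: a x)
  case (Cons w ws)
  then have "com (bracket L x (snd w)) ws \<in> X ((a \<otimes>\<^bsub>A\<^esub> fst w) \<otimes>\<^bsub>A\<^esub> tw ws)"
    using hidealD(3)[OF X] by auto
  then show ?case using Cons.prems tw_closed[of ws] by (simp add: A.m_assoc)
qed simp

lemma hideal_trivial: "hideal (\<lambda>a. {\<zero>\<^bsub>L\<^esub>})"
  using G_zero G_carrier by (intro hidealI) auto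

text \<open>Relative nilpotency of the action of \<open>L\<close>: if \<open>X\<close> and \<open>Y\<close> are ideals, \<open>[Y, L, \<dots>, L] \<le> X\<close>.\<close>

definition lands :: "nat \<Rightarrow> ('a \<Rightarrow> 'l set) \<Rightarrow> ('a \<Rightarrow> 'l set) \<Rightarrow> bool" where
  "lands n Y X \<longleftrightarrow> (\<forall>a\<in>carrier A. \<forall>y\<in>Y a. \<forall>ws. hword ws \<and> length ws = n \<longrightarrow>
     com y ws \<in> X (a \<otimes>\<^bsub>A\<^esub> tw ws))"

lemma landsD:
  "\<lbrakk>lands n Y X; a \<in> carrier A; y \<in> Y a; hword ws; length ws = n\<rbrakk> \<Longrightarrow> com y ws \<in> X (a \<otimes>\<^bsub>A\<^esub> tw ws)"
  unfolding lands_def by blast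

lemma lands_trans:
  assumes "lands n Y Z" "lands m Z X"
  shows "lands (n + m) Y X"
  unfolding lands_def
proof (intro ballI allI impI, elim conjE)
  fix a y ws assume a: "a \<in> carrier A" "y \<in> Y a" "hword ws" "length ws = n + m"
  define p q where "p = take n ws" and "q = drop n ws"
  have w: "ws = p @ q" "length p = n" "length q = m" using a by (auto simp: p_def q_def)
  then have h: "hword p" "hword q" using a by auto
  have "com (com y p) q \<in> X ((a \<otimes>\<^bsub>A\<^esub> tw p) \<otimes>\<^bsub>A\<^esub> tw q)"
    using landsD[OF assms(2) _ landsD[OF assms(1) a(1,2) h(1) w(2)] h(2) w(3)] a h by auto
  then show "com y ws \<in> X (a \<otimes>\<^bsub>A\<^esub> tw ws)"
    using w h a tw_closed[OF h(1)] tw_closed[OF h(2)] by (simp add: com_append tw_append A.m_assoc del: map_append)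
qed

definition into :: "('a \<Rightarrow> 'l set) \<Rightarrow> 'a set \<Rightarrow> ('a \<Rightarrow> 'l set) \<Rightarrow> 'a \<Rightarrow> 'l set" where
  "into Y S W a = {y \<in> Y a. \<forall>ws. hword ws \<and> a \<otimes>\<^bsub>A\<^esub> tw ws \<in> S \<longrightarrow> com y ws \<in> W (a \<otimes>\<^bsub>A\<^esub> tw ws)}"

lemma intoD:
  "\<lbrakk>y \<in> into Y S W a; hword ws; a \<otimes>\<^bsub>A\<^esub> tw ws \<in> S\<rbrakk> \<Longrightarrow> com y ws \<in> W (a \<otimes>\<^bsub>A\<^esub> tw ws)"
  by (auto simp: into_def)

lemma into_base: "\<lbrakk>y \<in> into Y S W a; a \<in> S; a \<in> carrier A\<rbrakk> \<Longrightarrow> y \<in> W a"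
  using intoD[of y Y S W a "[]"] by simp

text \<open>Ideals are cut out by conditions on the commutators that start in an element, not generated by
  elements. To show that such an ideal contains a given element is then a statement about commutators,
  to which \<open>com_collect\<close> applies.\<close>

lemma hideal_into:
  assumes Y: "hideal Y" and W: "\<And>s. s \<in> S \<Longrightarrow> s \<in> carrier A \<Longrightarrow> subgroup (W s) (add_monoid L)"
  shows "hideal (into Y S W)"
proof (rule hidealI)
  fix a assume a: "a \<in> carrier A"
  have Wa: "subgroup (W (a \<otimes>\<^bsub>A\<^esub> tw ws)) (add_monoid L)" if "hword ws" "a \<otimes>\<^bsub>A\<^esub> tw ws \<in> S" for ws
    using that a by (intro W) auto
  have Yc: "x \<in> carrier L" if "x \<in> Y a" for x using hidealD(2)[OF Y a] G_carrier a that by blast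
  show "into Y S W a \<subseteq> G a" using hidealD(2)[OF Y a] by (auto simp: into_def)
  show "\<zero>\<^bsub>L\<^esub> \<in> into Y S W a"
    using hideal_subgroupD(2)[OF Y a] add_subgroupD(2)[OF Wa] hword_snd
    by (auto simp: into_def com_zero)
  show "x \<oplus>\<^bsub>L\<^esub> y \<in> into Y S W a" if "x \<in> into Y S W a" "y \<in> into Y S W a" for x y
    using hideal_subgroupD(3)[OF Y a] add_subgroupD(3)[OF Wa] hword_snd Yc that
    by (auto simp: into_def com_add)
  show "\<ominus>\<^bsub>L\<^esub> x \<in> into Y S W a" if "x \<in> into Y S W a" for x
    using hideal_subgroupD(4)[OF Y a] add_subgroupD(4)[OF Wa] hword_snd Yc that
    by (auto simp: into_def com_minus)
  fix b x y assume b: "b \<in> carrier A" and x: "x \<in> into Y S W a" and y: "y \<in> G b"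
  have "com x ((b, y) # ws) \<in> W (a \<otimes>\<^bsub>A\<^esub> tw ((b, y) # ws))"
    if "hword ws" "a \<otimes>\<^bsub>A\<^esub> b \<otimes>\<^bsub>A\<^esub> tw ws \<in> S" for ws
    using that a b y by (intro intoD[OF x]) (auto simp: A.m_assoc)
  then show "bracket L x y \<in> into Y S W (a \<otimes>\<^bsub>A\<^esub> b)"
    using hidealD(3)[OF Y a] b x y a tw_closed by (auto simp: into_def A.m_assoc)
qed

end

context graded_lie_algebra
begin

text \<open>No weight in the support of \<open>Y\<close> modulo \<open>X\<close> exceeds \<open>s\<close>. A commutator of total weight
  zero that starts in \<open>Y s\<close> can be rearranged so that, unless all its entries have weight zero, it
  begins with an entry of positive weight and so falls into \<open>X\<close> at once. On \<open>Y s\<close>, the components of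
  total weight zero therefore act through \<open>G \<one>\<close>, that is nilpotently.\<close>

lemma weight_zero_words_at_top:
  assumes P: "A.total_cone P" and X: "hideal X" and Y: "hideal Y" and s: "s \<in> carrier A"
    and top: "\<And>b. \<lbrakk>b \<in> P; b \<noteq> \<one>\<^bsub>A\<^esub>\<rbrakk> \<Longrightarrow> Y (s \<otimes>\<^bsub>A\<^esub> b) \<subseteq> X (s \<otimes>\<^bsub>A\<^esub> b)"
    and T: "subgroup T (add_monoid L)" and XT: "X s \<inter> Y s \<subseteq> T"
    and y: "y \<in> Y s"
    and zero: "\<And>ws. \<lbrakk>hword ws; ws \<noteq> []; set (map fst ws) \<subseteq> {\<one>\<^bsub>A\<^esub>}\<rbrakk> \<Longrightarrow> com y ws \<in> T"
    and ws: "hword ws" "ws \<noteq> []" "tw ws = \<one>\<^bsub>A\<^esub>"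
  shows "com y ws \<in> T"
proof (rule com_collect[OF T _ _ ws])
  show "y \<in> carrier L" using hideal_subgroupD(1)[OF Y s] y by blast
  have PA: "P \<subseteq> carrier A" "\<And>a. a \<in> carrier A \<Longrightarrow> a \<in> P \<or> inv\<^bsub>A\<^esub> a \<in> P"
    and oc: "A.order_cone P"
    using P by (auto simp: A.total_cone_def A.order_cone_def)
  fix ws assume ws: "hword ws" "ws \<noteq> []" "tw ws = \<one>\<^bsub>A\<^esub>"
  show "\<exists>ws'. mset ws = mset ws' \<and> com y ws' \<in> T"
  proof (cases "set (map fst ws) \<subseteq> {\<one>\<^bsub>A\<^esub>}")
    case True then show ?thesis using zero ws by blast
  next
    case False
    have "\<exists>w\<in>set ws. fst w \<in> P \<and> fst w \<noteq> \<one>\<^bsub>A\<^esub>"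
    proof (rule ccontr)
      assume neg: "\<not> ?thesis"
      have "inv\<^bsub>A\<^esub> b \<in> P" if "b \<in> set (map fst ws)" for b
      proof (cases "b = \<one>\<^bsub>A\<^esub>")
        case True then show ?thesis using oc by (simp add: A.order_cone_def)
      next
        case False
        then have "b \<notin> P" using neg that by auto
        then show ?thesis using PA(2) hword_fst[OF ws(1)] that by blast
      qed
      then have "set (map (m_inv A) (map fst ws)) \<subseteq> P" by auto
      moreover have "A.wt (map (m_inv A) (map fst ws)) = \<one>\<^bsub>A\<^esub>"
        using A.wt_map_inv[OF hword_fst[OF ws(1)]] ws(3) by simp
      ultimately have "set (map (m_inv A) (map fst ws)) \<subseteq> {\<one>\<^bsub>A\<^esub>}"
        using A.wt_trivial_if_all_positive[OF oc] by blast
      then have "inv\<^bsub>A\<^esub> b = \<one>\<^bsub>A\<^esub>" if "b \<in> set (map fst ws)" for b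
        using that by fastforce
      then have "b = \<one>\<^bsub>A\<^esub>" if "b \<in> set (map fst ws)" for b
        using that hword_fst[OF ws(1)] by (metis A.inv_inv A.inv_one subsetD)
      then show False using False by blast
    qed
    then obtain w where w: "w \<in> set ws" "fst w \<in> P" "fst w \<noteq> \<one>\<^bsub>A\<^esub>" by blast
    then obtain p q where pq: "ws = p @ w # q" by (meson split_list)
    have h: "fst w \<in> carrier A" "snd w \<in> G (fst w)" "hword (p @ q)" using ws pq by auto
    have m: "mset ws = mset (w # p @ q)" using pq by simp
    have "bracket L y (snd w) \<in> X (s \<otimes>\<^bsub>A\<^esub> fst w)"
      using hidealD(3)[OF Y s y h(1,2)] top[OF w(2,3)] by blast
    then have "com (bracket L y (snd w)) (p @ q) \<in> X ((s \<otimes>\<^bsub>A\<^esub> fst w) \<otimes>\<^bsub>A\<^esub> tw (p @ q))"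
      using hideal_com[OF X _ _ h(3)] s h(1) by simp
    moreover have "(s \<otimes>\<^bsub>A\<^esub> fst w) \<otimes>\<^bsub>A\<^esub> tw (p @ q) = s"
      using tw_mset[OF m ws(1)] ws(3) s h(1) tw_closed[OF h(3)] by (simp add: A.m_assoc)
    ultimately have "com y (w # p @ q) \<in> X s" by simp
    moreover have "tw (w # p @ q) = \<one>\<^bsub>A\<^esub>" using tw_mset[OF m ws(1)] ws(3) by (rule subst)
    then have "com y (w # p @ q) \<in> Y s"
      using hideal_com[OF Y s y, of "w # p @ q"] h s
      by (simp del: A.wt_Cons list.map com_Cons)
    ultimately show ?thesis using m XT by blast
  qed
qed

text \<open>By induction on the size of the support. Let \<open>s\<close> be its largest element, and let \<open>Z i\<close> consist of
  the elements of \<open>Y\<close> from which every commutator that reaches weight \<open>s\<close> is sent into \<open>X\<close> by any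
  \<open>i\<close> further entries of weight zero. The chain \<open>Z 0, \<dots>, Z k\<close> ends with \<open>Y\<close>, the ideal \<open>Z 0\<close> lies
  in \<open>X\<close> at weight \<open>s\<close>, and \<open>Z (i + 1)\<close> is sent into \<open>Z i\<close> by one step from weight \<open>s\<close>. Hence every
  link of the chain is accounted for by a support without \<open>s\<close>, up to one extra step.\<close>

theorem bounded_support_nilpotent:
  assumes P: "A.total_cone P"
    and k: "\<And>a y ws. \<lbrakk>a \<in> carrier A; y \<in> G a; hword ws; set (map fst ws) \<subseteq> {\<one>\<^bsub>A\<^esub>}; length ws = k\<rbrakk>
      \<Longrightarrow> com y ws = \<zero>\<^bsub>L\<^esub>"
  shows "\<lbrakk>hideal X; hideal Y; finite S; S \<subseteq> carrier A; card S = e;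
      \<And>a. \<lbrakk>a \<in> carrier A; a \<notin> S\<rbrakk> \<Longrightarrow> Y a \<subseteq> X a\<rbrakk> \<Longrightarrow> lands ((k + 1) ^ e - 1) Y X"
proof (induction e arbitrary: X Y S)
  case 0
  then show ?case by (auto simp: lands_def)
next
  case (Suc e)
  note X = Suc.prems(1) and Y = Suc.prems(2) and fS = Suc.prems(3) and SA = Suc.prems(4)
    and supp = Suc.prems(6)
  define m where "m = (k + 1) ^ e - 1"
  obtain s where sS: "s \<in> S" and smax: "\<And>t. t \<in> S \<Longrightarrow> s \<otimes>\<^bsub>A\<^esub> inv\<^bsub>A\<^esub> t \<in> P"
    using A.total_cone_max[OF P fS _ SA] Suc.prems(5) by fastforce
  have s: "s \<in> carrier A" using sS SA by blast
  have S': "finite (S - {s})" "S - {s} \<subseteq> carrier A" "card (S - {s}) = e"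
    using fS SA sS Suc.prems(5) by auto
  have top: "Y (s \<otimes>\<^bsub>A\<^esub> b) \<subseteq> X (s \<otimes>\<^bsub>A\<^esub> b)" if b: "b \<in> P" "b \<noteq> \<one>\<^bsub>A\<^esub>" for b
  proof -
    have bc: "b \<in> carrier A" using P b by (auto simp: A.total_cone_def A.order_cone_def)
    have "s \<otimes>\<^bsub>A\<^esub> b \<notin> S"
    proof
      assume "s \<otimes>\<^bsub>A\<^esub> b \<in> S"
      from smax[OF this] have "inv\<^bsub>A\<^esub> b \<in> P"
        using s bc by (simp add: A.inv_mult A.m_assoc[symmetric])
      then show False using P b by (auto simp: A.total_cone_def A.order_cone_def)
    qed
    then show ?thesis using supp s bc by simp
  qed
  define W where "W i = {y \<in> Y s. \<forall>ws. hword ws \<and> set (map fst ws) \<subseteq> {\<one>\<^bsub>A\<^esub>} \<and> length ws = i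
      \<longrightarrow> com y ws \<in> X s}" for i
  define Z where "Z i = into Y {s} (\<lambda>_. W i)" for i
  have tw1: "tw ws = \<one>\<^bsub>A\<^esub>" if "set (map fst ws) \<subseteq> {\<one>\<^bsub>A\<^esub>}" for ws :: "('a \<times> 'l) list"
    using that by (induction ws) auto
  have X_zero_words: "com y ws \<in> X s" if "y \<in> X s" "hword ws" "set (map fst ws) \<subseteq> {\<one>\<^bsub>A\<^esub>}" for y ws
    using hideal_com[OF X s that(1,2)] tw1[OF that(3)] s by simp
  have Y_zero_words: "com y ws \<in> Y s" if "y \<in> Y s" "hword ws" "set (map fst ws) \<subseteq> {\<one>\<^bsub>A\<^esub>}" for y ws
    using hideal_com[OF Y s that(1,2)] tw1[OF that(3)] s by simp
  have W_mono: "com y ws \<in> X s"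
    if y: "y \<in> W i" and ws: "hword ws" "set (map fst ws) \<subseteq> {\<one>\<^bsub>A\<^esub>}" "i \<le> length ws" for y ws i
  proof -
    define p q where "p = take i ws" and "q = drop i ws"
    have w: "ws = p @ q" "length p = i" using ws by (auto simp: p_def q_def)
    then have "com y p \<in> X s" using y ws by (auto simp: W_def)
    then show ?thesis using X_zero_words[of "com y p" q] ws w by (simp add: com_append)
  qed
  have Yc: "Y s \<subseteq> carrier L" using hideal_subgroupD(1)[OF Y s] .
  have W_sub: "subgroup (W i) (add_monoid L)" for i
    using hideal_subgroupD[OF Y s] hideal_subgroupD[OF X s] Yc hword_snd
    by (intro add_subgroupI) (auto simp: W_def com_add com_minus com_zero subset_iff[of "Y s"])
  have Z: "hideal (Z i)" for i unfolding Z_def by (rule hideal_into[OF Y W_sub])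
  have XW: "X s \<inter> Y s \<subseteq> W i" for i using X_zero_words by (auto simp: W_def)
  have WY: "W i \<subseteq> Y s" for i by (auto simp: W_def)
  have Wk: "W k = Y s"
    using k[OF s] hidealD(2)[OF Y s] hideal_subgroupD(2)[OF X s] by (auto simp: W_def)
  have W0: "W 0 \<subseteq> X s" by (auto simp: W_def)
  have W_Suc: "W i \<subseteq> W (Suc i)" for i using W_mono WY by (fastforce simp: W_def)
  have Z_Suc: "Z i a \<subseteq> Z (Suc i) a" for i a using W_Suc by (auto simp: Z_def into_def)
  have Zk: "Y a \<subseteq> Z k a" if "a \<in> carrier A" for a
    using hideal_com[OF Y that] Wk by (auto simp: Z_def into_def)
  have ZY: "Z i a \<subseteq> Y a" for i a by (auto simp: Z_def into_def)
  have ZX: "Z i a \<subseteq> Z j a" if a: "a \<in> carrier A" "a \<notin> S" for i j a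
  proof
    fix y assume "y \<in> Z i a"
    then have y: "y \<in> Y a" "y \<in> X a" using ZY supp a by blast+
    then show "y \<in> Z j a"
      using hideal_com[OF Y a(1) y(1)] hideal_com[OF X a(1) y(2)] XW
      by (auto simp: Z_def into_def)
  qed
  have Z_loop: "com y ws \<in> W i" if y: "y \<in> Z (Suc i) s" and ws: "hword ws" "ws \<noteq> []" "tw ws = \<one>\<^bsub>A\<^esub>"
    for y ws i
  proof (rule weight_zero_words_at_top[OF P X Y s top W_sub XW _ _ ws])
    show "y \<in> Y s" using y ZY by blast
    have yW: "y \<in> W (Suc i)" using into_base[OF y[unfolded Z_def]] s by simp
    fix ws assume ws: "hword ws" "ws \<noteq> []" "set (map fst ws) \<subseteq> {\<one>\<^bsub>A\<^esub>}"
    then have "length ws \<ge> 1" by (cases ws) auto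
    then have "com y (ws @ vs) \<in> X s" if "hword vs" "set (map fst vs) \<subseteq> {\<one>\<^bsub>A\<^esub>}" "length vs = i" for vs
      using W_mono[OF yW, of "ws @ vs"] ws that by auto
    then show "com y ws \<in> W i"
      using Y_zero_words[OF \<open>y \<in> Y s\<close> ws(1,3)] by (auto simp: W_def com_append)
  qed
  have step: "lands (m + 1) (Z (Suc i)) (Z i)" for i
  proof -
    \<comment> \<open>The link is split at the ideal \<open>Q\<close> that agrees with \<open>Z (i + 1)\<close> at weight \<open>s\<close> and with \<open>Z i\<close>
      elsewhere: modulo \<open>Q\<close> the weight \<open>s\<close> has left the support, and one entry sends \<open>Q\<close> into \<open>Z i\<close>.\<close>
    define Q where "Q = (Z i)(s := Z (Suc i) s)"
    have ZQ: "Z i a \<subseteq> Q a" for a using Z_Suc by (auto simp: Q_def)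
    have one: "bracket L y x \<in> Z i (a \<otimes>\<^bsub>A\<^esub> b)"
      if a: "a \<in> carrier A" and b: "b \<in> carrier A" and y: "y \<in> Q a" and x: "x \<in> G b" for a b x y
    proof (cases "a = s")
      case False
      then show ?thesis using y hidealD(3)[OF Z a _ b x] by (simp add: Q_def)
    next
      case True
      then have y': "y \<in> Z (Suc i) s" using y by (simp add: Q_def)
      have "com y ((b, x) # ws) \<in> W i" if "hword ws" "(s \<otimes>\<^bsub>A\<^esub> b) \<otimes>\<^bsub>A\<^esub> tw ws = s" for ws
      proof (rule Z_loop[OF y'])
        have c: "b \<otimes>\<^bsub>A\<^esub> tw ws \<in> carrier A" using b tw_closed[OF that(1)] by simp
        have "s \<otimes>\<^bsub>A\<^esub> (b \<otimes>\<^bsub>A\<^esub> tw ws) = s"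
          using that(2) A.m_assoc[OF s b tw_closed[OF that(1)]] by simp
        then show "tw ((b, x) # ws) = \<one>\<^bsub>A\<^esub>" using A.l_cancel_one[OF s c] by simp
      qed (use that b x in auto)
      then show ?thesis
        using hidealD(3)[OF Y s _ b x] y' ZY True by (auto simp: Z_def into_def)
    qed
    have hQ: "hideal Q"
    proof (rule hidealI)
      fix a assume a: "a \<in> carrier A"
      show "Q a \<subseteq> G a" "\<zero>\<^bsub>L\<^esub> \<in> Q a"
        using hidealD(2)[OF Z a] hideal_subgroupD(2)[OF Z a] by (auto simp: Q_def)
      show "x \<oplus>\<^bsub>L\<^esub> y \<in> Q a" if "x \<in> Q a" "y \<in> Q a" for x y
        using hideal_subgroupD(3)[OF Z a] that by (auto simp: Q_def split: if_splits)
      show "\<ominus>\<^bsub>L\<^esub> x \<in> Q a" if "x \<in> Q a" for x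
        using hideal_subgroupD(4)[OF Z a] that by (auto simp: Q_def split: if_splits)
    qed (use one ZQ in blast)
    from hQ have "lands m (Z (Suc i)) Q"
      unfolding m_def
    proof (rule Suc.IH[OF _ Z S'])
      show "Z (Suc i) a \<subseteq> Q a" if "a \<in> carrier A" "a \<notin> S - {s}" for a
        using ZX[of a "Suc i" i] that by (auto simp: Q_def)
    qed
    moreover have "lands 1 Q (Z i)"
      unfolding lands_def using one by (auto simp: length_Suc_conv)
    ultimately show ?thesis by (rule lands_trans)
  qed
  have chain: "lands (j * (m + 1)) (Z j) (Z 0)" for j
  proof (induction j)
    case 0 show ?case by (auto simp: lands_def)
  next
    case (Suc j)
    have "m + 1 + j * (m + 1) = Suc j * (m + 1)" by simp
    then show ?case using lands_trans[OF step Suc.IH] by metis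
  qed
  have "lands m (Z 0) X"
    unfolding m_def
  proof (rule Suc.IH[OF X Z S'])
    fix a assume a: "a \<in> carrier A" "a \<notin> S - {s}"
    show "Z 0 a \<subseteq> X a"
    proof (cases "a = s")
      case True
      then show ?thesis using into_base[of _ Y "{s}" "\<lambda>_. W 0" s] s W0 by (auto simp: Z_def)
    next
      case False then show ?thesis using a supp ZY by blast
    qed
  qed
  then have "lands (k * (m + 1) + m) (Z k) X" using lands_trans[OF chain] by blast
  moreover have "k * (m + 1) + m = (k + 1) ^ Suc e - 1"
  proof -
    have "(k + 1) ^ e > 0" by simp
    then have "m + 1 = (k + 1) ^ e" by (simp add: m_def)
    then have "(k + 1) ^ Suc e = k * (m + 1) + m + 1" by simp
    then show ?thesis by simp
  qed
  ultimately show ?case using Zk by (auto simp: lands_def)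
qed

end

section \<open>Homogeneous components of arbitrary elements\<close>

context graded_lie_algebra
begin

definition proj :: "'a \<Rightarrow> 'l \<Rightarrow> 'l" where
  "proj a x = (THE u. u \<in> (\<Pi>\<^sub>E a\<in>carrier A. G a) \<and> finite {a \<in> carrier A. u a \<noteq> \<zero>\<^bsub>L\<^esub>}
     \<and> x = (\<Oplus>\<^bsub>L\<^esub>a\<in>{a \<in> carrier A. u a \<noteq> \<zero>\<^bsub>L\<^esub>}. u a)) a"

lemma proj_finsum:
  assumes F: "finite F" "F \<subseteq> carrier A" and v: "\<And>a. a \<in> F \<Longrightarrow> v a \<in> G a" and a: "a \<in> carrier A"
  shows "proj a (\<Oplus>\<^bsub>L\<^esub>b\<in>F. v b) = (if a \<in> F then v a else \<zero>\<^bsub>L\<^esub>)"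
proof -
  let ?x = "\<Oplus>\<^bsub>L\<^esub>b\<in>F. v b"
  let ?P = "\<lambda>u. u \<in> (\<Pi>\<^sub>E a\<in>carrier A. G a) \<and> finite {a \<in> carrier A. u a \<noteq> \<zero>\<^bsub>L\<^esub>}
     \<and> ?x = (\<Oplus>\<^bsub>L\<^esub>a\<in>{a \<in> carrier A. u a \<noteq> \<zero>\<^bsub>L\<^esub>}. u a)"
  have vc: "v b \<in> carrier L" if "b \<in> F" for b using v that F G_carrier by blast
  then have x: "?x \<in> carrier L" by (intro M.finsum_closed) auto
  define u where "u = (\<lambda>a\<in>carrier A. if a \<in> F then v a else \<zero>\<^bsub>L\<^esub>)"
  have "{a \<in> carrier A. u a \<noteq> \<zero>\<^bsub>L\<^esub>} \<subseteq> F" by (auto simp: u_def split: if_splits)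
  moreover have "?x = (\<Oplus>\<^bsub>L\<^esub>a\<in>{a \<in> carrier A. u a \<noteq> \<zero>\<^bsub>L\<^esub>}. u a)"
    using F vc by (intro M.add.finprod_mono_neutral_cong_right) (auto simp: u_def)
  moreover have "u \<in> (\<Pi>\<^sub>E a\<in>carrier A. G a)" using v G_zero by (auto simp: u_def)
  ultimately have "?P u" using F finite_subset by blast
  then have "(THE u. ?P u) = u" using the1_equality[OF direct_sum[OF x]] by blast
  then show ?thesis using a by (simp add: proj_def u_def)
qed

lemma homogeneous_decomposition:
  assumes x: "x \<in> carrier L"
  shows "\<And>a. a \<in> carrier A \<Longrightarrow> proj a x \<in> G a" "finite {a \<in> carrier A. proj a x \<noteq> \<zero>\<^bsub>L\<^esub>}"
    "x = (\<Oplus>\<^bsub>L\<^esub>a\<in>{a \<in> carrier A. proj a x \<noteq> \<zero>\<^bsub>L\<^esub>}. proj a x)"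
proof -
  let ?P = "\<lambda>u. u \<in> (\<Pi>\<^sub>E a\<in>carrier A. G a) \<and> finite {a \<in> carrier A. u a \<noteq> \<zero>\<^bsub>L\<^esub>}
     \<and> x = (\<Oplus>\<^bsub>L\<^esub>a\<in>{a \<in> carrier A. u a \<noteq> \<zero>\<^bsub>L\<^esub>}. u a)"
  have "?P (THE u. ?P u)" using theI'[OF direct_sum[OF x]] by blast
  then have "?P (\<lambda>a. proj a x)" unfolding proj_def by simp
  then show "\<And>a. a \<in> carrier A \<Longrightarrow> proj a x \<in> G a" "finite {a \<in> carrier A. proj a x \<noteq> \<zero>\<^bsub>L\<^esub>}"
    "x = (\<Oplus>\<^bsub>L\<^esub>a\<in>{a \<in> carrier A. proj a x \<noteq> \<zero>\<^bsub>L\<^esub>}. proj a x)" by auto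
qed

lemma proj_homogeneous:
  assumes "x \<in> G b" "b \<in> carrier A" "a \<in> carrier A"
  shows "proj a x = (if a = b then x else \<zero>\<^bsub>L\<^esub>)"
  using proj_finsum[of "{b}" "\<lambda>_. x" a] assms G_carrier by (simp add: M.finsum_singleton)

lemma proj_add:
  assumes x: "x \<in> carrier L" and y: "y \<in> carrier L" and a: "a \<in> carrier A"
  shows "proj a (x \<oplus>\<^bsub>L\<^esub> y) = proj a x \<oplus>\<^bsub>L\<^esub> proj a y"
proof -
  let ?S = "\<lambda>x. {a \<in> carrier A. proj a x \<noteq> \<zero>\<^bsub>L\<^esub>}"
  let ?F = "?S x \<union> ?S y"
  note dx = homogeneous_decomposition[OF x] and dy = homogeneous_decomposition[OF y]
  have F: "finite ?F" "?F \<subseteq> carrier A" using dx(2) dy(2) by auto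
  have xF: "x = (\<Oplus>\<^bsub>L\<^esub>a\<in>?F. proj a x)"
    by (subst dx(3), rule M.add.finprod_mono_neutral_cong_left) (use F dx(1) G_carrier in auto)
  have yF: "y = (\<Oplus>\<^bsub>L\<^esub>a\<in>?F. proj a y)"
    by (subst dy(3), rule M.add.finprod_mono_neutral_cong_left) (use F dy(1) G_carrier in auto)
  have eq: "x \<oplus>\<^bsub>L\<^esub> y = (\<Oplus>\<^bsub>L\<^esub>a\<in>?F. proj a x \<oplus>\<^bsub>L\<^esub> proj a y)"
    by (subst xF, subst yF, rule M.finsum_addf[symmetric]) (use F dx(1) dy(1) G_carrier in auto)
  have "proj b x \<oplus>\<^bsub>L\<^esub> proj b y \<in> G b" if "b \<in> ?F" for b
    using that F(2) dx(1) dy(1) G_add by blast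
  then have "proj a (x \<oplus>\<^bsub>L\<^esub> y) = (if a \<in> ?F then proj a x \<oplus>\<^bsub>L\<^esub> proj a y else \<zero>\<^bsub>L\<^esub>)"
    unfolding eq by (rule proj_finsum[OF F _ a])
  then show ?thesis using a by auto
qed

inductive_set graded_span :: "'a set \<Rightarrow> 'l set" for T where
  zero: "\<zero>\<^bsub>L\<^esub> \<in> graded_span T"
| add: "\<lbrakk>t \<in> T; x \<in> G t; y \<in> graded_span T\<rbrakk> \<Longrightarrow> x \<oplus>\<^bsub>L\<^esub> y \<in> graded_span T"

lemma graded_span_carrier: "\<lbrakk>y \<in> graded_span T; T \<subseteq> carrier A\<rbrakk> \<Longrightarrow> y \<in> carrier L"
  by (induction rule: graded_span.induct) (use G_carrier in auto)

lemma graded_span_add: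
  assumes "T \<subseteq> carrier A" "y \<in> graded_span T"
  shows "x \<in> graded_span T \<Longrightarrow> x \<oplus>\<^bsub>L\<^esub> y \<in> graded_span T"
proof (induction x rule: graded_span.induct)
  case zero
  then show ?case using assms graded_span_carrier by simp
next
  case (add t x z)
  then have "x \<in> carrier L" "z \<in> carrier L" "y \<in> carrier L"
    using assms graded_span_carrier G_carrier by blast+
  then show ?case using add by (simp add: M.a_assoc graded_span.add)
qed

lemma graded_span_homogeneous: "\<lbrakk>t \<in> T; t \<in> carrier A; x \<in> G t\<rbrakk> \<Longrightarrow> x \<in> graded_span T"
  using graded_span.add[OF _ _ graded_span.zero, of t T x] G_carrier by simp

lemma graded_span_mono: "\<lbrakk>x \<in> graded_span T; T \<subseteq> T'\<rbrakk> \<Longrightarrow> x \<in> graded_span T'"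
  by (induction rule: graded_span.induct) (auto intro: graded_span.intros)

lemma graded_span_finsum:
  assumes "finite F" "\<And>i. i \<in> F \<Longrightarrow> t i \<in> T" "T \<subseteq> carrier A" "\<And>i. i \<in> F \<Longrightarrow> f i \<in> G (t i)"
  shows "finsum L f F \<in> graded_span T"
  using assms(1,2,4)
proof (induction F rule: finite_induct)
  case (insert i F)
  then have "f \<in> F \<rightarrow> carrier L" "f i \<in> carrier L" using assms(3) G_carrier by blast+
  then show ?case using insert graded_span.add[of "t i" T "f i"] by simp
qed (simp add: graded_span.zero)

lemma graded_span_bracket:
  assumes T: "T \<subseteq> carrier A" "T' \<subseteq> carrier A" "\<And>t t'. \<lbrakk>t \<in> T; t' \<in> T'\<rbrakk> \<Longrightarrow> t \<otimes>\<^bsub>A\<^esub> t' \<in> U"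
    and U: "U \<subseteq> carrier A" and y: "y \<in> graded_span T'"
  shows "x \<in> graded_span T \<Longrightarrow> bracket L x y \<in> graded_span U"
proof (induction x rule: graded_span.induct)
  case zero
  then show ?case using graded_span_carrier[OF y T(2)] by (simp add: graded_span.zero)
next
  case (add t x z)
  have x: "x \<in> carrier L" and z: "z \<in> carrier L"
    using add T graded_span_carrier G_carrier by blast+
  have "bracket L x y \<in> graded_span U"
    using y
  proof (induction y rule: graded_span.induct)
    case zero
    then show ?case using x by (simp add: graded_span.zero)
  next
    case (add t' v w)
    have "v \<in> carrier L" "w \<in> carrier L" using add T graded_span_carrier G_carrier by blast+
    then have "bracket L x (v \<oplus>\<^bsub>L\<^esub> w) = bracket L x v \<oplus>\<^bsub>L\<^esub> bracket L x w"
      using x bracket_add_right by blast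
    moreover have "bracket L x v \<in> G (t \<otimes>\<^bsub>A\<^esub> t')"
      using bracket_component \<open>t \<in> T\<close> \<open>x \<in> G t\<close> add T by blast
    ultimately show ?case using graded_span.add[OF T(3)] add \<open>t \<in> T\<close> by simp
  qed
  then show ?case
    using bracket_add_left[OF x z graded_span_carrier[OF y T(2)]] graded_span_add[OF U] add by simp
qed

lemma carrier_graded_span: "x \<in> carrier L \<Longrightarrow> x \<in> graded_span (carrier A)"
  by (subst homogeneous_decomposition(3), assumption, rule graded_span_finsum)
    (auto simp: homogeneous_decomposition)

lemma proj_outside_span:
  assumes "s \<in> carrier A" "s \<notin> T" "T \<subseteq> carrier A"
  shows "y \<in> graded_span T \<Longrightarrow> proj s y = \<zero>\<^bsub>L\<^esub>"
proof (induction y rule: graded_span.induct)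
  case zero
  then show ?case using proj_homogeneous[of "\<zero>\<^bsub>L\<^esub>" s s] G_zero assms by simp
next
  case (add t x y)
  then show ?case
    using proj_add[of x y s] proj_homogeneous[of x t s] graded_span_carrier[of y T] G_carrier assms
    by auto
qed

text \<open>Commutators are multilinear, so homogeneous entries suffice to test nilpotency.\<close>

lemma nilpotent_if_homogeneous:
  assumes "\<And>a y ws. \<lbrakk>a \<in> carrier A; y \<in> G a; hword ws; length ws = n\<rbrakk> \<Longrightarrow> com y ws = \<zero>\<^bsub>L\<^esub>"
    and x: "x \<in> carrier L" and "set ys \<subseteq> carrier L" "length ys = n"
  shows "foldl (bracket L) x ys = \<zero>\<^bsub>L\<^esub>"
proof -
  define N where "N i = {y \<in> carrier L. \<forall>ws. hword ws \<and> length ws = i \<longrightarrow> com y ws = \<zero>\<^bsub>L\<^esub>}" for i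
  have N0: "\<zero>\<^bsub>L\<^esub> \<in> N i" for i using hword_snd by (auto simp: N_def com_zero)
  have Na: "y \<oplus>\<^bsub>L\<^esub> z \<in> N i" if "y \<in> N i" "z \<in> N i" for y z i
    using that hword_snd by (auto simp: N_def com_add)
  have red: "foldl (bracket L) y ys = \<zero>\<^bsub>L\<^esub>" if "y \<in> N i" "set ys \<subseteq> carrier L" "length ys = i" for y ys i
    using that
  proof (induction ys arbitrary: y i)
    case Nil
    then show ?case by (auto simp: N_def)
  next
    case (Cons z ys)
    have y: "y \<in> carrier L" using Cons.prems by (simp add: N_def)
    have kill: "\<forall>ws. hword ws \<and> length ws = Suc (length ys) \<longrightarrow> com y ws = \<zero>\<^bsub>L\<^esub>"
      using Cons.prems(1,3) by (simp add: N_def)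
    have hom: "bracket L y v \<in> N (length ys)" if "b \<in> carrier A" "v \<in> G b" for b v
    proof -
      have "com y ((b, v) # ws) = \<zero>\<^bsub>L\<^esub>" if "hword ws" "length ws = length ys" for ws
        using spec[OF kill, of "(b, v) # ws"] that \<open>b \<in> carrier A\<close> \<open>v \<in> G b\<close> by simp
      moreover have "bracket L y v \<in> carrier L" using bracket_closed[OF y G_carrier[OF that]] .
      ultimately show ?thesis by (auto simp: N_def)
    qed
    have "z \<in> graded_span (carrier A)" using Cons.prems carrier_graded_span by simp
    then have "bracket L y z \<in> N (length ys)"
    proof (induction z rule: graded_span.induct)
      case zero then show ?case using y N0 by simp
    next
      case (add t v w)
      then show ?case
        using bracket_add_right[of y v w] y G_carrier graded_span_carrier[of w "carrier A"]
          hom Na by auto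
    qed
    then show ?case using Cons.IH Cons.prems by simp
  qed
  have "x \<in> graded_span (carrier A)" using x carrier_graded_span by simp
  then have "x \<in> N n"
  proof (induction x rule: graded_span.induct)
    case zero then show ?case using N0 by simp
  next
    case (add t v w)
    then have "v \<in> N n" using assms(1) G_carrier by (auto simp: N_def)
    then show ?case using Na add by blast
  qed
  then show ?thesis using red assms by blast
qed

end


section \<open>Vanishing of independent commutators\<close>

locale graded_fpf_action = graded_lie_algebra R L A G + fpf_action A H e act
  for R :: "('r, 'm) ring_scheme" (structure)
    and L :: "('r, 'l, 'n) lie_algebra_scheme" (structure)
    and A :: "('a, 'p) monoid_scheme" (structure)
    and G :: "'a \<Rightarrow> 'l set"
    and H :: "'h set" and e :: 'h and act :: "'h \<Rightarrow> 'a \<Rightarrow> 'a"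
begin

text \<open>The part of nilpotency of class \<open>j\<close> modulo \<open>X\<close> that \<open>L\<close> inherits from the fixed points of \<open>H\<close>.\<close>

definition selective :: "nat \<Rightarrow> ('a \<Rightarrow> 'l set) \<Rightarrow> bool" where
  "selective j X \<longleftrightarrow> (\<forall>d\<in>carrier A. \<forall>u\<in>G d. \<forall>ws. hword ws \<and> length ws = j \<and> indep (d # map fst ws)
     \<longrightarrow> com u ws \<in> X (d \<otimes>\<^bsub>A\<^esub> tw ws))"

lemma selectiveD:
  "\<lbrakk>selective j X; d \<in> carrier A; u \<in> G d; hword ws; length ws = j; indep (d # map fst ws)\<rbrakk>
    \<Longrightarrow> com u ws \<in> X (d \<otimes>\<^bsub>A\<^esub> tw ws)"
  unfolding selective_def by blast

text \<open>Expand a commutator in the orbit sums of the entries. The summand in which no entry is twisted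
  has the total weight of the original entries, and by independence it is the only one of that
  weight.\<close>

lemma selective_if_orbit_sums_nilpotent:
  fixes lact :: "'h \<Rightarrow> 'l \<Rightarrow> 'l"
  defines "osum \<equiv> \<lambda>x. \<Oplus>\<^bsub>L\<^esub>h\<in>H. lact h x"
  assumes lact_e: "\<And>x. x \<in> carrier L \<Longrightarrow> lact e x = x"
    and lact_G: "\<And>h a x. \<lbrakk>h \<in> H; a \<in> carrier A; x \<in> G a\<rbrakk> \<Longrightarrow> lact h x \<in> G (act h a)"
    and nil: "\<And>x ys. \<lbrakk>x \<in> carrier L; set ys \<subseteq> carrier L; length ys = c\<rbrakk> \<Longrightarrow>
      foldl (bracket L) (osum x) (map osum ys) = \<zero>\<^bsub>L\<^esub>"
  shows "selective c (\<lambda>_. {\<zero>\<^bsub>L\<^esub>})"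
  unfolding selective_def
proof (intro ballI allI impI, elim conjE)
  fix d u ws
  assume d: "d \<in> carrier A" and u: "u \<in> G d" and ws: "hword ws" "length ws = c"
    and ind: "indep (d # map fst ws)"
  \<comment> \<open>The total weights of the twisted summands.\<close>
  define tweights where "tweights ds =
    {A.wt (map2 act hs ds) | hs. set hs \<subseteq> H \<and> length hs = length ds \<and> \<not> set hs \<subseteq> {e}}" for ds
  define oword where "oword ws = map (\<lambda>(b, x). (b, osum x)) ws" for ws :: "('a \<times> 'l) list"
  have tweightsI: "t \<in> tweights ds"
    if "A.wt (map2 act hs ds) = t" "set hs \<subseteq> H" "length hs = length ds" "\<not> set hs \<subseteq> {e}" for t hs ds
    using that unfolding tweights_def by blast
  have tweights_sub: "tweights ds \<subseteq> carrier A" if "set ds \<subseteq> carrier A" for ds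
    using that map2_act_closed[of _ ds] by (auto simp: tweights_def)
  have osum_split: "\<exists>r. r \<in> graded_span ((\<lambda>h. act h b) ` (H - {e})) \<and> osum x = x \<oplus>\<^bsub>L\<^esub> r"
    if b: "b \<in> carrier A" and x: "x \<in> G b" for b x
  proof -
    have "lact h x \<in> carrier L" if "h \<in> H" for h using lact_G[OF that b x] G_carrier b that by blast
    then have f: "(\<lambda>h. lact h x) \<in> H - {e} \<rightarrow> carrier L" "lact e x \<in> carrier L"
      using e_in by auto
    have "osum x = finsum L (\<lambda>h. lact h x) (insert e (H - {e}))"
      using e_in by (simp add: osum_def insert_absorb)
    also have "\<dots> = lact e x \<oplus>\<^bsub>L\<^esub> finsum L (\<lambda>h. lact h x) (H - {e})"
      using finite_H f by (intro M.finsum_insert) auto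
    also have "lact e x = x" using lact_e G_carrier b x by blast
    finally show ?thesis
      using graded_span_finsum[of "H - {e}" "\<lambda>h. act h b" "(\<lambda>h. act h b) ` (H - {e})" "\<lambda>h. lact h x"]
        finite_H b lact_G[OF _ b x] by auto
  qed
  have osum_span: "osum x \<in> graded_span ((\<lambda>h. act h b) ` H)" if "b \<in> carrier A" "x \<in> G b" for b x
    unfolding osum_def using that lact_G finite_H by (intro graded_span_finsum) auto
  have expand: "\<exists>r. r \<in> graded_span (tweights (d # map fst ws)) \<and>
      com (osum u) (oword ws) = com u ws \<oplus>\<^bsub>L\<^esub> r" if "hword ws" for ws
    using that
  proof (induction ws rule: rev_induct)
    case Nil
    have "(\<lambda>h. act h d) ` (H - {e}) \<subseteq> tweights [d]"
    proof
      fix t assume "t \<in> (\<lambda>h. act h d) ` (H - {e})"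
      then obtain h where "h \<in> H" "h \<noteq> e" "t = act h d" by blast
      then show "t \<in> tweights [d]"
        using d by (intro tweightsI[of "[h]"]) auto
    qed
    then obtain r where "r \<in> graded_span (tweights [d])" "osum u = u \<oplus>\<^bsub>L\<^esub> r"
      using osum_split[OF d u] graded_span_mono by blast
    then show ?case by (auto simp: oword_def)
  next
    case (snoc w ws)
    obtain b x where w: "w = (b, x)" by force
    have b: "b \<in> carrier A" and x: "x \<in> G b" and hws: "hword ws" using snoc.prems w by auto
    obtain r where r: "r \<in> graded_span (tweights (d # map fst ws))"
      "com (osum u) (oword ws) = com u ws \<oplus>\<^bsub>L\<^esub> r" using snoc.IH[OF hws] by blast
    obtain r' where r': "r' \<in> graded_span ((\<lambda>h. act h b) ` (H - {e}))" "osum x = x \<oplus>\<^bsub>L\<^esub> r'"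
      using osum_split[OF b x] by blast
    let ?ds = "d # map fst ws"
    let ?U = "tweights (?ds @ [b])"
    have ds: "set ?ds \<subseteq> carrier A" using d hword_fst[OF hws] by auto
    have U: "?U \<subseteq> carrier A" using tweights_sub ds b by simp
    have v: "com u ws \<in> G (A.wt ?ds)" using com_component[OF d u hws] by simp
    have wtc: "A.wt ?ds \<in> carrier A" using ds A.wt_closed by blast
    have vc: "com u ws \<in> carrier L" using v wtc G_carrier by blast
    have rc: "r \<in> carrier L" using graded_span_carrier[OF r(1) tweights_sub[OF ds]] .
    have xc: "x \<in> carrier L" using G_carrier b x by blast
    have oc: "osum x \<in> carrier L"
      using graded_span_carrier[OF osum_span[OF b x]] b by blast
    have r'c: "r' \<in> carrier L" using graded_span_carrier[OF r'(1)] b by blast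
    have 1: "bracket L (com u ws) r' \<in> graded_span ?U"
    proof (rule graded_span_bracket[OF _ _ _ U r'(1)])
      show "com u ws \<in> graded_span {A.wt ?ds}" using graded_span_homogeneous[OF _ wtc v] by simp
      fix t t' assume t: "t \<in> {A.wt ?ds}" and "t' \<in> (\<lambda>h. act h b) ` (H - {e})"
      then obtain h where h: "h \<in> H" "h \<noteq> e" "t' = act h b" by blast
      let ?hs = "replicate (length ?ds) e @ [h]"
      have "map2 act (replicate (length ds) e) ds = ds" if "set ds \<subseteq> carrier A" for ds
        using that by (induction ds) (auto simp: act_e)
      from this[OF ds] have "map2 act ?hs (?ds @ [b]) = ?ds @ [act h b]"
        by (subst zip_append) (simp_all del: replicate.simps length_Cons)
      then have "A.wt (map2 act ?hs (?ds @ [b])) = t \<otimes>\<^bsub>A\<^esub> t'"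
        using A.wt_append[OF ds, of "[act h b]"] t h b by simp
      moreover have "set ?hs \<subseteq> H" "length ?hs = length (?ds @ [b])" "\<not> set ?hs \<subseteq> {e}"
        using h e_in by auto
      ultimately show "t \<otimes>\<^bsub>A\<^esub> t' \<in> ?U" by (rule tweightsI)
    qed (use wtc b in auto)
    have 2: "bracket L r (osum x) \<in> graded_span ?U"
    proof (rule graded_span_bracket[OF tweights_sub[OF ds] _ _ U osum_span[OF b x] r(1)])
      fix t t' assume t: "t \<in> tweights ?ds" and "t' \<in> (\<lambda>h. act h b) ` H"
      then obtain h where h: "h \<in> H" "t' = act h b" by blast
      from t obtain hs where hs: "t = A.wt (map2 act hs ?ds)" "set hs \<subseteq> H"
        "length hs = length ?ds" "\<not> set hs \<subseteq> {e}" unfolding tweights_def by blast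
      have "map2 act (hs @ [h]) (?ds @ [b]) = map2 act hs ?ds @ [act h b]"
        by (simp only: zip_append[OF hs(3)] map_append) simp
      then have "A.wt (map2 act (hs @ [h]) (?ds @ [b])) = t \<otimes>\<^bsub>A\<^esub> t'"
        using A.wt_append[OF map2_act_closed[OF hs(2) ds], of "[act h b]"] hs(1) h b by simp
      moreover have "set (hs @ [h]) \<subseteq> H" "length (hs @ [h]) = length (?ds @ [b])" "\<not> set (hs @ [h]) \<subseteq> {e}"
        using h hs by auto
      ultimately show "t \<otimes>\<^bsub>A\<^esub> t' \<in> ?U" by (rule tweightsI)
    qed (use b in auto)
    have "com (osum u) (oword (ws @ [w])) = bracket L (com u ws \<oplus>\<^bsub>L\<^esub> r) (osum x)"
      using r w by (simp add: oword_def com_append)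
    also have "\<dots> = bracket L (com u ws) (x \<oplus>\<^bsub>L\<^esub> r') \<oplus>\<^bsub>L\<^esub> bracket L r (osum x)"
      using bracket_add_left[OF vc rc oc] r'(2) by simp
    also have "\<dots> = bracket L (com u ws) x \<oplus>\<^bsub>L\<^esub> (bracket L (com u ws) r' \<oplus>\<^bsub>L\<^esub> bracket L r (osum x))"
      using vc rc oc xc r'c by (simp add: bracket_add_right bracket_closed M.a_assoc)
    finally show ?case using graded_span_add[OF U 2 1] w by (auto simp: com_append)
  qed
  let ?ds = "d # map fst ws"
  have ds: "set ?ds \<subseteq> carrier A" using d hword_fst[OF ws(1)] by auto
  have wtc: "A.wt ?ds \<in> carrier A" using ds A.wt_closed by blast
  obtain r where r: "r \<in> graded_span (tweights ?ds)" "com (osum u) (oword ws) = com u ws \<oplus>\<^bsub>L\<^esub> r"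
    using expand[OF ws(1)] by blast
  have "A.wt ?ds \<notin> tweights ?ds"
  proof
    assume "A.wt ?ds \<in> tweights ?ds"
    then obtain hs where "A.wt (map2 act hs ?ds) = A.wt ?ds" "set hs \<subseteq> H"
      "length hs = length ?ds" "\<not> set hs \<subseteq> {e}" unfolding tweights_def by fastforce
    then show False using ind unfolding indep_def by blast
  qed
  then have pr: "proj (A.wt ?ds) r = \<zero>\<^bsub>L\<^esub>" using proj_outside_span[OF wtc _ tweights_sub[OF ds] r(1)] by blast
  have v: "com u ws \<in> G (A.wt ?ds)" using com_component[OF d u ws(1)] by simp
  have vc: "com u ws \<in> carrier L" using v wtc G_carrier by blast
  have rc: "r \<in> carrier L" using graded_span_carrier[OF r(1) tweights_sub[OF ds]] .
  have "map snd (oword ws) = map osum (map snd ws)" by (auto simp: oword_def)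
  then have "com (osum u) (oword ws) = \<zero>\<^bsub>L\<^esub>"
    unfolding com_def using nil[of u "map snd ws"] ws hword_snd[OF ws(1)] G_carrier[OF d u] by auto
  then have "com u ws \<oplus>\<^bsub>L\<^esub> r = \<zero>\<^bsub>L\<^esub>" using r by simp
  then have "proj (A.wt ?ds) (com u ws) \<oplus>\<^bsub>L\<^esub> \<zero>\<^bsub>L\<^esub> = proj (A.wt ?ds) \<zero>\<^bsub>L\<^esub>"
    using proj_add[OF vc rc wtc] pr by simp
  then show "com u ws \<in> {\<zero>\<^bsub>L\<^esub>}"
    using proj_homogeneous[OF v wtc wtc] proj_homogeneous[OF G_zero[OF wtc] wtc wtc] vc by simp
qed

end

section \<open>From selective nilpotency to nilpotency\<close>

text \<open>At most \<open>q ^ (j + 2)\<close> weights extend an independent sequence of length \<open>j + 1\<close> to a dependent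
  one, and \<open>q ^ (j + 2) + (j + 1) + k\<close> entries of equal weight give zero. The power of the second
  number to the first bounds the support of the ideal generated by an independent commutator with
  \<open>j + 1\<close> entries.\<close>

definition support_bound :: "nat \<Rightarrow> nat \<Rightarrow> nat \<Rightarrow> nat" where
  "support_bound q k j = (q ^ (j + 2) + (j + 1) + k) ^ q ^ (j + 2)"

primrec nilpotency_bound :: "nat \<Rightarrow> nat \<Rightarrow> nat \<Rightarrow> nat" where
  "nilpotency_bound q k 0 = k"
| "nilpotency_bound q k (Suc j) = nilpotency_bound q k j + ((k + 1) ^ support_bound q k j - 1)"

locale graded_fpf_action_nil = graded_fpf_action R L A G H e act
  for R :: "('r, 'm) ring_scheme" (structure)
    and L :: "('r, 'l, 'n) lie_algebra_scheme" (structure)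
    and A :: "('a, 'p) monoid_scheme" (structure)
    and G :: "'a \<Rightarrow> 'l set"
    and H :: "'h set" and e :: 'h and act :: "'h \<Rightarrow> 'a \<Rightarrow> 'a" +
  fixes k :: nat
  assumes zero_words:
    "\<lbrakk>a \<in> carrier A; y \<in> G a; hword ws; set (map fst ws) \<subseteq> {\<one>\<^bsub>A\<^esub>}; length ws = k\<rbrakk>
      \<Longrightarrow> com y ws = \<zero>\<^bsub>L\<^esub>"
begin

lemma hideal_com_prefix:
  assumes X: "hideal X" and a: "a \<in> carrier A" and h: "hword p" "hword q"
    and y: "com y p \<in> X (a \<otimes>\<^bsub>A\<^esub> tw p)"
  shows "com y (p @ q) \<in> X (a \<otimes>\<^bsub>A\<^esub> tw (p @ q))"
  using hideal_com[OF X _ y h(2)] a tw_closed[OF h(1)] tw_closed[OF h(2)] h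
  by (simp add: com_append tw_append A.m_assoc del: map_append)

lemma lands_mono:
  assumes "hideal X" "lands n Y X" "n \<le> m"
  shows "lands m Y X"
proof -
  have "lands (m - n) X X" using hideal_com[OF assms(1)] by (auto simp: lands_def)
  then show ?thesis using lands_trans[OF assms(2)] assms(3) by fastforce
qed

lemma zero_words_in_hideal:
  assumes X: "hideal X" and a: "a \<in> carrier A" "y \<in> G a"
    and ws: "hword ws" "set (map fst ws) \<subseteq> {\<one>\<^bsub>A\<^esub>}" "k \<le> length ws"
  shows "com y ws \<in> X (a \<otimes>\<^bsub>A\<^esub> tw ws)"
proof -
  define p q where "p = take k ws" and "q = drop k ws"
  have w: "ws = p @ q" "length p = k" using ws by (auto simp: p_def q_def)
  then have h: "hword p" "hword q" "set (map fst p) \<subseteq> {\<one>\<^bsub>A\<^esub>}" using ws by auto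
  have "a \<otimes>\<^bsub>A\<^esub> tw p \<in> carrier A" using a h by auto
  then have "com y p \<in> X (a \<otimes>\<^bsub>A\<^esub> tw p)"
    using zero_words[OF a h(1,3) w(2)] hideal_subgroupD(2)[OF X] by simp
  then show ?thesis using hideal_com_prefix[OF X a(1) h(1,2)] w by blast
qed

text \<open>Among the weights \<open>a, a + b, a + 2b, \<dots>\<close> only boundedly many form a dependent sequence with
  \<open>j\<close> copies of \<open>b\<close>, so that the other ones yield vanishing commutators.\<close>

lemma selective_engel:
  assumes sel: "selective j X" and X: "hideal X" and a: "a \<in> carrier A" "y \<in> G a"
    and b: "b \<in> carrier A" and ws: "hword ws" "set (map fst ws) \<subseteq> {b}"
    and len: "card H ^ Suc j + j + k \<le> length ws"
  shows "com y ws \<in> X (a \<otimes>\<^bsub>A\<^esub> tw ws)"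
proof (cases "b = \<one>\<^bsub>A\<^esub>")
  case True
  then show ?thesis using zero_words_in_hideal[OF X a ws(1)] ws(2) len by simp
next
  case False
  let ?N = "card H ^ Suc j"
  let ?D = "{i \<in> carrier A. \<not> indep (i # replicate j b)}"
  have D: "finite ?D" "card ?D \<le> ?N"
    using dependent_extensions[OF indep_replicate[OF b False, of j]] b by (auto simp: set_replicate_conv_if)
  have "\<exists>t\<le>?N. a \<otimes>\<^bsub>A\<^esub> b [^]\<^bsub>A\<^esub> t \<notin> ?D"
  proof (rule ccontr)
    assume "\<not> ?thesis"
    then have "(\<lambda>t::nat. a \<otimes>\<^bsub>A\<^esub> b [^]\<^bsub>A\<^esub> t) ` {..?N} \<subseteq> ?D" by blast
    then have "card ((\<lambda>t::nat. a \<otimes>\<^bsub>A\<^esub> b [^]\<^bsub>A\<^esub> t) ` {..?N}) \<le> card ?D" using D(1) card_mono by blast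
    moreover have "card ((\<lambda>t::nat. a \<otimes>\<^bsub>A\<^esub> b [^]\<^bsub>A\<^esub> t) ` {..?N}) = Suc ?N"
      using card_image[OF inj_on_subset[OF inj_mult_pow[OF a(1) b False]], of "{..?N}"] by simp
    ultimately show False using D(2) by simp
  qed
  then obtain t where t: "t \<le> ?N" "indep ((a \<otimes>\<^bsub>A\<^esub> b [^]\<^bsub>A\<^esub> t) # replicate j b)" using a b by auto
  define p r q where "p = take t ws" and "r = take j (drop t ws)" and "q = drop j (drop t ws)"
  have w: "ws = p @ r @ q" by (simp only: p_def r_def q_def append_take_drop_id)
  have l: "length p = t" "length r = j" using len t(1) by (auto simp: p_def r_def)
  have h: "hword p" "hword r" "hword q" using ws(1) w(1) by auto
  have "set (map fst p) \<subseteq> {b}" "set (map fst r) \<subseteq> {b}" using ws(2) w by simp_all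
  then have fst_rep: "map fst p = replicate t b" "map fst r = replicate j b"
    using l by (intro replicate_eqI; force)+
  have p: "tw p = b [^]\<^bsub>A\<^esub> t" using fst_rep(1) A.wt_replicate[OF b] by simp
  have "com (com y p) r \<in> X ((a \<otimes>\<^bsub>A\<^esub> tw p) \<otimes>\<^bsub>A\<^esub> tw r)"
    using com_component[OF a h(1)] t(2) h l a(1) p fst_rep b
    by (intro selectiveD[OF sel]) auto
  then have "com y (p @ r) \<in> X (a \<otimes>\<^bsub>A\<^esub> tw (p @ r))"
    using a(1) tw_closed[OF h(1)] tw_closed[OF h(2)] h
    by (simp add: com_append tw_append A.m_assoc del: map_append)
  then show ?thesis using hideal_com_prefix[OF X a(1), of "p @ r" q] h w by simp
qed

definition reachable :: "'a \<Rightarrow> 'a set \<Rightarrow> nat \<Rightarrow> 'a set" where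
  "reachable d D M = {d \<otimes>\<^bsub>A\<^esub> A.wt bs | bs. set bs \<subseteq> D \<and> (\<forall>i. count (mset bs) i < M)}"

text \<open>A weight in \<open>reachable d D M\<close> depends only on the multiplicities in \<open>bs\<close> of the elements of \<open>D\<close>.\<close>

lemma reachable_bound:
  assumes D: "finite D" "D \<subseteq> carrier A" and M: "M > 0"
  shows "finite (reachable d D M)" "card (reachable d D M) \<le> M ^ card D"
proof -
  let ?F = "D \<rightarrow>\<^sub>E {..<M}"
  define g where "g n = d \<otimes>\<^bsub>A\<^esub> A.wt (SOME bs. set bs \<subseteq> D \<and> (\<forall>i\<in>D. count (mset bs) i = n i))" for n
  have finF: "finite ?F" using D(1) by (intro finite_PiE) auto
  have sub: "reachable d D M \<subseteq> g ` ?F"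
  proof
    fix s assume "s \<in> reachable d D M"
    then obtain bs where bs: "s = d \<otimes>\<^bsub>A\<^esub> A.wt bs" "set bs \<subseteq> D" "\<forall>i. count (mset bs) i < M"
      unfolding reachable_def by blast
    define n where "n = restrict (count (mset bs)) D"
    let ?cs = "SOME cs. set cs \<subseteq> D \<and> (\<forall>i\<in>D. count (mset cs) i = n i)"
    have "set bs \<subseteq> D \<and> (\<forall>i\<in>D. count (mset bs) i = n i)" using bs by (simp add: n_def)
    then have cs: "set ?cs \<subseteq> D \<and> (\<forall>i\<in>D. count (mset ?cs) i = n i)" by (rule someI)
    have "mset bs = mset ?cs"
    proof (rule multiset_eqI)
      fix i show "count (mset bs) i = count (mset ?cs) i"
      proof (cases "i \<in> D")
        case True then show ?thesis using cs by (simp add: n_def)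
      next
        case False
        then have "i \<notin># mset bs" "i \<notin># mset ?cs" using bs(2) cs by auto
        then show ?thesis unfolding not_in_iff by (rule trans[OF _ sym])
      qed
    qed
    then have "s = g n" using A.wt_mset_cong[of bs ?cs] bs D(2) by (simp add: g_def)
    moreover have "n \<in> ?F" using bs(3) by (auto simp: n_def)
    ultimately show "s \<in> g ` ?F" by blast
  qed
  show "finite (reachable d D M)" using finite_subset[OF sub] finF by blast
  have "card (reachable d D M) \<le> card ?F"
    using card_mono[OF finite_imageI[OF finF] sub] card_image_le[OF finF, of g] by linarith
  also have "\<dots> = M ^ card D" using D(1) by (simp add: card_PiE)
  finally show "card (reachable d D M) \<le> M ^ card D" .
qed

text \<open>Let \<open>U = com u ws\<close>. In a commutator \<open>[U, \<dots>]\<close> the entries may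
  be permuted modulo shorter ones. An entry whose weight extends the sequence of \<open>U\<close> independently
  can be moved next to \<open>U\<close>, and the same can be done with many entries of equal weight. In both
  cases the commutator lies in \<open>X\<close>. What remains reaches boundedly many weights.\<close>

lemma independent_commutator_nilpotent:
  assumes sel: "selective (Suc j) X" and X: "hideal X"
    and d: "d \<in> carrier A" "u \<in> G d" and ws: "hword ws" "length ws = j"
    and ind: "indep (d # map fst ws)"
    and vs: "hword vs" "length vs = (k + 1) ^ support_bound (card H) k j - 1"
  shows "com (com u ws) vs \<in> X (d \<otimes>\<^bsub>A\<^esub> tw ws \<otimes>\<^bsub>A\<^esub> tw vs)"
proof -
  define U where "U = com u ws"
  define d0 where "d0 = d \<otimes>\<^bsub>A\<^esub> tw ws"
  \<comment> \<open>\<open>D\<close> holds the weights that need not annihilate \<open>U\<close>, and \<open>M\<close> entries of equal weight give zero.\<close>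
  define D where "D = {i \<in> carrier A. \<not> indep (i # d # map fst ws)}"
  define M where "M = card H ^ (j + 2) + (j + 1) + k"
  define S where "S = reachable d0 D M"
  define Y where "Y = into G (carrier A - S) X"
  have d0: "d0 \<in> carrier A" using d ws by (auto simp: d0_def)
  have U: "U \<in> G d0" using com_component[OF d ws(1)] by (simp add: U_def d0_def)
  have cards: "set (d # map fst ws) \<subseteq> carrier A" using d hword_fst[OF ws(1)] by auto
  have D: "finite D" "card D \<le> card H ^ (j + 2)" "D \<subseteq> carrier A"
    using dependent_extensions[OF ind cards] ws(2) by (auto simp: D_def)
  have M: "M > 0" by (simp add: M_def)
  have S: "finite S" "card S \<le> M ^ card D" using reachable_bound[OF D(1,3) M] by (auto simp: S_def)
  have SA: "S \<subseteq> carrier A"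
  proof
    fix s assume "s \<in> S"
    then obtain bs where "s = d0 \<otimes>\<^bsub>A\<^esub> A.wt bs" "set bs \<subseteq> D" unfolding S_def reachable_def by blast
    then show "s \<in> carrier A" using d0 D(3) A.wt_closed[of bs] by auto
  qed
  have hG: "hideal G"
    using G_zero G_add G_minus bracket_component by (intro hidealI) auto
  have Y: "hideal Y" unfolding Y_def using hidealD(1)[OF X] by (intro hideal_into[OF hG]) auto
  have outside: "com U vs \<in> X (d0 \<otimes>\<^bsub>A\<^esub> tw vs)"
    if vs: "hword vs" and nS: "d0 \<otimes>\<^bsub>A\<^esub> tw vs \<notin> S" for vs
  proof (cases "vs = []")
    case True
    have "d0 \<otimes>\<^bsub>A\<^esub> A.wt [] \<in> S" unfolding S_def reachable_def using M by fastforce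
    then show ?thesis using nS True by simp
  next
    case False
    have dt: "d0 \<otimes>\<^bsub>A\<^esub> tw vs \<in> carrier A" using d0 vs by auto
    show ?thesis
    proof (rule com_collect[OF hidealD(1)[OF X dt] G_carrier[OF d0 U] _ vs False refl])
      fix vs' assume vs': "hword vs'" "vs' \<noteq> []" "tw vs' = tw vs"
      show "\<exists>ws'. mset vs' = mset ws' \<and> com U ws' \<in> X (d0 \<otimes>\<^bsub>A\<^esub> tw vs)"
      proof (cases "set (map fst vs') \<subseteq> D")
        case False
        then obtain w where w: "w \<in> set vs'" "fst w \<notin> D" by auto
        then obtain p q where pq: "vs' = p @ w # q" by (meson split_list)
        have m: "mset vs' = mset (w # p @ q)" using pq by simp
        have h: "fst w \<in> carrier A" "snd w \<in> G (fst w)" "hword (p @ q)" using vs' pq by auto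
        have "indep ((d # map fst ws) @ [fst w])"
          using w(2) h(1) cards by (intro indep_rotate) (auto simp: D_def)
        then have "com u (ws @ [w]) \<in> X (d \<otimes>\<^bsub>A\<^esub> tw (ws @ [w]))"
          using ws h by (intro selectiveD[OF sel d]) auto
        then have "com U [w] \<in> X (d0 \<otimes>\<^bsub>A\<^esub> tw [w])"
          using d ws h tw_closed[OF ws(1)]
          by (simp add: U_def d0_def com_append A.m_assoc tw_append del: map_append)
        then have "com U ([w] @ p @ q) \<in> X (d0 \<otimes>\<^bsub>A\<^esub> tw ([w] @ p @ q))"
          using h by (intro hideal_com_prefix[OF X d0]) auto
        then show ?thesis using m tw_mset[OF m vs'(1)] vs'(3) by (metis append_Cons append_Nil)
      next
        case True
        have "\<exists>i. count (mset (map fst vs')) i \<ge> M"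
        proof (rule ccontr)
          assume "\<not> ?thesis"
          then have "d0 \<otimes>\<^bsub>A\<^esub> tw vs' \<in> S"
            unfolding S_def reachable_def using True not_le by blast
          then show False using nS vs'(3) by simp
        qed
        then obtain i where i: "count (mset (map fst vs')) i \<ge> M" by blast
        then have "i \<in># mset (map fst vs')" using M by (metis count_greater_zero_iff less_le_trans)
        then have ic: "i \<in> carrier A" using True D(3) by auto
        let ?p = "filter (\<lambda>w. fst w = i) vs'" and ?q = "filter (\<lambda>w. fst w \<noteq> i) vs'"
        have h: "hword ?p" "hword ?q" using vs'(1) by (auto simp: hword_def)
        have m: "mset vs' = mset (?p @ ?q)" by simp
        have "count (mset (map fst vs')) i = length ?p"
          by (induction vs') auto
        then have "com U ?p \<in> X (d0 \<otimes>\<^bsub>A\<^esub> tw ?p)"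
          using i by (intro selective_engel[OF sel X d0 U ic h(1)]) (auto simp: M_def)
        then have "com U (?p @ ?q) \<in> X (d0 \<otimes>\<^bsub>A\<^esub> tw (?p @ ?q))"
          using h by (intro hideal_com_prefix[OF X d0]) auto
        then show ?thesis using m tw_mset[OF m vs'(1)] vs'(3) by metis
      qed
    qed
  qed
  have UY: "U \<in> Y d0" using U outside by (auto simp: Y_def into_def)
  have supp: "Y a \<subseteq> X a" if "a \<in> carrier A" "a \<notin> S" for a
    using into_base[of _ G "carrier A - S" X a] that by (auto simp: Y_def)
  obtain P where P: "A.total_cone P" using A.torsion_free_orderable torsion_free by blast
  have "lands ((k + 1) ^ card S - 1) Y X"
    by (rule bounded_support_nilpotent[OF P _ X Y S(1) SA refl]) (use zero_words supp in blast)+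
  moreover have "(k + 1) ^ card S - 1 \<le> (k + 1) ^ support_bound (card H) k j - 1"
  proof -
    have "card S \<le> M ^ card D" using S by simp
    also have "\<dots> \<le> M ^ card H ^ (j + 2)" using D(2) M by (intro power_increasing) auto
    finally have "card S \<le> support_bound (card H) k j" by (simp add: support_bound_def M_def)
    then show ?thesis by (intro diff_le_mono power_increasing) auto
  qed
  ultimately have "lands ((k + 1) ^ support_bound (card H) k j - 1) Y X" using lands_mono[OF X] by blast
  then show ?thesis using landsD[where X = X and Y = Y, OF _ d0 UY vs] by (simp add: U_def d0_def)
qed

text \<open>A single nontrivial weight is independent, so \<open>X\<close> contains all components but \<open>G \<one>\<close>. A commutator
  with a nontrivial weight among its entries has a nontrivial partial weight next to that entry.\<close>

lemma selective_zero_nilpotent: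
  assumes sel: "selective 0 X" and X: "hideal X"
  shows "lands k G X"
  unfolding lands_def
proof (intro ballI allI impI, elim conjE)
  fix a y ws assume a: "a \<in> carrier A" and y: "y \<in> G a" and ws: "hword ws" "length ws = k"
  have GX: "v \<in> X b" if "b \<in> carrier A" "b \<noteq> \<one>\<^bsub>A\<^esub>" "v \<in> G b" for b v
    using selectiveD[OF sel that(1,3), of "[]"] indep_singleton[OF that(1,2)] that(1) by simp
  show "com y ws \<in> X (a \<otimes>\<^bsub>A\<^esub> tw ws)"
  proof (cases "set (map fst ws) \<subseteq> {\<one>\<^bsub>A\<^esub>}")
    case True
    then show ?thesis using zero_words_in_hideal[OF X a y ws(1)] ws(2) by simp
  next
    case False
    then obtain w where w: "w \<in> set ws" "fst w \<noteq> \<one>\<^bsub>A\<^esub>" by auto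
    then obtain p q where pq: "ws = p @ w # q" by (meson split_list)
    have h: "hword p" "fst w \<in> carrier A" "snd w \<in> G (fst w)" "hword (w # q)" "hword q" "hword (p @ [w])"
      using ws(1) pq by auto
    show ?thesis
    proof (cases "a \<otimes>\<^bsub>A\<^esub> tw p = \<one>\<^bsub>A\<^esub>")
      case False
      then have "com y p \<in> X (a \<otimes>\<^bsub>A\<^esub> tw p)"
        using com_component[OF a y h(1)] a tw_closed[OF h(1)] by (intro GX) auto
      then show ?thesis using hideal_com_prefix[OF X a h(1,4)] pq by simp
    next
      case True
      have "a \<otimes>\<^bsub>A\<^esub> tw (p @ [w]) = (a \<otimes>\<^bsub>A\<^esub> tw p) \<otimes>\<^bsub>A\<^esub> fst w"
        using a h tw_closed[OF h(1)] by (simp add: tw_append A.m_assoc del: map_append)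
      then have "a \<otimes>\<^bsub>A\<^esub> tw (p @ [w]) = fst w" using True h(2) by simp
      then have "com y (p @ [w]) \<in> X (a \<otimes>\<^bsub>A\<^esub> tw (p @ [w]))"
        using com_component[OF a y h(6)] w(2) h(2) by (simp add: GX)
      then show ?thesis using hideal_com_prefix[OF X a h(6,5)] pq by simp
    qed
  qed
qed

text \<open>The elements that every commutator with \<open>m\<close> further entries sends into \<open>X\<close> form an ideal \<open>Z\<close>. For
  suitable \<open>m\<close> it contains the independent commutators with \<open>j + 1\<close> entries, so the induction
  hypothesis for \<open>Z\<close> applies.\<close>

theorem selective_nilpotent:
  "\<lbrakk>selective j X; hideal X\<rbrakk> \<Longrightarrow> lands (nilpotency_bound (card H) k j) G X"
proof (induction j arbitrary: X)
  case 0
  then show ?case using selective_zero_nilpotent by simp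
next
  case (Suc j)
  note X = Suc.prems(2)
  define m where "m = (k + 1) ^ support_bound (card H) k j - 1"
  define Z where "Z a = {y \<in> G a. \<forall>ws. hword ws \<and> length ws = m \<longrightarrow> com y ws \<in> X (a \<otimes>\<^bsub>A\<^esub> tw ws)}" for a
  have "hideal Z"
  proof (rule hidealI)
    fix a assume a: "a \<in> carrier A"
    have Xa: "subgroup (X (a \<otimes>\<^bsub>A\<^esub> tw ws)) (add_monoid L)" if "hword ws" for ws
      using that a by (intro hidealD(1)[OF X]) auto
    show "Z a \<subseteq> G a" by (auto simp: Z_def)
    show "\<zero>\<^bsub>L\<^esub> \<in> Z a" using G_zero[OF a] add_subgroupD(2)[OF Xa] hword_snd by (auto simp: Z_def com_zero)
    show "x \<oplus>\<^bsub>L\<^esub> y \<in> Z a" if "x \<in> Z a" "y \<in> Z a" for x y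
      using that G_add[OF a] add_subgroupD(3)[OF Xa] hword_snd G_carrier[OF a] by (auto simp: Z_def com_add)
    show "\<ominus>\<^bsub>L\<^esub> x \<in> Z a" if "x \<in> Z a" for x
      using that G_minus[OF a] add_subgroupD(4)[OF Xa] hword_snd G_carrier[OF a] by (auto simp: Z_def com_minus)
    fix b x y assume b: "b \<in> carrier A" and x: "x \<in> Z a" and y: "y \<in> G b"
    have "com (bracket L x y) ws \<in> X (a \<otimes>\<^bsub>A\<^esub> b \<otimes>\<^bsub>A\<^esub> tw ws)" if ws: "hword ws" "length ws = m" for ws
    proof -
      have "lands m Z X" by (auto simp: lands_def Z_def)
      then have "lands (Suc m) Z X" using lands_mono[OF X] by simp
      from landsD[OF this a x, of "(b, y) # ws"] show ?thesis
        using ws a b y tw_closed[OF ws(1)] by (simp add: A.m_assoc)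
    qed
    then show "bracket L x y \<in> Z (a \<otimes>\<^bsub>A\<^esub> b)"
      using bracket_component[OF a b _ y] x by (auto simp: Z_def)
  qed
  moreover have "selective j Z"
    unfolding selective_def
  proof (intro ballI allI impI, elim conjE)
    fix d u ws assume d: "d \<in> carrier A" "u \<in> G d" "hword ws" "length ws = j" "indep (d # map fst ws)"
    show "com u ws \<in> Z (d \<otimes>\<^bsub>A\<^esub> tw ws)"
      using com_component[OF d(1-3)] independent_commutator_nilpotent[OF Suc.prems d]
      by (auto simp: Z_def m_def)
  qed
  ultimately have "lands (nilpotency_bound (card H) k j) G Z" using Suc.IH by blast
  moreover have "lands m Z X" by (auto simp: lands_def Z_def)
  ultimately show ?case unfolding nilpotency_bound.simps m_def[symmetric] by (rule lands_trans)
qed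

end

section \<open>Groups of double automorphisms\<close>

locale double_automorphism_setting = graded_lie_algebra R L A G
  for R :: "('r, 'm) ring_scheme" (structure)
    and L :: "('r, 'l, 'n) lie_algebra_scheme" (structure)
    and A :: "('a, 'p) monoid_scheme" (structure)
    and G :: "'a \<Rightarrow> 'l set" +
  fixes H :: "('l \<Rightarrow> 'l) set" and act :: "('l \<Rightarrow> 'l) \<Rightarrow> 'a \<Rightarrow> 'a" and q k c :: nat
  assumes hyps: "double_automorphism_hyps q k c R L A G H act"
begin

abbreviation e :: "'l \<Rightarrow> 'l" where
  "e \<equiv> \<lambda>x\<in>carrier L. x"

lemma group_hyps:
  "subgroup H (BijGroup (carrier L))"
  "act \<in> hom (BijGroup (carrier L)\<lparr>carrier := H\<rparr>) (AutoGroup A)"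
  "h \<in> H \<Longrightarrow> double_automorphism R L A G h (act h)"
  using hyps by (auto simp: double_automorphism_hyps_def double_automorphism_group_def)

lemma finite_H: "finite H" and card_H: "card H = q" and torsion_free: "torsion_free A"
  using hyps by (auto simp: double_automorphism_hyps_def)

lemma e_in: "e \<in> H"
  using subgroup.one_closed[OF group_hyps(1)] by (simp add: BijGroup_def)

lemma H_Bij: "h \<in> H \<Longrightarrow> h \<in> Bij (carrier L)"
  using subgroup.subset[OF group_hyps(1)] by (auto simp: BijGroup_def)

lemma act_auto: "h \<in> H \<Longrightarrow> act h \<in> auto A"
  using group_hyps(3) by (simp add: double_automorphism_def)

lemma act_Bij: "h \<in> H \<Longrightarrow> act h \<in> Bij (carrier A)"
  using act_auto by (simp add: auto_def)

lemma act_closed: "h \<in> H \<Longrightarrow> a \<in> carrier A \<Longrightarrow> act h a \<in> carrier A"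
  using Bij_imp_funcset[OF act_Bij] by blast

lemma act_mult:
  "h \<in> H \<Longrightarrow> a \<in> carrier A \<Longrightarrow> b \<in> carrier A \<Longrightarrow> act h (a \<otimes>\<^bsub>A\<^esub> b) = act h a \<otimes>\<^bsub>A\<^esub> act h b"
  using act_auto by (auto simp: auto_def hom_def)

lemma H_closed: "h \<in> H \<Longrightarrow> x \<in> carrier L \<Longrightarrow> h x \<in> carrier L"
  using Bij_imp_funcset[OF H_Bij] by blast

lemma H_lie_auto: "h \<in> H \<Longrightarrow> h \<in> lie_auto R L"
  using group_hyps(3) by (simp add: double_automorphism_def)

lemma H_add: "\<lbrakk>h \<in> H; x \<in> carrier L; y \<in> carrier L\<rbrakk> \<Longrightarrow> h (x \<oplus>\<^bsub>L\<^esub> y) = h x \<oplus>\<^bsub>L\<^esub> h y"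
  and H_bracket: "\<lbrakk>h \<in> H; x \<in> carrier L; y \<in> carrier L\<rbrakk> \<Longrightarrow> h (bracket L x y) = bracket L (h x) (h y)"
  using H_lie_auto by (auto simp: lie_auto_def)

lemma H_component: "h \<in> H \<Longrightarrow> a \<in> carrier A \<Longrightarrow> h ` G a = G (act h a)"
  using group_hyps(3) by (simp add: double_automorphism_def)

lemma H_comp:
  assumes "g \<in> H" "h \<in> H"
  shows "compose (carrier L) g h \<in> H"
    and "act (compose (carrier L) g h) = compose (carrier A) (act g) (act h)"
proof -
  have gh: "g \<otimes>\<^bsub>BijGroup (carrier L)\<^esub> h = compose (carrier L) g h"
    using assms H_Bij by (simp add: BijGroup_def)
  show "compose (carrier L) g h \<in> H"
    using subgroup.m_closed[OF group_hyps(1) assms] gh by simp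
  have "act (g \<otimes>\<^bsub>BijGroup (carrier L)\<^esub> h) = act g \<otimes>\<^bsub>AutoGroup A\<^esub> act h"
    using hom_mult[OF group_hyps(2), of g h] assms by simp
  then show "act (compose (carrier L) g h) = compose (carrier A) (act g) (act h)"
    using gh assms act_Bij by (simp add: AutoGroup_def BijGroup_def)
qed

lemma act_e: "a \<in> carrier A \<Longrightarrow> act e a = a"
proof -
  assume a: "a \<in> carrier A"
  have "compose (carrier L) e e = e" by (rule extensionalityI[of _ "carrier L"]) (auto simp: compose_def)
  then have "act e = compose (carrier A) (act e) (act e)" using H_comp(2)[OF e_in e_in] by simp
  then have "act e a = act e (act e a)" using a by (metis compose_eq)
  then show ?thesis
    using act_Bij[OF e_in] a act_closed[OF e_in a] by (auto simp: Bij_def bij_betw_def dest: inj_onD)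
qed

lemma H_inverse:
  assumes h: "h \<in> H"
  obtains g where "g \<in> H" "\<And>x. x \<in> carrier L \<Longrightarrow> h (g x) = x" "\<And>x. x \<in> carrier L \<Longrightarrow> g (h x) = x"
    "\<And>a. a \<in> carrier A \<Longrightarrow> act h (act g a) = a" "\<And>a. a \<in> carrier A \<Longrightarrow> act g (act h a) = a"
proof -
  interpret B: group "BijGroup (carrier L)" by (rule group_BijGroup)
  define g where "g = inv\<^bsub>BijGroup (carrier L)\<^esub> h"
  have g: "g \<in> H" using subgroup.m_inv_closed[OF group_hyps(1) h] by (simp add: g_def)
  have hc: "h \<in> carrier (BijGroup (carrier L))" using H_Bij[OF h] by (simp add: BijGroup_def)
  have "h \<otimes>\<^bsub>BijGroup (carrier L)\<^esub> g = \<one>\<^bsub>BijGroup (carrier L)\<^esub>"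
    "g \<otimes>\<^bsub>BijGroup (carrier L)\<^esub> h = \<one>\<^bsub>BijGroup (carrier L)\<^esub>"
    using hc by (simp_all add: g_def)
  then have c: "compose (carrier L) h g = e" "compose (carrier L) g h = e"
    using H_Bij[OF h] H_Bij[OF g] by (simp_all add: BijGroup_def)
  show thesis
  proof
    show "g \<in> H" by (rule g)
    show "h (g x) = x" if "x \<in> carrier L" for x using fun_cong[OF c(1), of x] that by (simp add: compose_def)
    show "g (h x) = x" if "x \<in> carrier L" for x using fun_cong[OF c(2), of x] that by (simp add: compose_def)
    show "act h (act g a) = a" if "a \<in> carrier A" for a
      using H_comp(2)[OF h g] c(1) act_e[OF that] that by (metis compose_eq)
    show "act g (act h a) = a" if "a \<in> carrier A" for a
      using H_comp(2)[OF g h] c(2) act_e[OF that] that by (metis compose_eq)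
  qed
qed

lemma H_fixed_point_free:
  assumes "h \<in> H" "h \<noteq> e" "a \<in> carrier A" "act h a = a"
  shows "a = \<one>\<^bsub>A\<^esub>"
proof -
  have "{a \<in> carrier A. act h a = a} = {\<one>\<^bsub>A\<^esub>}"
    using hyps assms(1,2) by (simp add: double_automorphism_hyps_def fixed_point_free_def BijGroup_def)
  then show ?thesis using assms(3,4) by blast
qed

lemma fixed_nilpotent:
  "\<lbrakk>x \<in> fixed_subalgebra L H; set ys \<subseteq> fixed_subalgebra L H; length ys = c\<rbrakk>
    \<Longrightarrow> foldl (bracket L) x ys = \<zero>\<^bsub>L\<^esub>"
  using hyps commutator_span_eq_zero_iff
  unfolding double_automorphism_hyps_def nilpotent_of_class_def by blast

lemma zero_component_nilpotent:
  "\<lbrakk>x \<in> carrier L; set ys \<subseteq> G \<one>\<^bsub>A\<^esub>; length ys = k\<rbrakk> \<Longrightarrow> foldl (bracket L) x ys = \<zero>\<^bsub>L\<^esub>"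
  using hyps commutator_span_eq_zero_iff
  unfolding double_automorphism_hyps_def ad_nilpotent_def by blast

sublocale graded_fpf_action_nil R L A G H e act k
proof unfold_locales
  show "torsion_free A" "finite H" "e \<in> H" by (fact torsion_free finite_H e_in)+
  show "act e a = a" if "a \<in> carrier A" for a using act_e that .
  show "act h \<in> hom A A" "inj_on (act h) (carrier A)" if "h \<in> H" for h
    using act_auto[OF that] by (auto simp: auto_def Bij_def bij_betw_def)
  show "\<exists>f\<in>H. \<forall>a\<in>carrier A. act g (act h a) = act f a" if "g \<in> H" "h \<in> H" for g h
    using H_comp[OF that] by (intro bexI[of _ "compose (carrier L) g h"]) (auto simp: compose_def)
  show "a = \<one>\<^bsub>A\<^esub>" if "h \<in> H" "h \<noteq> e" "a \<in> carrier A" "act h a = a" for h a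
    using H_fixed_point_free that .
  fix a y ws
  assume a: "a \<in> carrier A" "y \<in> G a" and ws: "hword ws" "set (map fst ws) \<subseteq> {\<one>\<^bsub>A\<^esub>}" "length ws = k"
  have "set (map snd ws) \<subseteq> G \<one>\<^bsub>A\<^esub>" using ws(1,2) by (fastforce simp: hword_def)
  then show "com y ws = \<zero>\<^bsub>L\<^esub>"
    unfolding com_def using ws(3) G_carrier[OF a] by (intro zero_component_nilpotent) auto
qed

lemma H_left_mult_inj:
  assumes g: "g \<in> H"
  shows "inj_on (compose (carrier L) g) H"
proof (rule inj_onI)
  fix h h' assume h: "h \<in> H" "h' \<in> H" "compose (carrier L) g h = compose (carrier L) g h'"
  obtain f where f: "\<And>x. x \<in> carrier L \<Longrightarrow> f (g x) = x" using H_inverse[OF g] by metis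
  show "h = h'"
  proof (rule extensionalityI)
    show "h \<in> extensional (carrier L)" "h' \<in> extensional (carrier L)"
      using h H_Bij Bij_imp_extensional by blast+
    fix y assume y: "y \<in> carrier L"
    then have "g (h y) = g (h' y)" using fun_cong[OF h(3), of y] by (simp add: compose_eq)
    then show "h y = h' y" using f H_closed h y by metis
  qed
qed

lemma orbit_sum_fixed:
  assumes x: "x \<in> carrier L"
  shows "(\<Oplus>\<^bsub>L\<^esub>h\<in>H. h x) \<in> fixed_subalgebra L H"
proof -
  have xc: "(\<lambda>h. h x) \<in> H \<rightarrow> carrier L" using H_closed x by blast
  have "g (\<Oplus>\<^bsub>L\<^esub>h\<in>H. h x) = (\<Oplus>\<^bsub>L\<^esub>h\<in>H. h x)" if g: "g \<in> H" for g
  proof -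
    have g0: "g \<zero>\<^bsub>L\<^esub> = \<zero>\<^bsub>L\<^esub>"
      using H_add[OF g, of "\<zero>\<^bsub>L\<^esub>" "\<zero>\<^bsub>L\<^esub>"] H_closed[OF g, of "\<zero>\<^bsub>L\<^esub>"] by (simp add: M.add.l_cancel_one')
    have "g (finsum L f F) = (\<Oplus>\<^bsub>L\<^esub>h\<in>F. g (f h))" if "finite F" "f \<in> F \<rightarrow> carrier L" for F and f :: "('l \<Rightarrow> 'l) \<Rightarrow> 'l"
      using that
    proof (induction F rule: finite_induct)
      case (insert i F)
      then have f: "f \<in> F \<rightarrow> carrier L" "f i \<in> carrier L" by auto
      then have "(\<lambda>h. g (f h)) \<in> F \<rightarrow> carrier L" "g (f i) \<in> carrier L" using H_closed[OF g] by auto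
      then show ?case using insert f H_add[OF g] by (simp add: M.finsum_insert)
    qed (simp add: g0)
    then have "g (\<Oplus>\<^bsub>L\<^esub>h\<in>H. h x) = (\<Oplus>\<^bsub>L\<^esub>h\<in>H. g (h x))" using finite_H xc by simp
    also have "\<dots> = (\<Oplus>\<^bsub>L\<^esub>h\<in>H. (compose (carrier L) g h) x)"
      using x by (simp add: compose_eq)
    also have "\<dots> = (\<Oplus>\<^bsub>L\<^esub>h\<in>compose (carrier L) g ` H. h x)"
    proof (rule M.finsum_reindex[symmetric])
      show "(\<lambda>h. h x) \<in> compose (carrier L) g ` H \<rightarrow> carrier L" using H_comp(1)[OF g] H_closed x by blast
      show "inj_on (compose (carrier L) g) H" by (rule H_left_mult_inj[OF g])
    qed
    also have "compose (carrier L) g ` H = H"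
    proof (rule card_subset_eq[OF finite_H])
      show "compose (carrier L) g ` H \<subseteq> H" using H_comp(1)[OF g] by blast
      have "inj_on (compose (carrier L) g) H" by (rule H_left_mult_inj[OF g])
      then show "card (compose (carrier L) g ` H) = card H" by (rule card_image)
    qed
    finally show ?thesis .
  qed
  then show ?thesis using xc by (auto simp: fixed_subalgebra_def)
qed

theorem nilpotent_of_class_nilpotency_bound:
  "nilpotent_of_class R L (carrier L) (nilpotency_bound q k c)"
proof -
  have "selective c (\<lambda>_. {\<zero>\<^bsub>L\<^esub>})"
  proof (rule selective_if_orbit_sums_nilpotent[where lact = "\<lambda>h x. h x"])
    show "h x \<in> G (act h a)" if "h \<in> H" "a \<in> carrier A" "x \<in> G a" for h a x
      using H_component[OF that(1,2)] that(3) by blast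
    fix x ys assume "x \<in> carrier L" "set ys \<subseteq> carrier L" "length ys = c"
    then show "foldl (bracket L) (\<Oplus>\<^bsub>L\<^esub>h\<in>H. h x) (map (\<lambda>x. \<Oplus>\<^bsub>L\<^esub>h\<in>H. h x) ys) = \<zero>\<^bsub>L\<^esub>"
      using orbit_sum_fixed by (intro fixed_nilpotent) auto
  qed simp
  from selective_nilpotent[OF this hideal_trivial]
  have "lands (nilpotency_bound q k c) G (\<lambda>_. {\<zero>\<^bsub>L\<^esub>})" by (simp add: card_H)
  then have "com y ws = \<zero>\<^bsub>L\<^esub>"
    if "a \<in> carrier A" "y \<in> G a" "hword ws" "length ws = nilpotency_bound q k c" for a y ws
    using landsD that by blast
  then show ?thesis
    unfolding nilpotent_of_class_def commutator_span_eq_zero_iff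
    using nilpotent_if_homogeneous by blast
qed

end

section \<open>Countable substructures\<close>

lemma countable_closure:
  assumes B: "countable B" "B \<subseteq> V"
    and op: "\<And>x y. x \<in> V \<Longrightarrow> y \<in> V \<Longrightarrow> countable (op x y) \<and> op x y \<subseteq> V"
  obtains C where "countable C" "B \<subseteq> C" "C \<subseteq> V" "\<And>x y. \<lbrakk>x \<in> C; y \<in> C\<rbrakk> \<Longrightarrow> op x y \<subseteq> C"
proof -
  define C where "C = rec_nat B (\<lambda>_ S. S \<union> (\<Union>x\<in>S. \<Union>y\<in>S. op x y))"
  have C0: "C 0 = B" and CS: "C (Suc n) = C n \<union> (\<Union>x\<in>C n. \<Union>y\<in>C n. op x y)" for n
    by (simp_all add: C_def)
  have sub: "C n \<subseteq> V" for n
  proof (induction n)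
    case (Suc n)
    then have "op x y \<subseteq> V" if "x \<in> C n" "y \<in> C n" for x y using op that by blast
    then show ?case unfolding CS using Suc by blast
  qed (simp add: C0 B)
  have cnt: "countable (C n)" for n
  proof (induction n)
    case (Suc n)
    have "countable (op x y)" if "x \<in> C n" "y \<in> C n" for x y using op sub that by blast
    then show ?case unfolding CS using Suc by (intro countable_Un countable_UN) auto
  qed (simp add: C0 B)
  have mono: "C m \<subseteq> C n" if "m \<le> n" for m n
    using that by (rule lift_Suc_mono_le[rotated]) (simp add: CS)
  have closed: "op x y \<subseteq> (\<Union>n. C n)" if xy: "x \<in> (\<Union>n. C n)" "y \<in> (\<Union>n. C n)" for x y
  proof -
    obtain i j where "x \<in> C i" "y \<in> C j" using xy by blast
    then have "x \<in> C (max i j)" "y \<in> C (max i j)"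
      using mono[of i "max i j"] mono[of j "max i j"] by auto
    then have "op x y \<subseteq> C (Suc (max i j))" unfolding CS by blast
    then show ?thesis by blast
  qed
  show thesis
  proof (rule that[OF _ _ _ closed])
    show "countable (\<Union>n. C n)" using cnt by (intro countable_UN) auto
    show "B \<subseteq> (\<Union>n. C n)" using C0 by blast
    show "(\<Union>n. C n) \<subseteq> V" using sub by blast
  qed
qed

locale double_automorphism_restriction = double_automorphism_setting R L A G H act q k c
  for R :: "('r, 'm) ring_scheme" (structure)
    and L :: "('r, 'l, 'n) lie_algebra_scheme" (structure)
    and A :: "('a, 'p) monoid_scheme" (structure)
    and G :: "'a \<Rightarrow> 'l set"
    and H :: "('l \<Rightarrow> 'l) set" and act :: "('l \<Rightarrow> 'l) \<Rightarrow> 'a \<Rightarrow> 'a" and q k c :: nat +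
  fixes L0 :: "'l set" and A0 :: "'a set" and eL :: "'l \<Rightarrow> nat" and eA :: "'a \<Rightarrow> nat"
  assumes L0_carrier: "L0 \<subseteq> carrier L"
    and L0_zero: "\<zero>\<^bsub>L\<^esub> \<in> L0"
    and L0_add: "\<lbrakk>x \<in> L0; y \<in> L0\<rbrakk> \<Longrightarrow> x \<oplus>\<^bsub>L\<^esub> y \<in> L0"
    and L0_minus: "x \<in> L0 \<Longrightarrow> \<ominus>\<^bsub>L\<^esub> x \<in> L0"
    and L0_bracket: "\<lbrakk>x \<in> L0; y \<in> L0\<rbrakk> \<Longrightarrow> bracket L x y \<in> L0"
    and L0_H: "\<lbrakk>h \<in> H; x \<in> L0\<rbrakk> \<Longrightarrow> h x \<in> L0"
    and L0_proj: "\<lbrakk>a \<in> carrier A; x \<in> L0\<rbrakk> \<Longrightarrow> proj a x \<in> L0"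
    and A0_carrier: "A0 \<subseteq> carrier A"
    and A0_one: "\<one>\<^bsub>A\<^esub> \<in> A0"
    and A0_mult: "\<lbrakk>a \<in> A0; b \<in> A0\<rbrakk> \<Longrightarrow> a \<otimes>\<^bsub>A\<^esub> b \<in> A0"
    and A0_inv: "a \<in> A0 \<Longrightarrow> inv\<^bsub>A\<^esub> a \<in> A0"
    and A0_act: "\<lbrakk>h \<in> H; a \<in> A0\<rbrakk> \<Longrightarrow> act h a \<in> A0"
    and A0_support: "\<lbrakk>a \<in> carrier A; x \<in> L0; proj a x \<noteq> \<zero>\<^bsub>L\<^esub>\<rbrakk> \<Longrightarrow> a \<in> A0"
    and eL_inj: "inj_on eL L0"
    and eA_inj: "inj_on eA A0"
    and faithful: "\<lbrakk>g \<in> H; h \<in> H; g \<noteq> h\<rbrakk> \<Longrightarrow> \<exists>x\<in>L0. g x \<noteq> h x"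
begin

definition cL :: "nat set" where "cL = eL ` L0"
definition cA :: "nat set" where "cA = eA ` A0"
definition dL :: "nat \<Rightarrow> 'l" where "dL = the_inv_into L0 eL"
definition dA :: "nat \<Rightarrow> 'a" where "dA = the_inv_into A0 eA"

text \<open>The subring \<open>L0\<close> is copied to the natural numbers along \<open>eL\<close>, and \<open>dL\<close> is the decoding. Since \<open>R\<close> may
  be uncountable, \<open>L0\<close> cannot be kept closed under its scalars, and the integers take its place.\<close>

definition L' :: "(int, nat) lie_algebra" where
  "L' = \<lparr>carrier = cL, monoid.mult = (\<lambda>x y. x), one = 0, zero = eL \<zero>\<^bsub>L\<^esub>,
     add = (\<lambda>x y. eL (dL x \<oplus>\<^bsub>L\<^esub> dL y)), smult = (\<lambda>n x. eL (add_pow L n (dL x))),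
     bracket = (\<lambda>x y. eL (bracket L (dL x) (dL y)))\<rparr>"

definition A' :: "nat monoid" where
  "A' = \<lparr>carrier = cA, monoid.mult = (\<lambda>a b. eA (dA a \<otimes>\<^bsub>A\<^esub> dA b)), one = eA \<one>\<^bsub>A\<^esub>\<rparr>"

definition G' :: "nat \<Rightarrow> nat set" where
  "G' a = {x \<in> cL. dL x \<in> G (dA a)}"

definition tr :: "('l \<Rightarrow> 'l) \<Rightarrow> nat \<Rightarrow> nat" where
  "tr h = (\<lambda>x\<in>cL. eL (h (dL x)))"

definition trA :: "('l \<Rightarrow> 'l) \<Rightarrow> nat \<Rightarrow> nat" where
  "trA h = (\<lambda>a\<in>cA. eA (act h (dA a)))"

definition H' :: "(nat \<Rightarrow> nat) set" where "H' = tr ` H"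

definition act' :: "(nat \<Rightarrow> nat) \<Rightarrow> nat \<Rightarrow> nat" where
  "act' h' = trA (the_inv_into H tr h')"

lemma eL_in [simp]: "y \<in> L0 \<Longrightarrow> eL y \<in> cL"
  and eA_in [simp]: "b \<in> A0 \<Longrightarrow> eA b \<in> cA"
  by (auto simp: cL_def cA_def)

lemma dL_in [simp]: "x \<in> cL \<Longrightarrow> dL x \<in> L0"
  and eL_dL [simp]: "x \<in> cL \<Longrightarrow> eL (dL x) = x"
  and dL_eL [simp]: "y \<in> L0 \<Longrightarrow> dL (eL y) = y"
  using eL_inj by (auto simp: cL_def dL_def the_inv_into_f_f)

lemma dA_in [simp]: "a \<in> cA \<Longrightarrow> dA a \<in> A0"
  and eA_dA [simp]: "a \<in> cA \<Longrightarrow> eA (dA a) = a"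
  and dA_eA [simp]: "b \<in> A0 \<Longrightarrow> dA (eA b) = b"
  using eA_inj by (auto simp: cA_def dA_def the_inv_into_f_f)

lemma dL_carrier [simp]: "x \<in> cL \<Longrightarrow> dL x \<in> carrier L"
  using L0_carrier dL_in by blast

lemma dA_carrier [simp]: "a \<in> cA \<Longrightarrow> dA a \<in> carrier A"
  using A0_carrier dA_in by blast

lemma dL_eqI: "\<lbrakk>x \<in> cL; y \<in> cL; dL x = dL y\<rbrakk> \<Longrightarrow> x = y"
  by (metis eL_dL)

lemma dA_eqI: "\<lbrakk>a \<in> cA; b \<in> cA; dA a = dA b\<rbrakk> \<Longrightarrow> a = b"
  by (metis eA_dA)

lemma carrier_L' [simp]: "carrier L' = cL"
  and zero_L': "\<zero>\<^bsub>L'\<^esub> = eL \<zero>\<^bsub>L\<^esub>"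
  and add_L': "x \<oplus>\<^bsub>L'\<^esub> y = eL (dL x \<oplus>\<^bsub>L\<^esub> dL y)"
  and smult_L': "n \<odot>\<^bsub>L'\<^esub> x = eL (add_pow L n (dL x))"
  and bracket_L': "bracket L' x y = eL (bracket L (dL x) (dL y))"
  by (simp_all add: L'_def)

lemma carrier_A' [simp]: "carrier A' = cA"
  and one_A': "\<one>\<^bsub>A'\<^esub> = eA \<one>\<^bsub>A\<^esub>"
  and mult_A': "a \<otimes>\<^bsub>A'\<^esub> b = eA (dA a \<otimes>\<^bsub>A\<^esub> dA b)"
  by (simp_all add: A'_def)

lemma L0_subgroup: "subgroup L0 (add_monoid L)"
  using L0_carrier L0_zero L0_add L0_minus by (rule add_subgroupI)

lemma add_pow_closed_subgroup:
  "\<lbrakk>subgroup T (add_monoid L); x \<in> T\<rbrakk> \<Longrightarrow> add_pow L (n::int) x \<in> T"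
  using group.subgroup_int_pow_closed[OF M.a_group] by (simp add: add_pow_def)

lemma closed_L' [simp]:
  "\<zero>\<^bsub>L'\<^esub> \<in> cL"
  "\<lbrakk>x \<in> cL; y \<in> cL\<rbrakk> \<Longrightarrow> x \<oplus>\<^bsub>L'\<^esub> y \<in> cL"
  "x \<in> cL \<Longrightarrow> n \<odot>\<^bsub>L'\<^esub> x \<in> cL"
  "\<lbrakk>x \<in> cL; y \<in> cL\<rbrakk> \<Longrightarrow> bracket L' x y \<in> cL"
  using L0_zero L0_add L0_bracket add_pow_closed_subgroup[OF L0_subgroup]
  by (auto simp: zero_L' add_L' smult_L' bracket_L')

lemma dL_simps [simp]:
  "dL \<zero>\<^bsub>L'\<^esub> = \<zero>\<^bsub>L\<^esub>"
  "\<lbrakk>x \<in> cL; y \<in> cL\<rbrakk> \<Longrightarrow> dL (x \<oplus>\<^bsub>L'\<^esub> y) = dL x \<oplus>\<^bsub>L\<^esub> dL y"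
  "x \<in> cL \<Longrightarrow> dL (n \<odot>\<^bsub>L'\<^esub> x) = add_pow L n (dL x)"
  "\<lbrakk>x \<in> cL; y \<in> cL\<rbrakk> \<Longrightarrow> dL (bracket L' x y) = bracket L (dL x) (dL y)"
  using L0_zero L0_add L0_bracket add_pow_closed_subgroup[OF L0_subgroup] dL_in
  by (simp_all add: zero_L' add_L' smult_L' bracket_L')

lemma A'_simps [simp]:
  "\<one>\<^bsub>A'\<^esub> \<in> cA" "\<lbrakk>a \<in> cA; b \<in> cA\<rbrakk> \<Longrightarrow> a \<otimes>\<^bsub>A'\<^esub> b \<in> cA"
  "dA \<one>\<^bsub>A'\<^esub> = \<one>\<^bsub>A\<^esub>" "\<lbrakk>a \<in> cA; b \<in> cA\<rbrakk> \<Longrightarrow> dA (a \<otimes>\<^bsub>A'\<^esub> b) = dA a \<otimes>\<^bsub>A\<^esub> dA b"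
  using A0_one A0_mult dA_in by (simp_all add: one_A' mult_A')

lemma abelian_group_L': "abelian_group L'"
proof (rule abelian_groupI, unfold carrier_L')
  fix x assume x: "x \<in> cL"
  then have "eL (\<ominus>\<^bsub>L\<^esub> dL x) \<in> cL" "dL (eL (\<ominus>\<^bsub>L\<^esub> dL x)) = \<ominus>\<^bsub>L\<^esub> dL x" using L0_minus by auto
  then show "\<exists>y\<in>cL. y \<oplus>\<^bsub>L'\<^esub> x = \<zero>\<^bsub>L'\<^esub>"
    using x by (intro bexI[of _ "eL (\<ominus>\<^bsub>L\<^esub> dL x)"] dL_eqI) (auto simp: M.l_neg)
qed (auto intro!: dL_eqI simp: M.a_ac)

lemma comm_group_A': "comm_group A'"
proof (rule comm_groupI, unfold carrier_A')
  fix x assume x: "x \<in> cA"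
  then have "eA (inv\<^bsub>A\<^esub> dA x) \<in> cA" "dA (eA (inv\<^bsub>A\<^esub> dA x)) = inv\<^bsub>A\<^esub> dA x" using A0_inv by auto
  then show "\<exists>y\<in>cA. y \<otimes>\<^bsub>A'\<^esub> x = \<one>\<^bsub>A'\<^esub>"
    using x by (intro bexI[of _ "eA (inv\<^bsub>A\<^esub> dA x)"] dA_eqI) auto
qed (auto intro!: dA_eqI simp: A.m_ac)

lemma add_pow_hom:
  assumes "f \<in> carrier L \<rightarrow> carrier L"
    and "\<And>x y. \<lbrakk>x \<in> carrier L; y \<in> carrier L\<rbrakk> \<Longrightarrow> f (x \<oplus>\<^bsub>L\<^esub> y) = f x \<oplus>\<^bsub>L\<^esub> f y"
    and "x \<in> carrier L"
  shows "f (add_pow L (n::int) x) = add_pow L n (f x)"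
proof -
  have "f \<in> hom (add_monoid L) (add_monoid L)" using assms(1,2) by (auto simp: hom_def)
  from hom_int_pow[OF this _ M.a_group M.a_group, of x n] show ?thesis
    using assms(3) by (simp add: add_pow_def)
qed

lemma module_L': "module int_ring L'"
proof (rule moduleI)
  show "cring int_ring" by (rule int_is_cring)
  show "abelian_group L'" by (rule abelian_group_L')
qed (auto intro!: dL_eqI simp: M.add.int_pow_mult M.add.int_pow_distrib M.add.int_pow_pow mult.commute)

lemma lie_algebra_L': "lie_algebra int_ring L'"
proof (intro lie_algebra.intro lie_algebra_axioms.intro module_L'; unfold carrier_L')
  fix n :: int and x y assume x: "x \<in> cL" and y: "y \<in> cL"
  have "(\<lambda>z. bracket L z (dL y)) \<in> carrier L \<rightarrow> carrier L" using y bracket_closed by auto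
  from add_pow_hom[OF this, of "dL x" n] show "bracket L' (n \<odot>\<^bsub>L'\<^esub> x) y = n \<odot>\<^bsub>L'\<^esub> bracket L' x y"
    using x y bracket_add_left by (intro dL_eqI) auto
  have "bracket L (dL x) \<in> carrier L \<rightarrow> carrier L" using x bracket_closed by auto
  from add_pow_hom[OF this, of "dL y" n] show "bracket L' x (n \<odot>\<^bsub>L'\<^esub> y) = n \<odot>\<^bsub>L'\<^esub> bracket L' x y"
    using x y bracket_add_right by (intro dL_eqI) auto
qed (auto intro!: dL_eqI simp: bracket_add_left bracket_add_right bracket_self jacobi)

lemma dL_finsum:
  assumes "finite F" "u \<in> F \<rightarrow> cL"
  shows "finsum L' u F \<in> cL" "dL (finsum L' u F) = (\<Oplus>\<^bsub>L\<^esub>i\<in>F. dL (u i))"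
proof -
  interpret L': abelian_group L' by (rule abelian_group_L')
  have "finsum L' u F \<in> cL \<and> dL (finsum L' u F) = (\<Oplus>\<^bsub>L\<^esub>i\<in>F. dL (u i))"
    using assms
  proof (induction F rule: finite_induct)
    case (insert i F)
    then have "u \<in> F \<rightarrow> cL" "u i \<in> cL" by auto
    moreover from this have "(\<lambda>i. dL (u i)) \<in> F \<rightarrow> carrier L" using dL_carrier by blast
    ultimately show ?case using insert by (simp add: M.finsum_insert L'.finsum_insert)
  qed simp
  then show "finsum L' u F \<in> cL" "dL (finsum L' u F) = (\<Oplus>\<^bsub>L\<^esub>i\<in>F. dL (u i))" by auto
qed

lemma G'_submodule:
  assumes a: "a \<in> cA"
  shows "submodule (G' a) int_ring L'"
proof -
  interpret L': module int_ring L' by (rule module_L')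
  have Ga: "subgroup (G (dA a)) (add_monoid L)" using G_subgroup a by simp
  have minus: "\<ominus>\<^bsub>L'\<^esub> x = (-1::int) \<odot>\<^bsub>L'\<^esub> x" if "x \<in> cL" for x
    using L'.smult_l_minus[of 1 x] that int_is_cring
    by (metis L'.smult_one UNIV_I carrier_L' L'.R.add.inv_equality add.left_neutral add.right_inverse
        int_Zcarr add.commute ring.simps(1) ring.simps(2) monoid.simps(2))
  show ?thesis
    using add_subgroupD[OF Ga] add_pow_closed_subgroup[OF Ga] minus
    by (intro L'.submoduleI) (auto simp: G'_def)
qed

lemma G'_direct_sum:
  assumes x: "x \<in> cL"
  shows "\<exists>!u. u \<in> (\<Pi>\<^sub>E a\<in>carrier A'. G' a) \<and> finite {a \<in> carrier A'. u a \<noteq> \<zero>\<^bsub>L'\<^esub>}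
         \<and> x = (\<Oplus>\<^bsub>L'\<^esub>a\<in>{a \<in> carrier A'. u a \<noteq> \<zero>\<^bsub>L'\<^esub>}. u a)"
proof
  let ?y = "dL x"
  define u where "u = (\<lambda>a\<in>cA. eL (proj (dA a) ?y))"
  let ?S = "{a \<in> carrier A'. u a \<noteq> \<zero>\<^bsub>L'\<^esub>}"
  let ?T = "{b \<in> carrier A. proj b ?y \<noteq> \<zero>\<^bsub>L\<^esub>}"
  have y: "?y \<in> L0" "?y \<in> carrier L" using x by auto
  note dec = homogeneous_decomposition[OF y(2)]
  have TA: "?T \<subseteq> A0" using A0_support y by blast
  have du: "u a \<in> cL" "dL (u a) = proj (dA a) ?y" if "a \<in> cA" for a
    using that L0_proj[OF _ y(1)] by (simp_all add: u_def)
  have uG: "u \<in> (\<Pi>\<^sub>E a\<in>carrier A'. G' a)"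
    using du dec(1) by (auto simp: G'_def u_def)
  have ST: "?S = eA ` ?T"
  proof
    show "?S \<subseteq> eA ` ?T"
    proof
      fix a assume "a \<in> ?S"
      then have a: "a \<in> cA" "u a \<noteq> \<zero>\<^bsub>L'\<^esub>" by auto
      then have "proj (dA a) ?y \<noteq> \<zero>\<^bsub>L\<^esub>" using du[OF a(1)] dL_eqI[of "u a" "\<zero>\<^bsub>L'\<^esub>"] by auto
      then show "a \<in> eA ` ?T" using a(1) by (intro image_eqI[of _ _ "dA a"]) auto
    qed
    show "eA ` ?T \<subseteq> ?S"
    proof
      fix a assume "a \<in> eA ` ?T"
      then obtain b where b: "b \<in> ?T" "a = eA b" by blast
      then have "b \<in> A0" using TA by blast
      then show "a \<in> ?S" using b du[of a] by auto
    qed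
  qed
  have fS: "finite ?S" unfolding ST using dec(2) by simp
  have "?y = (\<Oplus>\<^bsub>L\<^esub>b\<in>?T. proj b ?y)" by (rule dec(3))
  also have "\<dots> = (\<Oplus>\<^bsub>L\<^esub>b\<in>?T. dL (u (eA b)))"
    using TA du dec(1) G_carrier by (intro M.finsum_cong') auto
  also have "\<dots> = (\<Oplus>\<^bsub>L\<^esub>a\<in>?S. dL (u a))"
    unfolding ST
  proof (rule M.finsum_reindex[symmetric])
    have "eA b \<in> cA" if "b \<in> ?T" for b using TA that eA_in by blast
    then show "(\<lambda>a. dL (u a)) \<in> eA ` ?T \<rightarrow> carrier L" using du(1) by fastforce
    show "inj_on eA ?T" by (rule inj_on_subset[OF eA_inj TA])
  qed
  also have "\<dots> = dL (finsum L' u ?S)" using fS du by (intro dL_finsum(2)[symmetric]) auto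
  finally have "x = finsum L' u ?S" using x dL_finsum(1)[OF fS, of u] du by (intro dL_eqI) auto
  then show "u \<in> (\<Pi>\<^sub>E a\<in>carrier A'. G' a) \<and> finite ?S \<and> x = (\<Oplus>\<^bsub>L'\<^esub>a\<in>?S. u a)" using uG fS by blast
  fix v
  let ?V = "{a \<in> carrier A'. v a \<noteq> \<zero>\<^bsub>L'\<^esub>}"
  assume "v \<in> (\<Pi>\<^sub>E a\<in>carrier A'. G' a) \<and> finite ?V \<and> x = (\<Oplus>\<^bsub>L'\<^esub>a\<in>?V. v a)"
  then have v: "v \<in> (\<Pi>\<^sub>E a\<in>carrier A'. G' a)" "finite ?V" "x = (\<Oplus>\<^bsub>L'\<^esub>a\<in>?V. v a)" by auto
  have vG: "v a \<in> cL" "dL (v a) \<in> G (dA a)" if "a \<in> cA" for a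
    using v(1) that by (auto simp: G'_def PiE_iff)
  have dV: "inj_on dA ?V" "dA ` ?V \<subseteq> carrier A" using dA_eqI by (auto intro!: inj_onI)
  have "?y = (\<Oplus>\<^bsub>L\<^esub>a\<in>?V. dL (v a))" using v(2,3) vG dL_finsum(2)[of ?V v] by auto
  also have "\<dots> = (\<Oplus>\<^bsub>L\<^esub>a\<in>?V. dL (v (eA (dA a))))"
    using vG by (intro M.finsum_cong') auto
  also have "\<dots> = (\<Oplus>\<^bsub>L\<^esub>b\<in>dA ` ?V. dL (v (eA b)))"
    using vG dV by (intro M.finsum_reindex[symmetric]) auto
  finally have yV: "?y = (\<Oplus>\<^bsub>L\<^esub>b\<in>dA ` ?V. dL (v (eA b)))" .
  have pr: "proj b ?y = (if b \<in> dA ` ?V then dL (v (eA b)) else \<zero>\<^bsub>L\<^esub>)" if "b \<in> carrier A" for b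
    by (subst yV, rule proj_finsum) (use v(2) dV vG that in auto)
  show "v = u"
  proof
    fix a show "v a = u a"
    proof (cases "a \<in> cA")
      case False
      then show ?thesis using v(1) by (auto simp: u_def PiE_iff extensional_def)
    next
      case True
      have "dA a \<in> dA ` ?V \<longleftrightarrow> a \<in> ?V" using dA_eqI True by auto
      then have "proj (dA a) ?y = dL (v a)" using pr[of "dA a"] True by auto
      then show ?thesis using du[OF True] vG(1)[OF True] by (intro dL_eqI) auto
    qed
  qed
qed

lemma graded_lie_algebra_L': "graded_lie_algebra int_ring L' A' G'"
proof (intro graded_lie_algebra.intro graded_lie_algebra_axioms.intro)
  show "lie_algebra int_ring L'" by (rule lie_algebra_L')
  show "comm_group A'" by (rule comm_group_A')
  show "submodule (G' a) int_ring L'" if "a \<in> carrier A'" for a using G'_submodule that by simp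
  show "bracket L' x y \<in> G' (a \<otimes>\<^bsub>A'\<^esub> b)"
    if "a \<in> carrier A'" "b \<in> carrier A'" "x \<in> G' a" "y \<in> G' b" for a b x y
    using that bracket_component by (auto simp: G'_def)
qed (use G'_direct_sum in simp)

lemma torsion_free_A': "Defs.torsion_free A'"
proof -
  interpret A': comm_group A' by (rule comm_group_A')
  have pow: "a [^]\<^bsub>A'\<^esub> n \<in> cA \<and> dA (a [^]\<^bsub>A'\<^esub> n) = dA a [^]\<^bsub>A\<^esub> n" if "a \<in> cA" for a and n :: nat
    using that by (induction n) auto
  show ?thesis
    unfolding torsion_free_def
  proof (intro ballI allI impI, elim conjE)
    fix a and n :: nat assume a: "a \<in> carrier A'" "0 < n" "a [^]\<^bsub>A'\<^esub> n = \<one>\<^bsub>A'\<^esub>"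
    then have "dA a [^]\<^bsub>A\<^esub> n = \<one>\<^bsub>A\<^esub>" using pow[of a n] by simp
    then have "dA a = \<one>\<^bsub>A\<^esub>" using torsion_free a unfolding torsion_free_def by auto
    then show "a = \<one>\<^bsub>A'\<^esub>" using a by (intro dA_eqI) auto
  qed
qed

lemma foldl_L':
  "\<lbrakk>x \<in> cL; set ys \<subseteq> cL\<rbrakk> \<Longrightarrow>
    foldl (bracket L') x ys \<in> cL \<and> dL (foldl (bracket L') x ys) = foldl (bracket L) (dL x) (map dL ys)"
  by (induction ys arbitrary: x) auto

lemma foldl_L'_zero:
  assumes "x \<in> cL" "set ys \<subseteq> cL"
  shows "foldl (bracket L') x ys = \<zero>\<^bsub>L'\<^esub> \<longleftrightarrow> foldl (bracket L) (dL x) (map dL ys) = \<zero>\<^bsub>L\<^esub>"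
  using foldl_L'[OF assms] dL_eqI[of "foldl (bracket L') x ys" "\<zero>\<^bsub>L'\<^esub>"] by auto

lemma tr_closed: "\<lbrakk>h \<in> H; x \<in> cL\<rbrakk> \<Longrightarrow> tr h x \<in> cL"
  and dL_tr: "\<lbrakk>h \<in> H; x \<in> cL\<rbrakk> \<Longrightarrow> dL (tr h x) = h (dL x)"
  using L0_H by (simp_all add: tr_def)

lemma trA_closed: "\<lbrakk>h \<in> H; a \<in> cA\<rbrakk> \<Longrightarrow> trA h a \<in> cA"
  and dA_trA: "\<lbrakk>h \<in> H; a \<in> cA\<rbrakk> \<Longrightarrow> dA (trA h a) = act h (dA a)"
  using A0_act by (simp_all add: trA_def)

lemma tr_Bij: "h \<in> H \<Longrightarrow> tr h \<in> Bij (carrier L')"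
proof -
  assume h: "h \<in> H"
  obtain g where g: "g \<in> H" "\<And>x. x \<in> carrier L \<Longrightarrow> h (g x) = x" "\<And>x. x \<in> carrier L \<Longrightarrow> g (h x) = x"
    using H_inverse[OF h] by metis
  have "bij_betw (tr h) (cL) (cL)"
    by (rule bij_betw_byWitness[where f' = "tr g"])
      (use h g tr_closed dL_tr in \<open>auto intro!: dL_eqI\<close>)
  then show ?thesis by (auto simp: Bij_def tr_def)
qed

lemma trA_auto: "h \<in> H \<Longrightarrow> trA h \<in> auto A'"
proof -
  assume h: "h \<in> H"
  obtain g where g: "g \<in> H" "\<And>a. a \<in> carrier A \<Longrightarrow> act h (act g a) = a" "\<And>a. a \<in> carrier A \<Longrightarrow> act g (act h a) = a"
    using H_inverse[OF h] by metis
  have "bij_betw (trA h) (cA) (cA)"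
    by (rule bij_betw_byWitness[where f' = "trA g"])
      (use h g trA_closed dA_trA in \<open>auto intro!: dA_eqI\<close>)
  moreover have "trA h \<in> hom A' A'"
    using h trA_closed dA_trA act_mult by (auto simp: hom_def intro!: dA_eqI)
  ultimately show ?thesis by (auto simp: auto_def Bij_def trA_def)
qed

lemma tr_inj: "inj_on tr H"
proof (rule inj_onI, rule ccontr)
  fix g h assume gh: "g \<in> H" "h \<in> H" "tr g = tr h" "g \<noteq> h"
  then obtain x where x: "x \<in> L0" "g x \<noteq> h x" using faithful by blast
  have "dL (tr g (eL x)) = dL (tr h (eL x))" using gh by simp
  then show False using x gh dL_tr[of g "eL x"] dL_tr[of h "eL x"] by simp
qed

lemma act'_tr: "h \<in> H \<Longrightarrow> act' (tr h) = trA h"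
  by (simp add: act'_def the_inv_into_f_f[OF tr_inj])

lemma tr_compose:
  assumes "g \<in> H" "h \<in> H"
  shows "compose (carrier L') (tr g) (tr h) = tr (compose (carrier L) g h)"
    and "compose (carrier A') (trA g) (trA h) = trA (compose (carrier L) g h)"
proof -
  show "compose (carrier L') (tr g) (tr h) = tr (compose (carrier L) g h)"
    using assms tr_closed dL_tr by (auto simp: compose_def tr_def intro!: ext)
  show "compose (carrier A') (trA g) (trA h) = trA (compose (carrier L) g h)"
    using assms H_comp(2)[OF assms] A0_act by (auto simp: compose_def trA_def intro!: ext)
qed

lemma tr_e: "tr e = \<one>\<^bsub>BijGroup (carrier L')\<^esub>"
  by (auto simp: tr_def BijGroup_def intro!: ext)

lemma H'_subgroup: "subgroup H' (BijGroup (carrier L'))"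
proof -
  interpret B: group "BijGroup (carrier L')" by (rule group_BijGroup)
  show ?thesis
  proof (rule B.subgroupI)
    show "H' \<subseteq> carrier (BijGroup (carrier L'))" using tr_Bij by (auto simp: H'_def BijGroup_def)
    show "H' \<noteq> {}" using e_in by (auto simp: H'_def)
    have mult: "tr g \<otimes>\<^bsub>BijGroup (carrier L')\<^esub> tr h = tr (compose (carrier L) g h)" if "g \<in> H" "h \<in> H" for g h
      using that tr_Bij tr_compose(1) by (simp add: BijGroup_def)
    show "x \<otimes>\<^bsub>BijGroup (carrier L')\<^esub> y \<in> H'" if "x \<in> H'" "y \<in> H'" for x y
      using that mult H_comp(1) by (auto simp: H'_def)
    fix x assume "x \<in> H'"
    then obtain h where h: "h \<in> H" "x = tr h" by (auto simp: H'_def)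
    obtain g where g: "g \<in> H" "\<And>x. x \<in> carrier L \<Longrightarrow> g (h x) = x" using H_inverse[OF h(1)] by metis
    have "compose (carrier L) g h = e" using g(2) by (auto simp: compose_def intro!: ext)
    then have "tr g \<otimes>\<^bsub>BijGroup (carrier L')\<^esub> x = \<one>\<^bsub>BijGroup (carrier L')\<^esub>"
      using mult g(1) h tr_e by simp
    then have "inv\<^bsub>BijGroup (carrier L')\<^esub> x = tr g"
      using tr_Bij g(1) h by (intro B.inv_equality) (auto simp: BijGroup_def)
    then show "inv\<^bsub>BijGroup (carrier L')\<^esub> x \<in> H'" using g(1) by (simp add: H'_def)
  qed
qed

lemma tr_component:
  assumes h: "h \<in> H" and a: "a \<in> cA"
  shows "tr h ` G' a = G' (trA h a)"
proof
  have ha: "dA a \<in> carrier A" using a by simp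
  show "tr h ` G' a \<subseteq> G' (trA h a)"
    using H_component[OF h ha] tr_closed[OF h] dL_tr[OF h] dA_trA[OF h a] by (auto simp: G'_def)
  show "G' (trA h a) \<subseteq> tr h ` G' a"
  proof
    fix y assume "y \<in> G' (trA h a)"
    then have y: "y \<in> cL" "dL y \<in> G (act h (dA a))" using dA_trA[OF h a] by (auto simp: G'_def)
    then obtain z where z: "z \<in> G (dA a)" "dL y = h z" using H_component[OF h ha] by auto
    obtain g where g: "g \<in> H" "\<And>x. x \<in> carrier L \<Longrightarrow> g (h x) = x" using H_inverse[OF h] by metis
    have "z = g (dL y)" using z g(2) G_carrier ha by metis
    then have zL: "z \<in> L0" using L0_H[OF g(1)] y by simp
    then have "y = tr h (eL z)" using y z h tr_closed dL_tr by (intro dL_eqI) auto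
    then show "y \<in> tr h ` G' a" using zL z by (auto simp: G'_def)
  qed
qed

lemma tr_lie_auto:
  assumes h: "h \<in> H"
  shows "tr h \<in> lie_auto int_ring L'"
proof -
  have hc: "h \<in> carrier L \<rightarrow> carrier L" using H_closed[OF h] by blast
  have "h (add_pow L (n::int) x) = add_pow L n (h x)" if "x \<in> carrier L" for n x
    by (rule add_pow_hom[OF hc _ that]) (rule H_add[OF h])
  then show ?thesis
    using tr_Bij[OF h] tr_closed[OF h] dL_tr[OF h] H_add[OF h] H_bracket[OF h]
    by (auto simp: lie_auto_def intro!: dL_eqI)
qed

lemma double_automorphism_group_L': "double_automorphism_group int_ring L' A' G' H' act'"
  unfolding double_automorphism_group_def
proof (intro conjI ballI)
  show "subgroup H' (BijGroup (carrier L'))" by (rule H'_subgroup)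
  have "tr g \<otimes>\<^bsub>BijGroup (carrier L')\<^esub> tr h = tr (compose (carrier L) g h)" if "g \<in> H" "h \<in> H" for g h
    using that tr_Bij tr_compose(1) by (simp add: BijGroup_def)
  moreover have "trA g \<otimes>\<^bsub>AutoGroup A'\<^esub> trA h = trA (compose (carrier L) g h)" if "g \<in> H" "h \<in> H" for g h
    using that trA_auto tr_compose(2) by (simp add: AutoGroup_def BijGroup_def auto_def)
  ultimately show "act' \<in> hom (BijGroup (carrier L')\<lparr>carrier := H'\<rparr>) (AutoGroup A')"
    using trA_auto act'_tr H_comp(1) by (auto simp: hom_def H'_def AutoGroup_def)
  fix x assume "x \<in> H'"
  then obtain h where h: "h \<in> H" "x = tr h" by (auto simp: H'_def)
  then show "double_automorphism int_ring L' A' G' x (act' x)"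
    using tr_lie_auto trA_auto tr_component act'_tr by (simp add: double_automorphism_def)
qed

lemma hyps_L': "double_automorphism_hyps q k c int_ring L' A' G' H' act'"
proof -
  interpret L': graded_lie_algebra int_ring L' A' G' by (rule graded_lie_algebra_L')
  have "ad_nilpotent int_ring L' (G' \<one>\<^bsub>A'\<^esub>) k"
    unfolding ad_nilpotent_def L'.commutator_span_eq_zero_iff
  proof (intro ballI allI impI, elim conjE)
    fix x ys assume x: "x \<in> carrier L'" and ys: "set ys \<subseteq> G' \<one>\<^bsub>A'\<^esub>" "length ys = k"
    have "set ys \<subseteq> cL" "set (map dL ys) \<subseteq> G \<one>\<^bsub>A\<^esub>" using ys(1) by (auto simp: G'_def)
    then show "foldl (bracket L') x ys = \<zero>\<^bsub>L'\<^esub>"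
      using foldl_L'_zero[of x ys] zero_component_nilpotent[of "dL x" "map dL ys"] x ys(2) by simp
  qed
  moreover have "card H' = q" using card_image[OF tr_inj] card_H by (simp add: H'_def)
  moreover have "fixed_point_free L' A' H' act'"
    unfolding fixed_point_free_def
  proof (intro ballI impI)
    fix x assume "x \<in> H'" "x \<noteq> \<one>\<^bsub>BijGroup (carrier L')\<^esub>"
    then obtain h where h: "h \<in> H" "x = tr h" "h \<noteq> e" using tr_e by (auto simp: H'_def)
    have "a = \<one>\<^bsub>A'\<^esub>" if "a \<in> cA" "trA h a = a" for a
      using H_fixed_point_free[OF h(1,3), of "dA a"] dA_trA[OF h(1) that(1)] that by (intro dA_eqI) auto
    moreover have "trA h \<one>\<^bsub>A'\<^esub> = \<one>\<^bsub>A'\<^esub>"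
      using trA_auto[OF h(1)] L'.A.is_group by (auto simp: auto_def hom_one)
    ultimately show "{a \<in> carrier A'. act' x a = a} = {\<one>\<^bsub>A'\<^esub>}" using act'_tr h by auto
  qed
  moreover have "nilpotent_of_class int_ring L' (fixed_subalgebra L' H') c"
    unfolding nilpotent_of_class_def L'.commutator_span_eq_zero_iff
  proof (intro ballI allI impI, elim conjE)
    have fix_dL: "dL x \<in> fixed_subalgebra L H" "x \<in> cL" if "x \<in> fixed_subalgebra L' H'" for x
      using that dL_tr by (fastforce simp: fixed_subalgebra_def H'_def)+
    fix x ys assume x: "x \<in> fixed_subalgebra L' H'" and ys: "set ys \<subseteq> fixed_subalgebra L' H'" "length ys = c"
    have "set ys \<subseteq> cL" "set (map dL ys) \<subseteq> fixed_subalgebra L H" using ys(1) fix_dL by auto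
    then show "foldl (bracket L') x ys = \<zero>\<^bsub>L'\<^esub>"
      using foldl_L'_zero[of x ys] fixed_nilpotent[of "dL x" "map dL ys"] fix_dL[OF x] ys(2) by simp
  qed
  ultimately show ?thesis
    using graded_lie_algebra_L' torsion_free_A' double_automorphism_group_L' finite_H
    by (simp add: double_automorphism_hyps_def H'_def)
qed

end

text \<open>A nonzero commutator with \<open>n + 1\<close> entries, together with elements that tell the members of \<open>H\<close>
  apart, lies in a countable substructure that satisfies the same hypotheses. Telling them apart keeps
  the order \<open>q\<close> of the group. The substructure is closed under the homogeneous components of its
  elements and hence graded.\<close>

theorem (in double_automorphism_setting) nilpotent_of_class_countable:
  assumes small: "\<And>(R' :: int ring) (L' :: (int, nat) lie_algebra) (A' :: nat monoid) G' H' act'.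
    double_automorphism_hyps q k c R' L' A' G' H' act' \<Longrightarrow> nilpotent_of_class R' L' (carrier L') n"
  shows "nilpotent_of_class R L (carrier L) n"
proof -
  have "foldl (bracket L) x ys = \<zero>\<^bsub>L\<^esub>"
    if x: "x \<in> carrier L" and ys: "set ys \<subseteq> carrier L" "length ys = n" for x ys
  proof -
    have "\<exists>x. x \<in> carrier L \<and> fst p x \<noteq> snd p x" if "p \<in> {p \<in> H \<times> H. fst p \<noteq> snd p}" for p
    proof (rule ccontr)
      assume *: "\<not> ?thesis"
      have "fst p \<in> extensional (carrier L)" "snd p \<in> extensional (carrier L)"
        using that H_Bij[of "fst p"] H_Bij[of "snd p"] Bij_imp_extensional by (auto simp: mem_Times_iff)
      then have "fst p = snd p" by (rule extensionalityI) (use * in blast)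
      then show False using that by simp
    qed
    then obtain w where w': "\<forall>p\<in>{p \<in> H \<times> H. fst p \<noteq> snd p}. w p \<in> carrier L \<and> fst p (w p) \<noteq> snd p (w p)"
      using bchoice[of "{p \<in> H \<times> H. fst p \<noteq> snd p}" "\<lambda>p x. x \<in> carrier L \<and> fst p x \<noteq> snd p x"] by blast
    have w: "w (g, h) \<in> carrier L" "g (w (g, h)) \<noteq> h (w (g, h))" if "g \<in> H" "h \<in> H" "g \<noteq> h" for g h
      using bspec[OF w', of "(g, h)"] that by auto
    define B where "B = insert \<zero>\<^bsub>L\<^esub> (insert x (set ys \<union> w ` {p \<in> H \<times> H. fst p \<noteq> snd p}))"
    define opL where "opL x y = {x \<oplus>\<^bsub>L\<^esub> y, \<ominus>\<^bsub>L\<^esub> x, bracket L x y} \<union> (\<lambda>h. h x) ` H \<union>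
      (\<lambda>a. proj a x) ` carrier A" for x y
    have proj_countable: "countable ((\<lambda>a. proj a x) ` carrier A)" if "x \<in> carrier L" for x
    proof -
      have "(\<lambda>a. proj a x) ` carrier A \<subseteq>
          insert \<zero>\<^bsub>L\<^esub> ((\<lambda>a. proj a x) ` {a \<in> carrier A. proj a x \<noteq> \<zero>\<^bsub>L\<^esub>})" by auto
      then show ?thesis
        using homogeneous_decomposition(2)[OF that] by (meson countable_finite finite.insertI finite_imageI finite_subset)
    qed
    have "finite {p \<in> H \<times> H. fst p \<noteq> snd p}" using finite_H by simp
    then have B: "countable B" by (simp add: B_def countable_finite)
    have BL: "B \<subseteq> carrier L" using x ys(1) w(1) by (auto simp: B_def)
    have opL: "countable (opL x y) \<and> opL x y \<subseteq> carrier L" if "x \<in> carrier L" "y \<in> carrier L" for x y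
    proof
      show "countable (opL x y)"
        using proj_countable[OF that(1)] finite_H by (simp add: opL_def countable_finite)
      have "proj a x \<in> carrier L" if "a \<in> carrier A" for a
        using homogeneous_decomposition(1)[OF \<open>x \<in> carrier L\<close> that] G_carrier[OF that] by simp
      moreover have "h x \<in> carrier L" if "h \<in> H" for h using H_closed[OF that \<open>x \<in> carrier L\<close>] .
      ultimately have "(\<lambda>h. h x) ` H \<subseteq> carrier L" "(\<lambda>a. proj a x) ` carrier A \<subseteq> carrier L" by blast+
      then show "opL x y \<subseteq> carrier L"
        using that bracket_closed[OF that] by (simp add: opL_def)
    qed
    obtain L0 where L0: "countable L0" "B \<subseteq> L0" "L0 \<subseteq> carrier L"
      and L0_closed: "\<And>x y. x \<in> L0 \<Longrightarrow> y \<in> L0 \<Longrightarrow> opL x y \<subseteq> L0"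
      by (rule countable_closure[where op = opL, OF B BL opL], assumption, assumption, rule that)
    define BA where "BA = insert \<one>\<^bsub>A\<^esub> (\<Union>x\<in>L0. {a \<in> carrier A. proj a x \<noteq> \<zero>\<^bsub>L\<^esub>})"
    define opA where "opA a b = {a \<otimes>\<^bsub>A\<^esub> b, inv\<^bsub>A\<^esub> a} \<union> (\<lambda>h. act h a) ` H" for a b
    have BA: "countable BA"
      unfolding BA_def using L0 homogeneous_decomposition(2)
      by (intro countable_insert countable_UN) (auto intro!: countable_finite)
    have BAA: "BA \<subseteq> carrier A" by (auto simp: BA_def)
    have opA: "countable (opA a b) \<and> opA a b \<subseteq> carrier A" if "a \<in> carrier A" "b \<in> carrier A" for a b
      using that finite_H act_closed by (auto simp: opA_def countable_finite)
    obtain A0 where A0: "countable A0" "BA \<subseteq> A0" "A0 \<subseteq> carrier A"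
      and A0_closed: "\<And>x y. x \<in> A0 \<Longrightarrow> y \<in> A0 \<Longrightarrow> opA x y \<subseteq> A0"
      by (rule countable_closure[where op = opA, OF BA BAA opA], assumption, assumption, rule that)
    obtain eL :: "'l \<Rightarrow> nat" where eL: "inj_on eL L0" using L0(1) by (auto simp: countable_def)
    obtain eA :: "'a \<Rightarrow> nat" where eA: "inj_on eA A0" using A0(1) by (auto simp: countable_def)
    interpret X: double_automorphism_restriction R L A G H act q k c L0 A0 eL eA
    proof unfold_locales
      show "\<zero>\<^bsub>L\<^esub> \<in> L0" using L0(2) by (auto simp: B_def)
      show "\<one>\<^bsub>A\<^esub> \<in> A0" using A0(2) by (auto simp: BA_def)
      show "a \<in> A0" if "a \<in> carrier A" "x \<in> L0" "proj a x \<noteq> \<zero>\<^bsub>L\<^esub>" for a x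
        using A0(2) that by (auto simp: BA_def)
      show "\<exists>x\<in>L0. g x \<noteq> h x" if "g \<in> H" "h \<in> H" "g \<noteq> h" for g h
        using w[OF that] L0(2) that by (intro bexI[of _ "w (g, h)"]) (auto simp: B_def)
      show "x \<oplus>\<^bsub>L\<^esub> y \<in> L0" "bracket L x y \<in> L0" if "x \<in> L0" "y \<in> L0" for x y
        using L0_closed[OF that] by (auto simp: opL_def)
      show "\<ominus>\<^bsub>L\<^esub> x \<in> L0" if "x \<in> L0" for x using L0_closed[OF that that] by (auto simp: opL_def)
      show "h x \<in> L0" if "h \<in> H" "x \<in> L0" for h x
        using L0_closed[OF that(2,2)] that(1) by (auto simp: opL_def)
      show "proj a x \<in> L0" if "a \<in> carrier A" "x \<in> L0" for a x
        using L0_closed[OF that(2,2)] that(1) by (auto simp: opL_def)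
      show "a \<otimes>\<^bsub>A\<^esub> b \<in> A0" if "a \<in> A0" "b \<in> A0" for a b using A0_closed[OF that] by (auto simp: opA_def)
      show "inv\<^bsub>A\<^esub> a \<in> A0" if "a \<in> A0" for a using A0_closed[OF that that] by (auto simp: opA_def)
      show "act h a \<in> A0" if "h \<in> H" "a \<in> A0" for h a
        using A0_closed[OF that(2,2)] that(1) by (auto simp: opA_def)
    qed (fact L0(3) A0(3) eL eA)+
    interpret L': graded_lie_algebra int_ring X.L' X.A' X.G' by (rule X.graded_lie_algebra_L')
    have xL0: "x \<in> L0" "set ys \<subseteq> L0" using L0(2) by (auto simp: B_def)
    have in_cL: "eL x \<in> X.cL" "set (map eL ys) \<subseteq> X.cL" using xL0 X.eL_in by auto
    have "\<forall>x\<in>X.cL. \<forall>ys. set ys \<subseteq> X.cL \<and> length ys = n \<longrightarrow> foldl (bracket X.L') x ys = \<zero>\<^bsub>X.L'\<^esub>"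
      using small[OF X.hyps_L']
      unfolding nilpotent_of_class_def L'.commutator_span_eq_zero_iff X.carrier_L' .
    then have "foldl (bracket X.L') (eL x) (map eL ys) = \<zero>\<^bsub>X.L'\<^esub>"
      using in_cL ys(2) by simp
    moreover have "map X.dL (map eL ys) = ys" using xL0(2) X.dL_eL by (simp add: map_idI subset_iff)
    ultimately show ?thesis using X.foldl_L'_zero[OF in_cL] X.dL_eL[OF xL0(1)] by simp
  qed
  then show ?thesis unfolding nilpotent_of_class_def commutator_span_eq_zero_iff by blast
qed

lemma double_automorphism_settingI:
  "double_automorphism_hyps q k c R L A G H act \<Longrightarrow> double_automorphism_setting R L A G H act q k c"
  by (simp add: double_automorphism_setting_def double_automorphism_setting_axioms_def
      double_automorphism_hyps_def)

text \<open>By the explicit bound, the set of numbers whose least element is \<open>class_bound q k c\<close> is not empty,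
  so \<open>class_bound q k c\<close> itself is a bound for the countable structures. The reduction extends it to
  all others.\<close>

theorem theorem1p3:
  fixes q k c :: nat
    and R :: "('r, 'm) ring_scheme"
    and L :: "('r, 'l, 'n) lie_algebra_scheme"
    and A :: "('a, 'p) monoid_scheme"
    and G :: "'a \<Rightarrow> 'l set"
    and H :: "('l \<Rightarrow> 'l) set"
    and act :: "('l \<Rightarrow> 'l) \<Rightarrow> 'a \<Rightarrow> 'a"
  assumes "q > 0" and "k > 0" and "c > 0"
    and "double_automorphism_hyps q k c R L A G H act"
  shows "nilpotent_of_class R L (carrier L) (class_bound q k c)"
proof -
  have "\<forall>(R :: int ring) (L :: (int, nat) lie_algebra) (A :: nat monoid) G H act.
      double_automorphism_hyps q k c R L A G H act \<longrightarrow>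
      nilpotent_of_class R L (carrier L) (class_bound q k c)"
    unfolding class_bound_def
    by (rule LeastI[of _ "nilpotency_bound q k c"], intro allI impI,
        rule double_automorphism_setting.nilpotent_of_class_nilpotency_bound[OF double_automorphism_settingI])
  then show ?thesis
    by (intro double_automorphism_setting.nilpotent_of_class_countable
        [OF double_automorphism_settingI[OF assms(4)]]) blast
qed

end
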